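(* Let $\mathds{T}_4$ be the $4$-graph on $[7]$ with edges $\{1234,1235,4567\}$. There exist constants $N_0$ and $c>0$ such that for all integers $n\ge N_0$ and all integers $t\in[0,cn]$ we have \[ \mathrm{EX}(n,(t+1)\mathds{T}_4)=\{K_t^4\bowtie T_4(n-t,4)\}. \]
   Context: For $\ell\ge r$, $T_r(n,\ell)$ is the $r$-graph on $[n]=V_1\cup\dots\cup V_\ell$ with $|V_i|\in\{\lfloor n/\ell\rfloor,\lceil n/\ell\rceil\}$ whose edges are all $r$-sets containing at most one vertex from each $V_i$. $K_t^r$ is the complete $r$-graph on $t$ vertices. For $r$-graphs $\mathcal{G},\mathcal{H}$ on disjoint vertex sets, $\mathcal{G}\bowtie\mathcal{H}$ consists of the edges of both plus all $r$-subsets of $V(\mathcal{G})\cup V(\mathcal{H})$ meeting both. $\mathrm{EX}(n,(t+1)F)$ is the set (up to isomorphism) of $n$-vertex $r$-graphs not containing $t+1$ pairwise vertex-disjoint copies of $F$ with the maximum number of edges among such. *)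

theory Defs
  imports Complex_Main
begin

datatype 'a hypergraph = Hypergraph (verts: "'a set") (edges: "'a set set")

definition hypergraph :: "'a hypergraph \<Rightarrow> bool" where
  "hypergraph H \<longleftrightarrow> finite (verts H) \<and> (\<forall>e\<in>edges H. e \<subseteq> verts H)"

definition r_graph :: "nat \<Rightarrow> 'a hypergraph \<Rightarrow> bool" where
  "r_graph r H \<longleftrightarrow> hypergraph H \<and> (\<forall>e\<in>edges H. card e = r)"

(* Well-formedness is part of isomorphism: otherwise an edge of G leaving the vertex set of G
   could still be mapped onto an edge of H. *)
definition isomorphic :: "'a hypergraph \<Rightarrow> 'b hypergraph \<Rightarrow> bool" where
  "isomorphic G H \<longleftrightarrow> hypergraph G \<and> hypergraph H \<and>
     (\<exists>f. bij_betw f (verts G) (verts H) \<and> (\<lambda>e. f ` e) ` edges G = edges H)"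

(* Every finite hypergraph, on any vertex type, is isomorphic to one on natural numbers, so the
   isomorphism type of H is represented by the set of its isomorphic copies on natural numbers. *)
definition iso_class :: "'a hypergraph \<Rightarrow> nat hypergraph set" where
  "iso_class H = {G. isomorphic G H}"

(* A copy is a not necessarily induced subhypergraph. *)
definition is_copy_in :: "'a hypergraph \<Rightarrow> 'b hypergraph \<Rightarrow> 'a hypergraph \<Rightarrow> bool" where
  "is_copy_in C F H \<longleftrightarrow> verts C \<subseteq> verts H \<and> edges C \<subseteq> edges H \<and> isomorphic C F"

definition contains_disjoint_copies ::
    "nat \<Rightarrow> 'b hypergraph \<Rightarrow> 'a hypergraph \<Rightarrow> bool" where
  "contains_disjoint_copies k F H \<longleftrightarrow>
     (\<exists>C. (\<forall>i<k. is_copy_in (C i) F H) \<and>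
          (\<forall>i<k. \<forall>j<k. i \<noteq> j \<longrightarrow> verts (C i) \<inter> verts (C j) = {}))"

definition free_graphs :: "nat \<Rightarrow> nat \<Rightarrow> nat \<Rightarrow> 'b hypergraph \<Rightarrow> nat hypergraph set" where
  "free_graphs r n k F =
     {H. r_graph r H \<and> card (verts H) = n \<and> \<not> contains_disjoint_copies k F H}"

(* Ex_classes r n k F is EX(n, kF) for r-graphs; its elements are isomorphism classes. *)
definition Ex_classes :: "nat \<Rightarrow> nat \<Rightarrow> nat \<Rightarrow> 'b hypergraph \<Rightarrow> nat hypergraph set set" where
  "Ex_classes r n k F = iso_class `
     {H \<in> free_graphs r n k F. \<forall>G\<in>free_graphs r n k F. card (edges G) \<le> card (edges H)}"

definition complete_graph :: "nat \<Rightarrow> nat \<Rightarrow> nat hypergraph" where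
  "complete_graph r t = Hypergraph {1..t} {e. e \<subseteq> {1..t} \<and> card e = r}"

(* The parts are indexed by i < l. Residue classes give one concrete balanced partition;
   lemma card_turan_part states the prescribed sizes. *)
definition turan_part :: "nat \<Rightarrow> nat \<Rightarrow> nat \<Rightarrow> nat set" where
  "turan_part n l i = {x \<in> {1..n}. x mod l = i}"

definition turan_graph :: "nat \<Rightarrow> nat \<Rightarrow> nat \<Rightarrow> nat hypergraph" where
  "turan_graph r n l = Hypergraph {1..n}
     {e. e \<subseteq> {1..n} \<and> card e = r \<and> (\<forall>i<l. card (e \<inter> turan_part n l i) \<le> 1)}"

(* The sum type makes the two vertex sets disjoint. *)
definition join :: "nat \<Rightarrow> 'a hypergraph \<Rightarrow> 'b hypergraph \<Rightarrow> ('a + 'b) hypergraph" where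
  "join r G H = Hypergraph (verts G <+> verts H)
     ((\<lambda>e. Inl ` e) ` edges G \<union> (\<lambda>e. Inr ` e) ` edges H \<union>
      {e. e \<subseteq> verts G <+> verts H \<and> card e = r \<and>
          e \<inter> Inl ` verts G \<noteq> {} \<and> e \<inter> Inr ` verts H \<noteq> {}})"

definition T4 :: "nat hypergraph" where
  "T4 = Hypergraph {1..7} {{1,2,3,4}, {1,2,3,5}, {4,5,6,7}}"

lemma r_graph_T4: "r_graph 4 T4"
  by (auto simp: r_graph_def hypergraph_def T4_def)

lemma UN_turan_part: "l > 0 \<Longrightarrow> (\<Union>i<l. turan_part n l i) = {1..n}"
  by (auto simp: turan_part_def)

lemma disjoint_turan_part: "i \<noteq> j \<Longrightarrow> turan_part n l i \<inter> turan_part n l j = {}"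
  by (auto simp: turan_part_def)

lemma card_turan_part_step:
  assumes "i < l"
  shows "card (turan_part (n + l) l i) = Suc (card (turan_part n l i))"
proof -
  define m where "m = (n + l - i) mod l"
  define q where "q = (n + l - i) div l"
  define x where "x = i + l * q"
  have e: "n + l - i = l * q + m" by (simp add: m_def q_def)
  have m: "m < l" using assms by (simp add: m_def)
  have x: "n < x" "x \<le> n + l" "x mod l = i" using e m assms by (auto simp: x_def)
  have "y = x" if y: "n < y" "y \<le> n + l" "y mod l = i" for y
  proof (rule ccontr)
    assume "y \<noteq> x"
    then consider "x < y" | "y < x" by linarith
    then show False
    proof cases
      case 1
      then have "l dvd y - x" using x y by (metis mod_eq_dvd_iff_nat less_imp_le_nat)
      moreover have "0 < y - x" "y - x < l" using 1 x y by auto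
      ultimately show False by (simp add: nat_dvd_not_less)
    next
      case 2
      then have "l dvd x - y" using x y by (metis mod_eq_dvd_iff_nat less_imp_le_nat)
      moreover have "0 < x - y" "x - y < l" using 2 x y by auto
      ultimately show False by (simp add: nat_dvd_not_less)
    qed
  qed
  then have "turan_part (n + l) l i = insert x (turan_part n l i)"
    using x by (fastforce simp: turan_part_def)
  moreover have "x \<notin> turan_part n l i" using x by (auto simp: turan_part_def)
  moreover have "finite (turan_part n l i)" by (simp add: turan_part_def)
  ultimately show ?thesis by simp
qed

lemma card_turan_part:
  assumes "i < l"
  shows "int (card (turan_part n l i)) \<in> {\<lfloor>real n / real l\<rfloor>, \<lceil>real n / real l\<rceil>}"
proof (induction n rule: less_induct)
  case (less n)
  show ?case
  proof (cases "n < l")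
    case True
    have s: "turan_part n l i \<subseteq> {i}" using True by (auto simp: turan_part_def)
    then have c: "card (turan_part n l i) \<le> 1" using card_mono[OF _ s] by simp
    have "\<lfloor>real n / real l\<rfloor> = 0" using True by (auto simp: floor_eq_iff)
    moreover have "\<lceil>real n / real l\<rceil> = 1" if "n > 0"
      using True that by (auto simp: ceiling_eq_iff)
    moreover have "turan_part n l i = {}" if "n = 0" using that by (auto simp: turan_part_def)
    ultimately show ?thesis using c by (cases "n = 0") (auto simp: le_Suc_eq)
  next
    case False
    define k where "k = n - l"
    have n: "n = k + l" using False by (simp add: k_def)
    have "real n / real l = real k / real l + 1" using assms by (simp add: n field_simps)
    then show ?thesis using less[of k] assms card_turan_part_step[OF assms, of k]
      by (auto simp: n)
  qed
qed

end

theory Submission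
  imports Defs
begin

text \<open>After deleting the edges through pairs of small codegree, a \<open>T4\<close>-free 4-graph is cancellative: the
  links of two vertices of a common edge are disjoint. Symmetrization with vertex weights turns a dense
  cancellative 4-graph into one in which every pair is covered, and there the degree conditions
  leave only a single edge. Undoing the symmetrization one unit of weight at a time, every vertex of
  large degree has to join one of the four classes, so the 4-graph is 4-partite up to a
  small set of vertices. The same extension argument applied directly to \<open>T4\<close>-free 4-graphs of large minimum
  degree shows that they are 4-partite, hence the exact result for \<open>t = 0\<close> by deleting vertices of
  small degree. For general \<open>t\<close>, a vertex of large degree lies in a copy of \<open>T4\<close> avoiding any given small
  set, so there are at most \<open>t\<close> of them; if there were fewer than \<open>t\<close>, the vertices of a maximal packing of
  the remaining 4-graph would meet too few edges.\<close>

section \<open>Weighted set systems and their links\<close>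

text \<open>For integral \<open>x\<close>, \<open>wt x F\<close> counts the edges of the blow-up
  replacing \<open>v\<close> by \<open>x v\<close> copies. Cloning is thus done in the weights, the
  edge set stays fixed, and cancellativity never has to be re-proved.

  All thresholds surround the balanced 4-partite 4-graph with about n^4/256 edges and degrees about
  n^3/64 = 0.015625 n^3. Making a 4-graph cancellative costs O(n^3) edges, which ruins exactness;
  hence the cleaned edges \<open>F\<close> only serve to find a colouring, which is then extended
  over all original edges.

  A vertex is large if its degree is at least 0.03 n^3. This number exceeds 0.0178 n^3, the bound
  for the triples missing one fixed class, so a large link cannot consist of such triples alone. On
  the other side, with r = t - s large vertices missing, the 7r vertices of a packing meet fewer
  than 7r * 0.03 n^3 = 0.21 r n^3 edges, whereas in the extremal 4-graph r full vertices and 6r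
  Turan vertices account for about (1/6 + 6/64) r n^3 = 0.26 r n^3.

  The ratio 10^-10 for t/n keeps the loss from deleting 7t vertices below 10^-9 n^4, within the
  tolerance of the stability result.\<close>

definition wt :: "('a \<Rightarrow> real) \<Rightarrow> 'a set set \<Rightarrow> real" where
  "wt x F = (\<Sum>T\<in>F. \<Prod>v\<in>T. x v)"

definition lnk :: "'a set set \<Rightarrow> 'a \<Rightarrow> 'a set set" where
  "lnk F v = {T. v \<notin> T \<and> insert v T \<in> F}"

definition cov :: "'a set set \<Rightarrow> 'a \<Rightarrow> 'a \<Rightarrow> bool" where
  "cov F u v \<longleftrightarrow> (\<exists>e\<in>F. u \<in> e \<and> v \<in> e)"

lemma lnk_subset: "lnk F v \<subseteq> (\<lambda>e. e - {v}) ` F"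
proof
  fix T assume "T \<in> lnk F v"
  then have "insert v T \<in> F" "T = insert v T - {v}" by (auto simp: lnk_def)
  then show "T \<in> (\<lambda>e. e - {v}) ` F" by blast
qed

lemma lnk_uniform:
  assumes "F \<subseteq> {T. T \<subseteq> S \<and> card T = Suc k}" "finite S"
  shows "lnk F a \<subseteq> {T. T \<subseteq> S \<and> card T = k}"
proof
  fix T assume "T \<in> lnk F a"
  then have a: "a \<notin> T" and "insert a T \<in> F" by (auto simp: lnk_def)
  then have T: "insert a T \<subseteq> S" "card (insert a T) = Suc k" using assms(1) by blast+
  then have "finite T" using assms(2) by (meson finite_insert finite_subset)
  then show "T \<in> {T. T \<subseteq> S \<and> card T = k}" using T a card_insert_disjoint[of T a] by simp
qed

lemma finite_lnk: "finite F \<Longrightarrow> finite (lnk F v)"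
  using lnk_subset by (metis finite_imageI finite_subset)

lemma lnk_mono: "F \<subseteq> G \<Longrightarrow> lnk F v \<subseteq> lnk G v"
  by (auto simp: lnk_def)

lemma cov_sym: "cov F u v \<longleftrightarrow> cov F v u"
  by (auto simp: cov_def)

lemma wt_const_1 [simp]: "wt (\<lambda>_. 1) F = real (card F)"
  by (simp add: wt_def)

lemma wt_mono:
  assumes "F \<subseteq> G" "finite G" "\<forall>v. 0 \<le> x v"
  shows "wt x F \<le> wt x G"
  unfolding wt_def using assms by (intro sum_mono2) (auto intro: prod_nonneg)

lemma wt_nonneg:
  assumes "\<forall>v. 0 \<le> x v"
  shows "0 \<le> wt x F"
  unfolding wt_def using assms by (intro sum_nonneg prod_nonneg) auto

lemma wt_Un_Int:
  assumes "finite F" "finite G"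
  shows "wt x (F \<union> G) + wt x (F \<inter> G) = wt x F + wt x G"
  unfolding wt_def using assms by (rule sum.union_inter)

lemma wt_Un_le:
  assumes "finite F" "finite G" "\<forall>v. 0 \<le> x v"
  shows "wt x (F \<union> G) \<le> wt x F + wt x G"
  using wt_Un_Int[OF assms(1,2), of x] wt_nonneg[of x "F \<inter> G"] assms(3) by simp

lemma wt_UN_le:
  assumes "finite I" "\<And>i. i \<in> I \<Longrightarrow> finite (F i)" "\<forall>v. 0 \<le> x v"
  shows "wt x (\<Union>i\<in>I. F i) \<le> (\<Sum>i\<in>I. wt x (F i))"
  using assms(1,2)
proof (induction I rule: finite_induct)
  case empty
  then show ?case by (simp add: wt_def)
next
  case (insert i I)
  have "wt x (F i \<union> (\<Union>i\<in>I. F i)) \<le> wt x (F i) + wt x (\<Union>i\<in>I. F i)"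
    using insert assms(3) by (intro wt_Un_le) auto
  then show ?case using insert by simp
qed

text \<open>Inclusion-exclusion inside \<open>C\<close>: two families that together outweigh
  \<open>C\<close> must overlap. Every common triple of two links needed later is produced this
  way.\<close>

lemma wt_inter_ge:
  assumes "F \<subseteq> C" "G \<subseteq> C" "finite C" "\<forall>v. 0 \<le> x v"
  shows "wt x F + wt x G - wt x C \<le> wt x (F \<inter> G)"
proof -
  have "wt x (F \<union> G) \<le> wt x C" using assms by (intro wt_mono) auto
  moreover have "finite F" "finite G" using assms finite_subset by blast+
  ultimately show ?thesis using wt_Un_Int[of F G x] by simp
qed

lemma wt_star:
  assumes "finite F" "\<forall>T\<in>F. finite T"
  shows "wt x {T \<in> F. a \<in> T} = x a * wt x (lnk F a)"
proof -
  have "wt x {T \<in> F. a \<in> T} = (\<Sum>T\<in>lnk F a. \<Prod>v\<in>insert a T. x v)"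
    unfolding wt_def
    by (rule sum.reindex_bij_witness[where i = "insert a" and j = "\<lambda>T. T - {a}"])
      (auto simp: lnk_def insert_absorb)
  also have "\<dots> = (\<Sum>T\<in>lnk F a. x a * (\<Prod>v\<in>T. x v))"
  proof (rule sum.cong[OF refl])
    fix T assume "T \<in> lnk F a"
    then have "a \<notin> T" "finite T" using assms(2) by (auto simp: lnk_def)
    then show "(\<Prod>v\<in>insert a T. x v) = x a * (\<Prod>v\<in>T. x v)" by simp
  qed
  finally show ?thesis by (simp add: wt_def sum_distrib_left)
qed

text \<open>Double counting. By \<open>wt_star\<close> the term for \<open>a\<close> is the weight
  of the members of \<open>F\<close> containing \<open>a\<close>, so \<open>T\<close> is counted
  once for each of its points in \<open>A\<close>.\<close>

lemma sum_lnk: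
  assumes "finite F" "\<forall>T\<in>F. finite T" "finite A"
  shows "(\<Sum>a\<in>A. x a * wt x (lnk F a)) = (\<Sum>T\<in>F. real (card (T \<inter> A)) * (\<Prod>v\<in>T. x v))"
proof -
  have "(\<Sum>a\<in>A. x a * wt x (lnk F a)) = (\<Sum>a\<in>A. \<Sum>T\<in>F. if a \<in> T then \<Prod>v\<in>T. x v else 0)"
    using wt_star[OF assms(1,2), symmetric] assms(1)
    by (intro sum.cong) (auto simp: wt_def sum.If_cases Int_def)
  also have "\<dots> = (\<Sum>T\<in>F. \<Sum>a\<in>A. if a \<in> T then \<Prod>v\<in>T. x v else 0)"
    by (rule sum.swap)
  also have "\<dots> = (\<Sum>T\<in>F. real (card (T \<inter> A)) * (\<Prod>v\<in>T. x v))"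
    using assms(3) by (intro sum.cong refl) (simp add: sum.If_cases Int_commute)
  finally show ?thesis .
qed

lemma sum_lnk_uniform:
  assumes "finite F" "\<forall>T\<in>F. finite T" "finite A" "\<forall>T\<in>F. card (T \<inter> A) = k"
  shows "(\<Sum>a\<in>A. x a * wt x (lnk F a)) = real k * wt x F"
proof -
  have "(\<Sum>T\<in>F. real (card (T \<inter> A)) * (\<Prod>v\<in>T. x v)) = (\<Sum>T\<in>F. real k * (\<Prod>v\<in>T. x v))"
    by (rule sum.cong[OF refl]) (simp add: assms(4))
  then show ?thesis by (simp add: sum_lnk[OF assms(1-3)] wt_def[of x F] sum_distrib_left)
qed

lemma wt_le_sum_lnk:
  assumes "finite F" "\<forall>T\<in>F. finite T" "finite A" "\<forall>T\<in>F. T \<inter> A \<noteq> {}"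
    and x: "\<forall>v. 0 \<le> x v"
  shows "wt x F \<le> (\<Sum>a\<in>A. x a * wt x (lnk F a))"
  unfolding sum_lnk[OF assms(1-3)] wt_def[of x F]
proof (rule sum_mono)
  fix T assume "T \<in> F"
  then have "1 \<le> card (T \<inter> A)" using assms by (simp add: Suc_le_eq card_gt_0_iff)
  then show "(\<Prod>v\<in>T. x v) \<le> real (card (T \<inter> A)) * (\<Prod>v\<in>T. x v)"
    using prod_nonneg[of T x] x mult_right_mono[of 1 "real (card (T \<inter> A))" "\<Prod>v\<in>T. x v"] by auto
qed

text \<open>The power expands over all \<open>k\<close>-tuples from \<open>S\<close>, and every
  \<open>k\<close>-set occurs among them. Peeling off one vertex through the links turns this into
  an induction on \<open>k\<close>.\<close>

lemma wt_card_le: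
  assumes "finite S" "F \<subseteq> {T. T \<subseteq> S \<and> card T = k}" "\<forall>v. 0 \<le> x v"
  shows "wt x F \<le> (\<Sum>v\<in>S. x v) ^ k"
  using assms(2)
proof (induction k arbitrary: F)
  case 0
  have "T = {}" if "T \<in> F" for T
    using that 0 finite_subset[OF _ assms(1), of T] by auto
  then have "F \<subseteq> {{}}" by auto
  then have "F = {} \<or> F = {{}}" by auto
  then show ?case by (auto simp: wt_def)
next
  case (Suc k)
  have fin: "\<forall>T\<in>F. finite T" using Suc.prems assms(1) by (auto dest: finite_subset)
  have finF: "finite F" using Suc.prems assms(1) by (auto intro: finite_subset[of F "Pow S"])
  have "wt x F \<le> (\<Sum>a\<in>S. x a * wt x (lnk F a))"
  proof (rule wt_le_sum_lnk[OF finF fin assms(1) _ assms(3)], rule ballI)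
    fix T assume "T \<in> F"
    then have "T \<subseteq> S" "card T = Suc k" using Suc.prems by auto
    then show "T \<inter> S \<noteq> {}" by (auto simp: Int_absorb2)
  qed
  also have "\<dots> \<le> (\<Sum>a\<in>S. x a * (\<Sum>v\<in>S. x v) ^ k)"
    by (intro sum_mono mult_left_mono spec[OF assms(3)] Suc.IH lnk_uniform Suc.prems assms(1))
  finally show ?case by (simp add: sum_distrib_right)
qed

text \<open>The same peeling, with the first vertex taken in \<open>Y\<close>. This is how the sets
  meeting a small exceptional set are discarded throughout.\<close>

lemma wt_hit_le:
  assumes "finite S" "Y \<subseteq> S" "F \<subseteq> {T. T \<subseteq> S \<and> card T = Suc k \<and> T \<inter> Y \<noteq> {}}" "\<forall>v. 0 \<le> x v"
  shows "wt x F \<le> (\<Sum>v\<in>Y. x v) * (\<Sum>v\<in>S. x v) ^ k"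
proof -
  have fin: "\<forall>T\<in>F. finite T" using assms(1,3) by (auto dest: finite_subset)
  have finF: "finite F" using assms(1,3) by (auto intro: finite_subset[of F "Pow S"])
  have finY: "finite Y" using assms(1,2) by (rule rev_finite_subset)
  have "wt x F \<le> (\<Sum>a\<in>Y. x a * wt x (lnk F a))"
    using assms(3) by (intro wt_le_sum_lnk[OF finF fin finY _ assms(4)]) auto
  also have "\<dots> \<le> (\<Sum>a\<in>Y. x a * (\<Sum>v\<in>S. x v) ^ k)"
    using assms(3)
    by (intro sum_mono mult_left_mono spec[OF assms(4)] wt_card_le[OF assms(1)] lnk_uniform[OF _ assms(1)] assms(4)) blast
  finally show ?thesis by (simp add: sum_distrib_right)
qed

section \<open>Transversal sets of a colouring and the bound from AM-GM\<close>

definition crossing :: "'a set \<Rightarrow> ('a \<Rightarrow> nat) \<Rightarrow> nat set \<Rightarrow> 'a set set" where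
  "crossing S c I = {T. T \<subseteq> S \<and> inj_on c T \<and> c ` T = I}"

lemma finite_crossing: "finite S \<Longrightarrow> finite (crossing S c I)"
  by (rule finite_subset[of _ "Pow S"]) (auto simp: crossing_def)

text \<open>A transversal is a free choice of one vertex per class: fixing its vertex
  \<open>a\<close> of colour \<open>i\<close> leaves exactly the transversals of the other colours,
  which gives the induction on \<open>I\<close>.\<close>

lemma wt_crossing:
  assumes "finite S" "finite I"
  shows "wt x (crossing S c I) = (\<Prod>i\<in>I. \<Sum>s\<in>{s\<in>S. c s = i}. x s)"
  using assms(2)
proof (induction I rule: finite_induct)
  case empty
  have "crossing S c {} = {{}}" by (auto simp: crossing_def)
  then show ?case by (simp add: wt_def)
next
  case (insert i I)
  let ?A = "{s\<in>S. c s = i}"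
  have fin: "\<forall>T\<in>crossing S c J. finite T" for J
    using assms(1) by (auto simp: crossing_def dest: finite_subset)
  have "card (T \<inter> ?A) = 1" if T: "T \<in> crossing S c (insert i I)" for T
  proof -
    from T have T': "T \<subseteq> S" "inj_on c T" "c ` T = insert i I" by (auto simp: crossing_def)
    from T'(3) obtain s where s: "s \<in> T" "c s = i" by (metis imageE insertI1)
    then have "T \<inter> ?A = {s}" using T' by (auto dest: inj_onD)
    then show ?thesis by simp
  qed
  then have "(\<Sum>a\<in>?A. x a * wt x (lnk (crossing S c (insert i I)) a)) =
      real 1 * wt x (crossing S c (insert i I))"
    using assms(1) by (intro sum_lnk_uniform finite_crossing fin) auto
  moreover have "lnk (crossing S c (insert i I)) a = crossing S c I" if a: "a \<in> ?A" for a
  proof (intro set_eqI iffI)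
    fix T assume "T \<in> lnk (crossing S c (insert i I)) a"
    then have T: "a \<notin> T" "insert a T \<subseteq> S" "inj_on c (insert a T)" "c ` insert a T = insert i I"
      by (auto simp: lnk_def crossing_def)
    have "c a \<notin> c ` T" using T(1,3) by (auto simp: inj_on_def)
    then have "c ` T = I" using T(4) a insert.hyps by (auto simp: insert_eq_iff)
    then show "T \<in> crossing S c I" using T by (auto simp: crossing_def)
  next
    fix T assume "T \<in> crossing S c I"
    then have T: "T \<subseteq> S" "inj_on c T" "c ` T = I" by (auto simp: crossing_def)
    then have "a \<notin> T" using a insert.hyps by auto
    then show "T \<in> lnk (crossing S c (insert i I)) a"
      using T a insert.hyps by (auto simp: lnk_def crossing_def)
  qed
  ultimately show ?case using insert by (simp add: sum_distrib_right)
qed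

text \<open>Two-term AM-GM, applied to each pair and then to the two means.\<close>

lemma am_gm_4:
  fixes a b c d :: real
  assumes "0 \<le> a" "0 \<le> b" "0 \<le> c" "0 \<le> d"
  shows "a * b * c * d \<le> (a + b + c + d) ^ 4 / 256"
proof -
  have am: "u * v \<le> ((u + v) / 2)\<^sup>2" for u v :: real
  proof -
    have "((u + v) / 2)\<^sup>2 - u * v = ((u - v) / 2)\<^sup>2" by (simp add: power2_eq_square field_simps)
    then show ?thesis using zero_le_power2[of "(u - v) / 2"] by linarith
  qed
  define p where "p = (a + b) / 2"
  define q where "q = (c + d) / 2"
  have pq: "0 \<le> p" "0 \<le> q" using assms by (auto simp: p_def q_def)
  have "(a * b) * (c * d) \<le> p\<^sup>2 * q\<^sup>2"
    unfolding p_def q_def using assms by (intro mult_mono am) auto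
  also have "\<dots> = (p * q)\<^sup>2" by (rule power_mult_distrib[symmetric])
  also have "\<dots> \<le> (((p + q) / 2)\<^sup>2)\<^sup>2"
    using pq by (intro power_mono am mult_nonneg_nonneg)
  also have "\<dots> = ((p + q) / 2) ^ 4" by (simp flip: power_mult)
  also have "(p + q) / 2 = (a + b + c + d) / 4" by (simp add: p_def q_def field_simps)
  finally show ?thesis by (simp add: mult.assoc power_divide)
qed

lemma lessThan_4: "{..<4} = {0, 1, 2, 3 :: nat}" by auto

lemma sum_colour_classes:
  assumes "finite S" "\<And>s. s \<in> S \<Longrightarrow> c s < (4::nat)"
  shows "(\<Sum>i<4. \<Sum>s\<in>{s\<in>S. c s = i}. x s) = (\<Sum>s\<in>S. x s :: real)"
proof -
  have "(\<Sum>s\<in>S. x s) = (\<Sum>i<4. \<Sum>s\<in>{s\<in>S. c s = i}. x s)"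
    using assms by (intro sum.group[symmetric]) auto
  then show ?thesis by simp
qed

lemma rainbow_eq_crossing:
  assumes "e \<subseteq> S" "card e = 4" "inj_on c e" "\<And>s. s \<in> S \<Longrightarrow> c s < (4::nat)"
  shows "e \<in> crossing S c {..<4}"
proof -
  have "card (c ` e) = 4" using assms by (simp add: card_image)
  moreover have "c ` e \<subseteq> {..<4}" using assms by auto
  ultimately have "c ` e = {..<4}" by (intro card_subset_eq) auto
  then show ?thesis using assms by (simp add: crossing_def)
qed

lemma wt_rainbow_le:
  assumes "finite S" "\<And>s. s \<in> S \<Longrightarrow> c s < (4::nat)" "\<forall>v. 0 \<le> x v"
    and "\<And>e. e \<in> E \<Longrightarrow> e \<subseteq> S \<and> card e = 4 \<and> inj_on c e"
  shows "wt x E \<le> (\<Sum>s\<in>S. x s) ^ 4 / 256"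
proof -
  let ?p = "\<lambda>i. \<Sum>s\<in>{s\<in>S. c s = i}. x s"
  have "E \<subseteq> crossing S c {..<4}"
  proof
    fix e assume "e \<in> E"
    then show "e \<in> crossing S c {..<4}"
      using assms(4)[of e] by (intro rainbow_eq_crossing assms(2)) auto
  qed
  then have "wt x E \<le> wt x (crossing S c {..<4})"
    using assms by (intro wt_mono finite_crossing)
  also have "\<dots> = (\<Prod>i<4. ?p i)" using assms by (intro wt_crossing) auto
  also have "\<dots> = ?p 0 * ?p 1 * ?p 2 * ?p 3" unfolding lessThan_4 by simp
  also have "\<dots> \<le> (?p 0 + ?p 1 + ?p 2 + ?p 3) ^ 4 / 256"
    using assms by (intro am_gm_4 sum_nonneg) auto
  also have "?p 0 + ?p 1 + ?p 2 + ?p 3 = (\<Sum>i<4. ?p i)" unfolding lessThan_4 by simp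
  finally show ?thesis by (simp add: sum_colour_classes assms)
qed

section \<open>Colourings with four classes\<close>

text \<open>The constants bracket the density \<open>1 / 64 = 15.625 / 1000\<close> of the triples crossing three
  classes of relative size \<open>1 / 4\<close>.\<close>
lemma rainbow_structure:
  fixes x :: "'a \<Rightarrow> real" and c :: "'a \<Rightarrow> nat"
  assumes fin: "finite W" "W \<noteq> {}" and pos: "\<And>v. v \<in> W \<Longrightarrow> 0 < x v" and nn: "\<forall>v. 0 \<le> x v"
    and c: "\<And>s. s \<in> W \<Longrightarrow> c s < 4"
    and F: "\<And>e. e \<in> F \<Longrightarrow> e \<subseteq> W \<and> card e = 4 \<and> inj_on c e"
    and w: "(\<Sum>s\<in>W. x s) \<le> w"
    and deg: "\<And>s. s \<in> W \<Longrightarrow> 15 / 1000 * w ^ 3 \<le> wt x (lnk F s)"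
  shows "\<And>s. s \<in> W \<Longrightarrow> lnk F s \<subseteq> crossing W c ({..<4} - {c s})"
    and "\<And>j. j < 4 \<Longrightarrow> wt x (crossing W c ({..<4} - {j})) \<le> 178 / 10000 * w ^ 3"
proof -
  show sub: "lnk F s \<subseteq> crossing W c ({..<4} - {c s})" if s: "s \<in> W" for s
  proof
    fix T assume "T \<in> lnk F s"
    then have T: "s \<notin> T" "insert s T \<in> F" by (auto simp: lnk_def)
    then have "insert s T \<in> crossing W c {..<4}"
      using F by (intro rainbow_eq_crossing c) auto
    then have *: "insert s T \<subseteq> W" "inj_on c (insert s T)" "c ` insert s T = {..<4}"
      by (auto simp: crossing_def)
    then have "c s \<notin> c ` T" using T(1) by (auto simp: inj_on_def)
    then have "c ` T = {..<4} - {c s}" using *(3) by (metis Diff_insert_absorb image_insert)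
    then show "T \<in> crossing W c ({..<4} - {c s})" using * by (auto simp: crossing_def)
  qed
  define p where "p i = (\<Sum>s\<in>{s\<in>W. c s = i}. x s)" for i
  define Q where "Q j = wt x (crossing W c ({..<4} - {j}))" for j
  have Q: "Q j = (\<Prod>i\<in>{..<4} - {j}. p i)" for j
    unfolding Q_def p_def using fin by (intro wt_crossing) auto
  have wpos: "0 < w" using sum_pos[of W x] fin pos w by fastforce
  define \<theta> where "\<theta> = 15 / 1000 * w ^ 3"
  have \<theta>: "0 < \<theta>" using wpos by (simp add: \<theta>_def)
  have degQ: "\<theta> \<le> Q (c s)" if "s \<in> W" for s
    unfolding Q_def \<theta>_def using deg[OF that] wt_mono[OF sub[OF that] finite_crossing[OF fin(1)] nn]
    by linarith
  \<comment> \<open>An empty class \<open>i\<close> would annihilate \<open>Q (c s)\<close> for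
    every vertex \<open>s\<close>, since \<open>c s\<close> differs from \<open>i\<close>.\<close>
  have onto: "\<exists>s\<in>W. c s = i" if "i < 4" for i
  proof (rule ccontr)
    assume no: "\<not> (\<exists>s\<in>W. c s = i)"
    then have p0: "p i = 0" unfolding p_def by (intro sum.neutral) auto
    obtain s where s: "s \<in> W" using fin by auto
    have "i \<in> {..<4} - {c s}" using no s that by auto
    then have "Q (c s) = 0" unfolding Q using p0 by (meson finite_Diff finite_lessThan prod_zero)
    then show False using degQ[OF s] \<theta> by simp
  qed
  have Qge: "\<theta> \<le> Q i" if "i < 4" for i using onto[OF that] degQ by metis
  have pnn: "0 \<le> p i" for i unfolding p_def using nn by (intro sum_nonneg) auto
  have "(\<Sum>i<4. p i) = (\<Sum>s\<in>W. x s)" unfolding p_def using fin c by (intro sum_colour_classes)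
  then have psum: "p 0 + p 1 + p 2 + p 3 \<le> w" using w unfolding lessThan_4 by simp
  have "p 0 * p 1 * p 2 * p 3 \<le> (p 0 + p 1 + p 2 + p 3) ^ 4 / 256"
    by (intro am_gm_4 pnn)
  also have "\<dots> \<le> w ^ 4 / 256"
    using psum pnn[of 0] pnn[of 1] pnn[of 2] pnn[of 3] by (intro divide_right_mono power_mono) auto
  finally have P: "p 0 * p 1 * p 2 * p 3 \<le> w ^ 4 / 256" .
  have Q4: "Q 0 = p 1 * p 2 * p 3" "Q 1 = p 0 * p 2 * p 3" "Q 2 = p 0 * p 1 * p 3" "Q 3 = p 0 * p 1 * p 2"
    unfolding Q lessThan_4 by (simp_all add: insert_Diff_if)
  have four: "i = 0 \<or> i = 1 \<or> i = 2 \<or> i = 3" if "i < 4" for i :: nat using that by auto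
  \<comment> \<open>The product of all four class weights is at most w^4/256, and any three of them
    multiply to at least 0.015 w^3; hence a class has weight at most w / 3.84 < 0.2605 w. Cubing
    gives the constant 0.0178.\<close>
  have ple: "p i \<le> w * 2605 / 10000" if "i < 4" for i
  proof -
    have "p i * Q i = p 0 * p 1 * p 2 * p 3" using four[OF that] Q4 by auto
    then have "p i * \<theta> \<le> w ^ 4 / 256" using P mult_left_mono[OF Qge[OF that] pnn[of i]] by linarith
    then have "w ^ 3 * (15 / 1000 * p i) \<le> w ^ 3 * (w / 256)"
      by (simp add: \<theta>_def field_simps power_numeral_reduce)
    then have "15 / 1000 * p i \<le> w / 256" using wpos by (simp add: mult_le_cancel_left_pos)
    then show ?thesis using wpos by simp
  qed
  have Qle: "Q j \<le> 178 / 10000 * w ^ 3" if "j < 4" for j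
  proof -
    have "Q j \<le> (\<Prod>i\<in>{..<4} - {j}. w * 2605 / 10000)"
      unfolding Q using ple pnn by (intro prod_mono) auto
    also have "\<dots> = (w * 2605 / 10000) ^ 3" using that by (simp add: card_Diff_singleton_if)
    also have "\<dots> \<le> 178 / 10000 * w ^ 3"
      using wpos by (simp add: power_mult_distrib power_divide divide_simps)
    finally show ?thesis .
  qed
  show "wt x (crossing W c ({..<4} - {j})) \<le> 178 / 10000 * w ^ 3" if "j < 4" for j
    using Qle[OF that] by (simp add: Q_def)
qed

text \<open>A vertex of large degree cannot be covered together with vertices of all four classes, since
  the link of each of these takes up almost all triples avoiding its class; so it joins one of the
  classes.\<close>
lemma rainbow_extension:
  fixes x :: "'a \<Rightarrow> real" and c :: "'a \<Rightarrow> nat"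
  assumes fin: "finite S" and pos: "\<And>v. v \<in> S \<Longrightarrow> 0 < x v" and nn: "\<forall>v. 0 \<le> x v"
    and E: "\<And>e. e \<in> E \<Longrightarrow> e \<subseteq> S \<and> card e = 4" and FE: "F \<subseteq> E"
    and w: "w = (\<Sum>s\<in>S. x s)" "0 < w"
    and Y: "Y \<subseteq> S" "(\<Sum>s\<in>Y. x s) \<le> w / 2000"
    and c: "\<And>s. s \<in> S - Y \<Longrightarrow> c s < 4"
    and rain: "\<And>e. e \<in> F \<Longrightarrow> e \<subseteq> S - Y \<Longrightarrow> inj_on c e"
    and degF: "\<And>s. s \<in> S - Y \<Longrightarrow> 155 / 10000 * w ^ 3 \<le> wt x (lnk F s)"
    and degE: "\<And>s. s \<in> Y \<Longrightarrow> 155 / 10000 * w ^ 3 \<le> wt x (lnk E s)"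
    and common: "\<And>s s'. s \<in> S \<Longrightarrow> s' \<in> S \<Longrightarrow> s \<noteq> s' \<Longrightarrow> cov E s s' \<Longrightarrow>
      wt x (lnk E s \<inter> lnk E s') \<le> w ^ 3 / 2000"
  shows "\<exists>c' :: 'a \<Rightarrow> nat. (\<forall>s. c' s < 4) \<and> (\<forall>e\<in>E. inj_on c' e)"
proof -
  define W where "W = S - Y"
  define F' where "F' = {e \<in> F. e \<subseteq> W}"
  define cr where "cr j = crossing W c ({..<4} - {j})" for j
  define G where "G s = {T \<in> lnk E s. T \<subseteq> W}" for s
  have finE: "finite E" using E fin by (intro finite_subset[of E "Pow S"]) auto
  have E': "E \<subseteq> {T. T \<subseteq> S \<and> card T = Suc 3}" using E by auto
  have w3: "0 < w ^ 3" using w by simp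
  \<comment> \<open>Triples meeting \<open>Y\<close> weigh at most w^3/2000, which lowers 0.0155 to
    exactly 0.015.\<close>
  have trunc: "15 / 1000 * w ^ 3 \<le> wt x {T \<in> lnk H s. T \<subseteq> W}"
    if "H \<subseteq> E" "155 / 10000 * w ^ 3 \<le> wt x (lnk H s)" for H s
  proof -
    have finH: "finite H" using finE that(1) by (rule rev_finite_subset)
    have H: "lnk H s \<subseteq> {T. T \<subseteq> S \<and> card T = 3}"
      using E' that(1) fin by (intro lnk_uniform) auto
    have "lnk H s = {T \<in> lnk H s. T \<subseteq> W} \<union> {T \<in> lnk H s. T \<inter> Y \<noteq> {}}"
      using H by (auto simp: W_def)
    then have "wt x (lnk H s) \<le> wt x {T \<in> lnk H s. T \<subseteq> W} + wt x {T \<in> lnk H s. T \<inter> Y \<noteq> {}}"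
      using wt_Un_le[of "{T \<in> lnk H s. T \<subseteq> W}" "{T \<in> lnk H s. T \<inter> Y \<noteq> {}}" x]
        finite_lnk[OF finH, of s] nn by simp
    moreover have "wt x {T \<in> lnk H s. T \<inter> Y \<noteq> {}} \<le> (\<Sum>v\<in>Y. x v) * (\<Sum>v\<in>S. x v) ^ 2"
      using H by (intro wt_hit_le fin Y(1) nn) auto
    moreover have "(\<Sum>v\<in>Y. x v) * (\<Sum>v\<in>S. x v) ^ 2 \<le> w / 2000 * w ^ 2"
      using Y(2) w by (intro mult_mono) auto
    moreover have "w / 2000 * w ^ 2 = w ^ 3 / 2000" by (simp add: power3_eq_cube power2_eq_square)
    ultimately show ?thesis using that(2) by linarith
  qed
  have lnkF': "lnk F' s = {T \<in> lnk F s. T \<subseteq> W}" if "s \<in> W" for s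
    using that by (auto simp: lnk_def F'_def)
  have degF': "15 / 1000 * w ^ 3 \<le> wt x (lnk F' s)" if "s \<in> W" for s
    unfolding lnkF'[OF that] using that by (intro trunc FE degF) (simp add: W_def)
  have Wne: "W \<noteq> {}"
  proof
    assume "W = {}"
    then have "Y = S" using Y by (auto simp: W_def)
    then show False using Y(2) w by simp
  qed
  have finW: "finite W" using fin by (simp add: W_def)
  have xW: "(\<Sum>s\<in>W. x s) \<le> w" unfolding w(1) using fin nn by (intro sum_mono2) (auto simp: W_def)
  have posW: "0 < x v" if "v \<in> W" for v using that pos by (simp add: W_def)
  have cW: "c s < 4" if "s \<in> W" for s using that c by (simp add: W_def)
  have F'W: "e \<subseteq> W \<and> card e = 4 \<and> inj_on c e" if "e \<in> F'" for e
    using that FE E rain by (auto simp: F'_def W_def)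
  have st1: "lnk F' s \<subseteq> cr (c s)" if "s \<in> W" for s
    unfolding cr_def using posW cW F'W degF' that by (intro rainbow_structure(1)[OF finW Wne _ nn _ _ xW])
  have st2: "wt x (cr j) \<le> 178 / 10000 * w ^ 3" if "j < 4" for j
    unfolding cr_def using posW cW F'W degF' that by (intro rainbow_structure(2)[OF finW Wne _ nn _ _ xW])
  have fincr: "finite (cr j)" for j unfolding cr_def by (rule finite_crossing[OF finW])
  \<comment> \<open>Two such families share at least 0.015 + 0.015 - 0.0178 = 0.0122 of w^3, far
    above the 0.0005 that \<open>common\<close> permits for covered pairs.\<close>
  have meet: "w ^ 3 / 2000 < wt x (A \<inter> B)"
    if "A \<subseteq> cr j" "B \<subseteq> cr j" "j < 4" "15 / 1000 * w ^ 3 \<le> wt x A" "15 / 1000 * w ^ 3 \<le> wt x B"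
    for A B j
    using wt_inter_ge[OF that(1,2) fincr nn] st2[OF that(3)] that(4,5) w3 by linarith
  have uncov: "\<not> cov E s s'" if ss: "s \<in> S" "s' \<in> S" "s \<noteq> s'" and
    AB: "A \<subseteq> cr j" "B \<subseteq> cr j" "j < 4" "15 / 1000 * w ^ 3 \<le> wt x A" "15 / 1000 * w ^ 3 \<le> wt x B"
      "A \<subseteq> lnk E s" "B \<subseteq> lnk E s'" for s s' A B j
  proof
    assume "cov E s s'"
    then have "wt x (lnk E s \<inter> lnk E s') \<le> w ^ 3 / 2000" using ss by (intro common)
    moreover have "wt x (A \<inter> B) \<le> wt x (lnk E s \<inter> lnk E s')"
      using AB finite_lnk[OF finE, of s] by (intro wt_mono nn) auto
    ultimately show False using meet[OF AB(1-5)] by linarith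
  qed
  have F'E: "lnk F' s \<subseteq> lnk E s" for s using FE by (intro lnk_mono) (auto simp: F'_def)
  have classes: "\<not> cov E s s'" if "s \<in> W" "s' \<in> W" "s \<noteq> s'" "c s = c s'" for s s'
  proof (rule uncov[of s s' "lnk F' s" "c s" "lnk F' s'"])
    show "lnk F' s' \<subseteq> cr (c s)" using st1[OF that(2)] that(4) by simp
  qed (use that st1[OF that(1)] degF' cW F'E in \<open>auto simp: W_def\<close>)
  \<comment> \<open>The vertices of such a triple are pairwise covered by its edge with
    \<open>s\<close>, so no two of them have the same colour, and exactly one colour is
    missing.\<close>
  have Gcr: "\<exists>j<4. T \<in> cr j" if "T \<in> G s" for s T
  proof -
    from that have T: "T \<subseteq> W" "insert s T \<in> E" "s \<notin> T" by (auto simp: G_def lnk_def)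
    have "T \<in> {T. T \<subseteq> S \<and> card T = 3}" using lnk_uniform[OF E' fin, of s] that by (auto simp: G_def)
    then have T3: "card T = 3" by simp
    have inj: "inj_on c T"
    proof (rule inj_onI, rule ccontr)
      fix u v assume uv: "u \<in> T" "v \<in> T" "c u = c v" "u \<noteq> v"
      then have "cov E u v" using T by (auto simp: cov_def)
      then show False using classes[of u v] uv T by auto
    qed
    then have "card (c ` T) = 3" using T3 by (simp add: card_image)
    moreover have sub: "c ` T \<subseteq> {..<4}" using T cW by auto
    ultimately have "card ({..<4} - c ` T) = 1" by (simp add: card_Diff_subset finite_subset[OF sub])
    then obtain j where j: "{..<4} - c ` T = {j}" by (auto simp: card_1_singleton_iff)
    then have "c ` T = {..<4} - {j}" "j < 4" using sub by auto
    then show ?thesis using T inj by (auto simp: cr_def crossing_def)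
  qed
  have degG: "15 / 1000 * w ^ 3 \<le> wt x (G y)" if "y \<in> Y" for y
    unfolding G_def by (intro trunc degE that order_refl)
  have finG: "finite (G y)" for y using finite_lnk[OF finE, of y] by (simp add: G_def)
  \<comment> \<open>If \<open>y\<close> were covered with some \<open>s\<close> of every class
    \<open>j\<close>, the link of \<open>s\<close> would leave at most 0.0178 - 0.015 + 0.0005 =
    0.0033 of w^3 in \<open>cr j\<close> for the link of \<open>y\<close>. Four times this is
    0.0132, below the degree 0.015.\<close>
  have "\<exists>j<4. \<forall>s\<in>W. c s = j \<longrightarrow> \<not> cov E y s" if y: "y \<in> Y" for y
  proof (rule ccontr)
    assume no: "\<not> ?thesis"
    have small: "wt x (G y \<inter> cr j) \<le> 33 / 10000 * w ^ 3" if j: "j < 4" for j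
    proof -
      from no j obtain s where s: "s \<in> W" "c s = j" "cov E y s" by blast
      have "s \<noteq> y" using s y by (auto simp: W_def)
      then have "wt x (lnk E y \<inter> lnk E s) \<le> w ^ 3 / 2000"
        using s y Y by (intro common) (auto simp: W_def)
      moreover have "wt x ((G y \<inter> cr j) \<inter> lnk F' s) \<le> wt x (lnk E y \<inter> lnk E s)"
        using F'E finite_lnk[OF finE, of y] by (intro wt_mono nn) (auto simp: G_def)
      moreover have "wt x (G y \<inter> cr j) + wt x (lnk F' s) - wt x (cr j) \<le>
          wt x ((G y \<inter> cr j) \<inter> lnk F' s)"
        using st1[OF s(1)] s(2) by (intro wt_inter_ge fincr nn) auto
      ultimately show ?thesis using st2[OF j] degF'[OF s(1)] by linarith
    qed
    have "G y = (\<Union>j<4. G y \<inter> cr j)" using Gcr by blast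
    then have "wt x (G y) \<le> (\<Sum>j<4. wt x (G y \<inter> cr j))"
      using wt_UN_le[of "{..<4}" "\<lambda>j. G y \<inter> cr j" x] finG nn by simp
    also have "\<dots> \<le> (\<Sum>j<(4::nat). 33 / 10000 * w ^ 3)" by (intro sum_mono small) simp
    finally show False using degG[OF y] w3 by simp
  qed
  then have "\<forall>y. \<exists>j. y \<in> Y \<longrightarrow> j < 4 \<and> (\<forall>s\<in>W. c s = j \<longrightarrow> \<not> cov E y s)" by blast
  then obtain d where d: "\<And>y. y \<in> Y \<Longrightarrow> d y < 4"
    "\<And>y s. y \<in> Y \<Longrightarrow> s \<in> W \<Longrightarrow> c s = d y \<Longrightarrow> \<not> cov E y s" by metis
  define c' where "c' s = (if s \<in> W then c s else if s \<in> Y then d s else 0)" for s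
  have c'4: "c' s < 4" for s using d cW by (auto simp: c'_def)
  \<comment> \<open>For \<open>s\<close> in \<open>Y\<close> the whole truncated link lies in
    \<open>cr (d s)\<close>: a triple of another type would contain a vertex of colour
    \<open>d s\<close>, covered together with \<open>s\<close>. After this step old and new vertices
    are on the same footing, and two of equal colour cannot be covered.\<close>
  have big: "15 / 1000 * w ^ 3 \<le> wt x (G s \<inter> cr (c' s))" if s: "s \<in> S" for s
  proof (cases "s \<in> W")
    case True
    have "lnk F' s \<subseteq> G s \<inter> cr (c' s)"
      using st1[OF True] F'E[of s] lnkF'[OF True] True by (auto simp: G_def c'_def)
    then have "wt x (lnk F' s) \<le> wt x (G s \<inter> cr (c' s))" using finG by (intro wt_mono nn) auto
    then show ?thesis using degF'[OF True] by linarith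
  next
    case False
    then have y: "s \<in> Y" using s by (auto simp: W_def)
    have "G s \<subseteq> cr (c' s)"
    proof
      fix T assume T: "T \<in> G s"
      then obtain j where j: "j < 4" "T \<in> cr j" using Gcr by blast
      have "j = d s"
      proof (rule ccontr)
        assume "j \<noteq> d s"
        then have "d s \<in> c ` T" using j d(1)[OF y] by (auto simp: cr_def crossing_def)
        then obtain v where v: "v \<in> T" "c v = d s" by auto
        have "v \<in> W" "cov E s v" using T v by (auto simp: G_def lnk_def cov_def)
        then show False using d(2)[OF y] v by blast
      qed
      then show "T \<in> cr (c' s)" using j False y by (simp add: c'_def)
    qed
    then have "G s \<inter> cr (c' s) = G s" by auto
    then show ?thesis using degG[OF y] by simp
  qed
  have "inj_on c' e" if e: "e \<in> E" for e
  proof (rule inj_onI, rule ccontr)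
    fix u v assume uv: "u \<in> e" "v \<in> e" "c' u = c' v" "u \<noteq> v"
    then have S: "u \<in> S" "v \<in> S" using E e by auto
    have "\<not> cov E u v"
      using uv(3) big[OF S(1)] big[OF S(2)] c'4[of u]
      by (intro uncov[OF S uv(4), of "G u \<inter> cr (c' u)" "c' u" "G v \<inter> cr (c' u)"])
        (auto simp: G_def)
    then show False using uv e by (auto simp: cov_def)
  qed
  then show ?thesis using c'4 by blast
qed

section \<open>Set systems with disjoint links\<close>

text \<open>With \<open>6 / 64\<close> in place of \<open>5994 / 64000 = 6 * 0.999 / 64\<close> the main inequality is an equality at
  \<open>k = q = 3\<close>, the case of a single edge with equal weights.\<close>
lemma design_numeric:
  fixes k q :: real
  assumes k0: "0 < k" and qk: "q \<le> k"
    and main: "k * (5994 / 64000 * (k + 1) ^ 3) \<le> k\<^sup>2 * q - q\<^sup>2"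
  shows "29 / 10 \<le> k" "k \<le> 478 / 100" "k - q \<le> 17 / 100"
proof -
  \<comment> \<open>Completing the square bounds the right side of \<open>main\<close> by k^4/4. For
    k < 2 the ratio k/(k+1) is below 2/3, and 2/27 < 5994/64000 contradicts
    \<open>main\<close>.\<close>
  have k2: "2 \<le> k"
  proof (rule ccontr)
    assume "\<not> 2 \<le> k"
    then have "k \<le> 2 / 3 * (k + 1)" by simp
    then have "k ^ 3 \<le> (2 / 3 * (k + 1)) ^ 3" using k0 by (intro power_mono) auto
    also have "\<dots> = 8 / 27 * (k + 1) ^ 3" by (simp only: power_mult_distrib) (simp add: power_divide)
    finally have "k ^ 3 / 4 \<le> 2 / 27 * (k + 1) ^ 3" by simp
    also have "\<dots> < 5994 / 64000 * (k + 1) ^ 3" using k0 by simp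
    finally have "k * (k ^ 3 / 4) < k * (5994 / 64000 * (k + 1) ^ 3)" using k0 by simp
    moreover have "k\<^sup>2 * q - q\<^sup>2 \<le> k * (k ^ 3 / 4)"
    proof -
      have "k * (k ^ 3 / 4) - (k\<^sup>2 * q - q\<^sup>2) = (k\<^sup>2 / 2 - q)\<^sup>2"
        by (simp add: power2_eq_square power3_eq_cube field_simps)
      then show ?thesis using zero_le_power2[of "k\<^sup>2 / 2 - q"] by linarith
    qed
    ultimately show False using main by linarith
  qed
  define d where "d = k - q"
  have d0: "0 \<le> d" using qk by (simp add: d_def)
  have "k\<^sup>2 * q - q\<^sup>2 = k * (k\<^sup>2 - k - (k - 2) * d) - d\<^sup>2"
    by (simp add: d_def power2_eq_square algebra_simps)
  then have "k * (5994 / 64000 * (k + 1) ^ 3) \<le> k * (k\<^sup>2 - k - (k - 2) * d)"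
    using main zero_le_power2[of d] by linarith
  then have g: "5994 / 64000 * (k + 1) ^ 3 \<le> k\<^sup>2 - k - (k - 2) * d"
    using k0 by (simp add: mult_le_cancel_left_pos)
  then have g0: "5994 / 64000 * (k + 1) ^ 3 \<le> k\<^sup>2 - k"
    using mult_nonneg_nonneg[of "k - 2" d] k2 d0 by linarith
  \<comment> \<open>Expansion about a chosen point \<open>m\<close>, so that each of the three
    bounds becomes a sign check on numerical coefficients in the increment \<open>v\<close>.\<close>
  have taylor: "c * (m + v + 1) ^ 3 - ((m + v)\<^sup>2 - (m + v)) =
      (c * (m + 1) ^ 3 - m\<^sup>2 + m) + (3 * c * (m + 1)\<^sup>2 - 2 * m + 1) * v
      + (3 * c * (m + 1) - 1) * v\<^sup>2 + c * (v * v\<^sup>2)" for c m v :: real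
    by (simp add: power2_eq_square power3_eq_cube algebra_simps)
  show lower: "29 / 10 \<le> k"
  proof (rule ccontr)
    assume "\<not> 29 / 10 \<le> k"
    define v where "v = k - 29 / 10"
    have v: "- 1 \<le> v" "v \<le> 0" and k: "29 / 10 + v = k"
      using k2 \<open>\<not> 29 / 10 \<le> k\<close> by (auto simp: v_def)
    have "- 1 * v\<^sup>2 \<le> v * v\<^sup>2" using v by (intro mult_right_mono) auto
    moreover have "0 \<le> v\<^sup>2" by simp
    moreover have "5994 / 64000 * (k + 1) ^ 3 - (k\<^sup>2 - k) =
      1459043 / 32000000 - 1684689 / 3200000 * v + 30649 / 320000 * v\<^sup>2 + 5994 / 64000 * (v * v\<^sup>2)"
      using taylor[of "5994 / 64000" "29 / 10" v] unfolding k
      by (simp add: power2_eq_square power3_eq_cube)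
    ultimately show False using g0 v by linarith
  qed
  show upper: "k \<le> 478 / 100"
  proof (rule ccontr)
    assume "\<not> k \<le> 478 / 100"
    define v where "v = k - 478 / 100"
    have v: "0 \<le> v" and k: "478 / 100 + v = k"
      using \<open>\<not> k \<le> 478 / 100\<close> by (auto simp: v_def)
    then have "0 \<le> v\<^sup>2" "0 \<le> v * v\<^sup>2" by auto
    moreover have "5994 / 64000 * (k + 1) ^ 3 - (k\<^sup>2 - k) =
      66694293 / 4000000000 + 66137311 / 80000000 * v + 998399 / 1600000 * v\<^sup>2 + 5994 / 64000 * (v * v\<^sup>2)"
      using taylor[of "5994 / 64000" "478 / 100" v] unfolding k
      by (simp add: power2_eq_square power3_eq_cube)
    ultimately show False using g0 v by linarith
  qed
  show "k - q \<le> 17 / 100"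
  proof (rule ccontr)
    assume "\<not> k - q \<le> 17 / 100"
    then have "(k - 2) * (17 / 100) \<le> (k - 2) * d" using k2 by (intro mult_left_mono) (auto simp: d_def)
    then have h: "5994 / 64000 * (k + 1) ^ 3 \<le> k\<^sup>2 - k - (k - 2) * (17 / 100)" using g by linarith
    \<comment> \<open>At 3.74 the linear terms -0.1673 and +0.17 nearly cancel, so the positive
      constant term, about 0.022, decides on the whole range of \<open>k\<close>.\<close>
    define v where "v = k - 374 / 100"
    have v: "- 1 \<le> v" "v \<le> 2" and k: "374 / 100 + v = k" using lower upper by (auto simp: v_def)
    then have "- 1 * v\<^sup>2 \<le> v * v\<^sup>2" by (intro mult_right_mono) auto
    moreover have "0 \<le> v\<^sup>2" by simp
    moreover have "5994 / 64000 * (k + 1) ^ 3 - (k\<^sup>2 - k) =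
      - (1094177159 / 4000000000) - 13384521 / 80000000 * v + 530867 / 1600000 * v\<^sup>2 + 5994 / 64000 * (v * v\<^sup>2)"
      using taylor[of "5994 / 64000" "374 / 100" v] unfolding k
      by (simp add: power2_eq_square power3_eq_cube)
    moreover have "(k - 2) * (17 / 100) = 2958 / 10000 + 17 / 100 * v" unfolding k[symmetric] by simp
    ultimately show False using h v by linarith
  qed
qed

text \<open>Disjoint links mean that two edges never share three vertices. So the pairs completing
  {s, a} to an edge form a matching: {b, c} and {b, c'} would put {s, a, b} into the links of both
  \<open>c\<close> and \<open>c'\<close>. Bounding each product by half the sum of squares, every
  vertex is charged at most once.\<close>

lemma codegree_le:
  assumes fin: "finite S" and E: "\<And>e. e \<in> E \<Longrightarrow> e \<subseteq> S \<and> card e = 4" and sa: "s \<noteq> a"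
    and disj: "\<And>u v. u \<in> S \<Longrightarrow> v \<in> S \<Longrightarrow> u \<noteq> v \<Longrightarrow> lnk E u \<inter> lnk E v = {}"
  shows "wt y (lnk (lnk E s) a) \<le> (\<Sum>v\<in>S - {s, a}. (y v)\<^sup>2) / 2"
proof -
  let ?P = "lnk (lnk E s) a"
  have P: "a \<notin> P \<and> s \<notin> P \<and> insert s (insert a P) \<in> E" if "P \<in> ?P" for P
    using that by (auto simp: lnk_def)
  have PS: "P \<subseteq> S - {s, a}" "finite P" "card P = 2" if "P \<in> ?P" for P
  proof -
    have e: "insert s (insert a P) \<subseteq> S" "card (insert s (insert a P)) = 4" using P[OF that] E by auto
    then show "P \<subseteq> S - {s, a}" "finite P" using P[OF that] fin by (auto intro: finite_subset)
    then show "card P = 2" using e(2) P[OF that] sa by simp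
  qed
  have disjP: "P \<inter> P' = {}" if PP: "P \<in> ?P" "P' \<in> ?P" "P \<noteq> P'" for P P'
  proof (rule ccontr)
    assume "P \<inter> P' \<noteq> {}"
    then obtain b where b: "b \<in> P" "b \<in> P'" by auto
    obtain c where c: "P = {b, c}" "b \<noteq> c" using PS(3)[OF PP(1)] b by (auto simp: card_2_iff)
    obtain c' where c': "P' = {b, c'}" "b \<noteq> c'" using PS(3)[OF PP(2)] b by (auto simp: card_2_iff)
    have "{s, a, b} \<in> lnk E c" "{s, a, b} \<in> lnk E c'"
      using P[OF PP(1)] P[OF PP(2)] c c' sa by (auto simp: lnk_def insert_commute)
    moreover have "c \<in> S" "c' \<in> S" using PS PP c c' by auto
    moreover have "c \<noteq> c'" using c c' PP by auto
    ultimately show False using disj[of c c'] by blast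
  qed
  have "wt y ?P \<le> (\<Sum>P\<in>?P. (\<Sum>v\<in>P. (y v)\<^sup>2) / 2)"
    unfolding wt_def
  proof (rule sum_mono)
    fix P assume "P \<in> ?P"
    from PS(3)[OF this] obtain b c where "P = {b, c}" "b \<noteq> c" by (auto simp: card_2_iff)
    moreover have "y b * y c \<le> ((y b)\<^sup>2 + (y c)\<^sup>2) / 2"
      using zero_le_power2[of "y b - y c"] by (simp add: power2_diff)
    ultimately show "(\<Prod>v\<in>P. y v) \<le> (\<Sum>v\<in>P. (y v)\<^sup>2) / 2" by simp
  qed
  also have "\<dots> = (\<Sum>P\<in>?P. \<Sum>v\<in>P. (y v)\<^sup>2) / 2" by (simp add: sum_divide_distrib)
  also have "(\<Sum>P\<in>?P. \<Sum>v\<in>P. (y v)\<^sup>2) = (\<Sum>v\<in>\<Union>?P. (y v)\<^sup>2)"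
    using PS(2) disjP by (intro sum.Union_disjoint[symmetric, unfolded comp_def]) auto
  also have "\<dots> \<le> (\<Sum>v\<in>S - {s, a}. (y v)\<^sup>2)"
    using fin PS(1) by (intro sum_mono2) auto
  finally show ?thesis by simp
qed

text \<open>The pair degrees at the heaviest vertex are sums over matchings. Comparing them with the
  degree condition forces the remaining weights to be nearly 0 or nearly 1 with exactly three of the
  latter kind, and then the vertices of the former kind would have too small a degree.\<close>
lemma covered_design_normalized:
  fixes y :: "'a \<Rightarrow> real"
  assumes fin: "finite S" and i: "i \<in> S" "y i = 1" and y1: "\<And>s. s \<in> S \<Longrightarrow> 0 < y s \<and> y s \<le> 1"
    and nn: "\<forall>v. 0 \<le> y v"
    and E: "\<And>e. e \<in> E \<Longrightarrow> e \<subseteq> S \<and> card e = 4"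
    and disj: "\<And>u v. u \<in> S \<Longrightarrow> v \<in> S \<Longrightarrow> u \<noteq> v \<Longrightarrow> lnk E u \<inter> lnk E v = {}"
    and deg: "\<And>s. s \<in> S \<Longrightarrow> 999 / 64000 * (\<Sum>s\<in>S. y s) ^ 3 \<le> wt y (lnk E s)"
  shows "card S = 4"
proof -
  define R where "R = S - {i}"
  define k where "k = (\<Sum>v\<in>R. y v)"
  define q where "q = (\<Sum>v\<in>R. (y v)\<^sup>2)"
  define s3 where "s3 = (\<Sum>v\<in>R. (y v) ^ 3)"
  have finR: "finite R" using fin by (simp add: R_def)
  have K: "(\<Sum>s\<in>S. y s) = k + 1" using fin i by (simp add: k_def R_def sum.remove)
  have finE: "finite E" using E fin by (intro finite_subset[of E "Pow S"]) auto
  have E': "E \<subseteq> {T. T \<subseteq> S \<and> card T = Suc 3}" using E by auto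
  have T3: "T \<subseteq> S \<and> card T = 3 \<and> s \<notin> T" if "T \<in> lnk E s" for T s
    using lnk_uniform[OF E' fin, of s] that by (auto simp: lnk_def)
  have finT: "\<forall>T\<in>lnk E s. finite T" for s using T3 fin by (auto intro: finite_subset)
  have W: "wt y (lnk (lnk E s) a) \<le> (\<Sum>v\<in>S - {s, a}. (y v)\<^sup>2) / 2" if "s \<noteq> a" for s a
    by (rule codegree_le[OF fin E that disj])
  have sq: "(y v)\<^sup>2 \<le> y v" if "v \<in> S" for v
    using y1[OF that] by (simp add: power2_eq_square mult_left_le)
  have yR: "0 < y a" "y a \<le> 1" if "a \<in> R" for a using that y1 by (auto simp: R_def)
  have k0: "0 \<le> k" unfolding k_def using nn by (intro sum_nonneg) auto
  have qk: "q \<le> k" unfolding k_def q_def using sq by (intro sum_mono) (auto simp: R_def)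
  have s30: "0 \<le> s3" unfolding s3_def using nn by (intro sum_nonneg) auto
  define D where "D = wt y (lnk E i)"
  have D: "999 / 64000 * (k + 1) ^ 3 \<le> D" using deg[OF i(1)] K by (simp add: D_def)
  have WR: "wt y (lnk (lnk E i) a) \<le> (q - (y a)\<^sup>2) / 2" if "a \<in> R" for a
  proof -
    have "S - {i, a} = R - {a}" by (auto simp: R_def)
    moreover have "(\<Sum>v\<in>R - {a}. (y v)\<^sup>2) = q - (y a)\<^sup>2"
      using sum.remove[OF finR that, of "\<lambda>v. (y v)\<^sup>2"] by (simp add: q_def)
    ultimately show ?thesis using W[of i a] that by (auto simp: R_def)
  qed
  \<comment> \<open>Each triple of the link of \<open>i\<close> is counted at its three vertices.
    The bound on pair degrees brings in the power sums \<open>k\<close>, \<open>q\<close>,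
    \<open>s3\<close> of the remaining weights.\<close>
  have "real 3 * D = (\<Sum>a\<in>R. y a * wt y (lnk (lnk E i) a))"
    unfolding D_def
  proof (rule sum_lnk_uniform[symmetric, OF finite_lnk[OF finE] finT finR])
    show "\<forall>T\<in>lnk E i. card (T \<inter> R) = 3"
    proof
      fix T assume "T \<in> lnk E i"
      then have "T \<inter> R = T" "card T = 3" using T3[of T i] by (auto simp: R_def)
      then show "card (T \<inter> R) = 3" by simp
    qed
  qed
  also have "\<dots> \<le> (\<Sum>a\<in>R. y a * ((q - (y a)\<^sup>2) / 2))"
    using WR nn by (intro sum_mono mult_left_mono) auto
  also have "\<dots> = (\<Sum>a\<in>R. q / 2 * y a - (y a) ^ 3 / 2)"
    by (intro sum.cong refl) (simp add: power2_eq_square power3_eq_cube field_simps)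
  also have "\<dots> = (k * q - s3) / 2"
  proof -
    have "(\<Sum>a\<in>R. q / 2 * y a) = q / 2 * k" by (simp only: k_def sum_distrib_left)
    moreover have "(\<Sum>a\<in>R. (y a) ^ 3 / 2) = s3 / 2" by (simp only: s3_def sum_divide_distrib)
    ultimately have "(\<Sum>a\<in>R. q / 2 * y a - (y a) ^ 3 / 2) = q / 2 * k - s3 / 2"
      by (simp only: sum_subtractf)
    then show ?thesis by (simp only:) (simp add: field_simps)
  qed
  finally have D6: "6 * D \<le> k * q - s3" by simp
  have Dpos: "0 < D" using D zero_less_power[of "k + 1" 3] k0 by linarith
  have kpos: "0 < k"
  proof (rule ccontr)
    assume "\<not> 0 < k"
    then have "k = 0" using k0 by simp
    then show False using D6 Dpos s30 by simp
  qed
  \<comment> \<open>Cauchy-Schwarz, q^2 <= k s3, in the form of a variance with respect to the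
    weights \<open>y\<close>.\<close>
  have "0 \<le> (\<Sum>a\<in>R. y a * (k * y a - q)\<^sup>2)" using nn by (intro sum_nonneg) auto
  also have "\<dots> = (\<Sum>a\<in>R. k\<^sup>2 * (y a) ^ 3 - 2 * k * q * (y a)\<^sup>2 + q\<^sup>2 * y a)"
    by (intro sum.cong refl) (simp add: power2_eq_square power3_eq_cube algebra_simps)
  also have "\<dots> = k\<^sup>2 * s3 - 2 * k * q * q + q\<^sup>2 * k"
    by (simp add: sum.distrib sum_subtractf s3_def flip: sum_distrib_left, simp add: q_def k_def)
  also have "\<dots> = k * (k * s3 - q\<^sup>2)" by (simp add: power2_eq_square algebra_simps)
  finally have cs: "q\<^sup>2 \<le> k * s3" using kpos by (simp add: zero_le_mult_iff)
  have "k * (5994 / 64000 * (k + 1) ^ 3) \<le> k * (6 * D)" using D kpos by (intro mult_left_mono) auto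
  also have "\<dots> \<le> k * (k * q - s3)" using D6 kpos by (intro mult_left_mono) auto
  also have "\<dots> \<le> k\<^sup>2 * q - q\<^sup>2" using cs by (simp add: power2_eq_square algebra_simps)
  finally have main: "k * (5994 / 64000 * (k + 1) ^ 3) \<le> k\<^sup>2 * q - q\<^sup>2" .
  note num = design_numeric[OF kpos qk main]
  have kq: "k - q = (\<Sum>a\<in>R. y a * (1 - y a))"
    by (simp add: k_def q_def sum_subtractf power2_eq_square algebra_simps)
  \<comment> \<open>Each term y (1 - y) is at most k - q <= 0.17, while 0.78 * 0.22 = 0.1716; so no
    weight lies strictly between 0.22 and 0.78.\<close>
  define H where "H = {a \<in> R. 78 / 100 \<le> y a}"
  define L where "L = {a \<in> R. y a < 78 / 100}"
  have HL: "R = H \<union> L" "H \<inter> L = {}" by (auto simp: H_def L_def)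
  have fHL: "finite H" "finite L" using finR by (auto simp: H_def L_def)
  have light: "y a \<le> 22 / 100" if "a \<in> L" for a
  proof (rule ccontr)
    assume no: "\<not> y a \<le> 22 / 100"
    have a: "a \<in> R" "y a < 78 / 100" using that by (auto simp: L_def)
    have nonneg: "0 \<le> y b * (1 - y b)" if "b \<in> R" for b using yR[OF that] by simp
    have "y a * (1 - y a) \<le> (\<Sum>a\<in>R. y a * (1 - y a))"
      using finR a(1) nonneg by (intro member_le_sum) auto
    then have "y a * (1 - y a) \<le> 17 / 100" using kq num by linarith
    moreover have "0 < (y a - 22 / 100) * (78 / 100 - y a)" using no a by (intro mult_pos_pos) auto
    ultimately show False by (simp add: algebra_simps)
  qed
  \<comment> \<open>The total light weight \<open>l\<close> and the total shortfall \<open>h\<close>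
    of the heavy vertices from 1 are controlled together: 0.78 (l + h) <= k - q <= 0.17.\<close>
  define l where "l = (\<Sum>a\<in>L. y a)"
  define h where "h = (\<Sum>a\<in>H. 1 - y a)"
  have khl: "k = real (card H) - h + l"
    using fHL HL by (simp add: k_def h_def l_def sum.union_disjoint sum_subtractf)
  have "78 / 100 * (l + h) = (\<Sum>a\<in>L. 78 / 100 * y a) + (\<Sum>a\<in>H. 78 / 100 * (1 - y a))"
    by (simp only: l_def h_def sum_distrib_left distrib_left)
  also have "\<dots> \<le> (\<Sum>a\<in>L. y a * (1 - y a)) + (\<Sum>a\<in>H. y a * (1 - y a))"
  proof (intro add_mono sum_mono)
    fix a assume "a \<in> L"
    then show "78 / 100 * y a \<le> y a * (1 - y a)"
      using light[of a] nn mult_left_mono[of "78 / 100" "1 - y a" "y a"] by (simp add: mult.commute)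
  next
    fix a assume "a \<in> H"
    then have "78 / 100 \<le> y a" "a \<in> R" by (auto simp: H_def)
    then show "78 / 100 * (1 - y a) \<le> y a * (1 - y a)" using yR by (intro mult_right_mono) auto
  qed
  also have "\<dots> = k - q" unfolding kq using fHL HL by (simp add: sum.union_disjoint)
  finally have lh: "l + h \<le> 218 / 1000" using num by simp
  have l0: "0 \<le> l" unfolding l_def using nn by (intro sum_nonneg) auto
  have h0: "0 \<le> h" unfolding h_def using yR by (intro sum_nonneg) (auto simp: H_def)
  \<comment> \<open>The number of heavy vertices is k + h - l, hence between 2.9 - 0.218 and 4.78 +
    0.218 = 4.998. The bounds on \<open>k\<close> were made for this.\<close>
  have "real (card H) < 5" "2 < real (card H)" using khl lh l0 h0 num by linarith+
  then have cardH: "card H = 3 \<or> card H = 4" by linarith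
  have half: "(\<Sum>v\<in>S - A. (y v)\<^sup>2) \<le> k + 1" for A
  proof -
    have "(\<Sum>v\<in>S - A. (y v)\<^sup>2) \<le> (\<Sum>v\<in>S. (y v)\<^sup>2)" using fin by (intro sum_mono2) auto
    also have "\<dots> \<le> (\<Sum>v\<in>S. y v)" using sq by (intro sum_mono)
    finally show ?thesis using K by simp
  qed
  \<comment> \<open>A pair degree is at most (k + 1)/2 <= 2.89, so triples with a light vertex
    contribute at most 0.218 * 2.89, about 0.63, to any degree.\<close>
  have lightT: "wt y {T \<in> lnk E s. T \<inter> L \<noteq> {}} \<le> l * (289 / 100)" for s
  proof -
    let ?F = "{T \<in> lnk E s. T \<inter> L \<noteq> {}}"
    have f: "finite ?F" "\<forall>T\<in>?F. finite T" using finite_lnk[OF finE] finT by auto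
    have "wt y ?F \<le> (\<Sum>a\<in>L. y a * wt y (lnk ?F a))"
      by (rule wt_le_sum_lnk[OF f fHL(2) _ nn]) auto
    also have "\<dots> \<le> (\<Sum>a\<in>L. y a * (289 / 100))"
    proof (intro sum_mono mult_left_mono spec[OF nn])
      fix a
      show "wt y (lnk ?F a) \<le> 289 / 100"
      proof (cases "a = s")
        case True
        have "lnk ?F a = {}" using True by (auto simp: lnk_def)
        then show ?thesis by (simp add: wt_def)
      next
        case False
        have "wt y (lnk ?F a) \<le> wt y (lnk (lnk E s) a)"
          using finite_lnk[OF finite_lnk[OF finE]] by (intro wt_mono lnk_mono nn) auto
        also have "\<dots> \<le> (k + 1) / 2" using W[of s a] half[of "{s, a}"] False by auto
        finally show ?thesis using num by simp
      qed
    qed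
    finally show ?thesis by (simp only: l_def sum_distrib_right)
  qed
  have split: "wt y (lnk E s) \<le> wt y {T \<in> lnk E s. T \<inter> L = {}} + l * (289 / 100)" for s
  proof -
    have "lnk E s = {T \<in> lnk E s. T \<inter> L = {}} \<union> {T \<in> lnk E s. T \<inter> L \<noteq> {}}" by auto
    then have "wt y (lnk E s) \<le> wt y {T \<in> lnk E s. T \<inter> L = {}} + wt y {T \<in> lnk E s. T \<inter> L \<noteq> {}}"
      using wt_Un_le[of "{T \<in> lnk E s. T \<inter> L = {}}" "{T \<in> lnk E s. T \<inter> L \<noteq> {}}" y]
        finite_lnk[OF finE, of s] nn by simp
    then show ?thesis using lightT[of s] by linarith
  qed
  define M where "M = {T \<in> lnk E i. T \<inter> L = {}}"
  have MH: "T \<subseteq> H" "card T = 3" if "T \<in> M" for T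
    using that T3[of T i] HL(1) by (auto simp: M_def R_def)
  \<comment> \<open>Two different triples among at most four heavy vertices share a pair
    \<open>P\<close>; then \<open>insert i P\<close> lies in the links of both remaining
    vertices.\<close>
  have M1: "card M \<le> 1"
  proof (rule ccontr)
    assume "\<not> card M \<le> 1"
    moreover have "finite M" using finite_lnk[OF finE, of i] by (simp add: M_def)
    ultimately obtain T U where TU: "T \<in> M" "U \<in> M" "T \<noteq> U"
      by (metis card_le_Suc0_iff_eq One_nat_def)
    have fT: "finite T" "finite U" using MH TU by (metis card.infinite zero_neq_numeral)+
    have "card (T \<union> U) + card (T \<inter> U) = 6"
      using card_Un_Int[OF fT] MH[OF TU(1)] MH[OF TU(2)] by simp
    moreover have "card (T \<union> U) \<le> 4"
      using card_mono[of H "T \<union> U"] MH[OF TU(1)] MH[OF TU(2)] fHL cardH by auto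
    ultimately have "2 \<le> card (T \<inter> U)" by simp
    then obtain P where P: "P \<subseteq> T \<inter> U" "card P = 2" by (rule obtain_subset_with_card_n)
    have "card (T - P) = 1" "card (U - P) = 1"
      using P MH[OF TU(1)] MH[OF TU(2)] fT by (auto simp: card_Diff_subset finite_subset)
    then obtain c d where cd: "T - P = {c}" "U - P = {d}" by (auto simp: card_1_singleton_iff)
    have "T = insert c P" "U = insert d P" "c \<notin> P" "d \<notin> P" using cd P by auto
    then have "insert i P \<in> lnk E c" "insert i P \<in> lnk E d" "c \<in> S" "d \<in> S" "c \<noteq> d"
      using TU T3[of T i] T3[of U i] by (auto simp: M_def lnk_def insert_commute)
    then show False using disj[of c d] by blast
  qed
  have prodle: "(\<Prod>v\<in>T. y v) \<le> 1" if "T \<subseteq> R" for T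
    using that yR by (intro prod_le_1) (auto intro: less_imp_le)
  have wtM: "wt y M \<le> real (card M)"
  proof -
    have "(\<Prod>v\<in>T. y v) \<le> 1" if "T \<in> M" for T
      using MH(1)[OF that] HL(1) by (intro prodle) auto
    then show ?thesis unfolding wt_def using sum_bounded_above[of M "\<lambda>T. \<Prod>v\<in>T. y v" 1] by simp
  qed
  have Dle: "D \<le> real (card M) + l * (289 / 100)" using split[of i] wtM by (simp add: D_def M_def)
  \<comment> \<open>From k >= 2.9 every degree exceeds 0.92, more than the 0.63 that triples with
    light vertices provide. So the link of \<open>i\<close> contains a triple of heavy
    vertices.\<close>
  have cube: "(39 / 10) ^ 3 \<le> (k + 1) ^ 3" using num by (intro power_mono) auto
  have "(999 / 64000 * (39 / 10) ^ 3 :: real) > 92 / 100" by (simp add: power3_eq_cube)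
  then have Dlow: "92 / 100 < 999 / 64000 * (k + 1) ^ 3" using cube by linarith
  have l218: "l \<le> 218 / 1000" using lh h0 by linarith
  have "card M \<noteq> 0"
  proof
    assume "card M = 0"
    then show False using Dle Dlow D l218 by simp
  qed
  then have M1': "card M = 1" using M1 by simp
  then obtain T where T: "M = {T}" by (auto simp: card_1_singleton_iff)
  \<comment> \<open>Four heavy vertices would give k >= 3.78 and degree above 1.7, but one heavy
    triple and the light contribution give at most 1 + 0.63.\<close>
  have H3: "card H = 3"
  proof (rule ccontr)
    assume "card H \<noteq> 3"
    then have "card H = 4" using cardH by simp
    then have "378 / 100 \<le> k" using khl lh l0 h0 by linarith
    then have "(478 / 100) ^ 3 \<le> (k + 1) ^ 3" by (intro power_mono) auto
    moreover have "(999 / 64000 * (478 / 100) ^ 3 :: real) > 17 / 10" by (simp add: power3_eq_cube)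
    ultimately have "17 / 10 < D" using D by linarith
    then show False using Dle M1' l218 by simp
  qed
  have "T \<in> M" using T by simp
  moreover from this have "T = H" using card_subset_eq[OF fHL(1), of T] MH[of T] H3 by simp
  ultimately have HM: "H \<in> M" by simp
  \<comment> \<open>Each triple inside \<open>insert i H\<close> is already in the link of the
    fourth vertex of that edge, so a light \<open>z\<close> would have only triples with light
    vertices, and degree below 0.92.\<close>
  have "L = {}"
  proof (rule ccontr)
    assume "L \<noteq> {}"
    then obtain z where z: "z \<in> L" by auto
    then have zS: "z \<in> S" "z \<noteq> i" "z \<notin> H" using HL by (auto simp: L_def R_def)
    have iH: "i \<notin> H" "insert i H \<in> E" using HM by (auto simp: M_def lnk_def)
    have "{T \<in> lnk E z. T \<inter> L = {}} = {}"
    proof (rule ccontr)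
      assume "\<not> ?thesis"
      then obtain U where U: "U \<in> lnk E z" "U \<inter> L = {}" by auto
      then have U3: "U \<subseteq> insert i H" "card U = 3" using T3[of U z] HL by (auto simp: R_def)
      have "card (insert i H - U) = 1" using U3 H3 iH fHL
        by (simp add: card_Diff_subset finite_subset[OF U3(1)])
      then obtain c where c: "insert i H - U = {c}" by (auto simp: card_1_singleton_iff)
      then have "insert c U = insert i H" "c \<notin> U" "c \<in> insert i H" using U3 by auto
      then have "U \<in> lnk E c" using iH by (auto simp: lnk_def)
      moreover have "c \<in> S" "c \<noteq> z" using \<open>c \<in> insert i H\<close> i zS HL by (auto simp: R_def)
      ultimately show False using disj[of c z] zS U by blast
    qed
    then have "wt y {T \<in> lnk E z. T \<inter> L = {}} = 0" by (simp only: wt_def sum.empty)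
    then have "wt y (lnk E z) \<le> l * (289 / 100)" using split[of z] by linarith
    then show False using deg[OF zS(1)] K Dlow l218 by simp
  qed
  then have "S = insert i H" "i \<notin> H" using HL i by (auto simp: R_def)
  then show ?thesis using H3 fHL by simp
qed

lemma wt_scale:
  assumes "\<forall>T\<in>F. card T = m"
  shows "wt (\<lambda>v. r * x v) F = r ^ m * wt x F"
  unfolding wt_def sum_distrib_left using assms by (intro sum.cong refl) (simp add: prod.distrib)

text \<open>Both sides of the degree condition are homogeneous of degree 3, so all weights may be
  divided by the largest one.\<close>

lemma covered_design:
  fixes x :: "'a \<Rightarrow> real"
  assumes fin: "finite S" "S \<noteq> {}" and pos: "\<And>s. s \<in> S \<Longrightarrow> 0 < x s" and nn: "\<forall>v. 0 \<le> x v"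
    and E: "\<And>e. e \<in> E \<Longrightarrow> e \<subseteq> S \<and> card e = 4"
    and disj: "\<And>u v. u \<in> S \<Longrightarrow> v \<in> S \<Longrightarrow> u \<noteq> v \<Longrightarrow> lnk E u \<inter> lnk E v = {}"
    and deg: "\<And>s. s \<in> S \<Longrightarrow> 999 / 64000 * (\<Sum>s\<in>S. x s) ^ 3 \<le> wt x (lnk E s)"
  shows "card S = 4"
proof -
  have "Max (x ` S) \<in> x ` S" using fin by (intro Max_in) auto
  then obtain i where i: "i \<in> S" "x i = Max (x ` S)" by auto
  have le: "x s \<le> x i" if "s \<in> S" for s using that fin i by simp
  have xi: "0 < x i" using pos[OF i(1)] .
  define y where "y v = inverse (x i) * x v" for v
  have T3: "\<forall>T\<in>lnk E s. card T = 3" for s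
    using lnk_uniform[of E S 3 s] E fin by auto
  show ?thesis
  proof (rule covered_design_normalized[OF fin(1) i(1)])
    show "y i = 1" using xi by (simp add: y_def)
    show "0 < y s \<and> y s \<le> 1" if "s \<in> S" for s
      using le[OF that] pos[OF that] xi by (simp add: y_def field_simps)
    show "\<forall>v. 0 \<le> y v" using nn xi by (simp add: y_def)
    show "999 / 64000 * (\<Sum>s\<in>S. y s) ^ 3 \<le> wt y (lnk E s)" if "s \<in> S" for s
    proof -
      have "(\<Sum>s\<in>S. y s) = inverse (x i) * (\<Sum>s\<in>S. x s)" by (simp add: y_def sum_distrib_left)
      then have "999 / 64000 * (\<Sum>s\<in>S. y s) ^ 3 =
          inverse (x i) ^ 3 * (999 / 64000 * (\<Sum>s\<in>S. x s) ^ 3)" by (simp add: power_mult_distrib)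
      also have "\<dots> \<le> inverse (x i) ^ 3 * wt x (lnk E s)"
        using deg[OF that] xi by (intro mult_left_mono) auto
      also have "\<dots> = wt y (lnk E s)" unfolding y_def by (rule wt_scale[OF T3, symmetric])
      finally show ?thesis .
    qed
  qed (use E disj in auto)
qed

section \<open>Symmetrization\<close>

text \<open>Concerns only two edges sharing three vertices: their symmetric difference, a pair, must
  not lie in a third edge. The usual notion of cancellativity asks this for any two edges.\<close>

definition cancellative :: "'a set set \<Rightarrow> bool" where
  "cancellative E \<longleftrightarrow> (\<forall>u v. u \<noteq> v \<longrightarrow> cov E u v \<longrightarrow> lnk E u \<inter> lnk E v = {})"

lemma wt_cong:
  assumes "\<And>T v. T \<in> F \<Longrightarrow> v \<in> T \<Longrightarrow> x v = y v"
  shows "wt x F = wt y F"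
  unfolding wt_def using assms by (intro sum.cong prod.cong) auto

text \<open>The edge polynomial is affine in each variable, with the weight of the link as slope.
  One unit of weight is therefore worth exactly one degree.\<close>

lemma wt_add:
  assumes "finite E" "\<forall>e\<in>E. finite e"
  shows "wt (x(v := x v + r)) E = wt x E + r * wt x (lnk E v)"
proof -
  have split: "wt z E = z v * wt z (lnk E v) + wt z {e \<in> E. v \<notin> e}" for z :: "'a \<Rightarrow> real"
  proof -
    have "E = {e \<in> E. v \<in> e} \<union> {e \<in> E. v \<notin> e}" "{e \<in> E. v \<in> e} \<inter> {e \<in> E. v \<notin> e} = {}" by auto
    then have "wt z E = wt z {e \<in> E. v \<in> e} + wt z {e \<in> E. v \<notin> e}"
      using wt_Un_Int[of "{e \<in> E. v \<in> e}" "{e \<in> E. v \<notin> e}" z] assms(1) by (simp add: wt_def)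
    then show ?thesis using wt_star[OF assms, of z v] by simp
  qed
  have "wt (x(v := x v + r)) {e \<in> E. v \<notin> e} = wt x {e \<in> E. v \<notin> e}"
    "wt (x(v := x v + r)) (lnk E v) = wt x (lnk E v)"
    by (intro wt_cong; auto simp: lnk_def)+
  then show ?thesis using split[of x] split[of "x(v := x v + r)"] by (simp add: distrib_right)
qed

lemma wt_supp:
  assumes "finite F" "\<forall>T\<in>F. finite T" "\<forall>v. v \<notin> S \<longrightarrow> x v = 0"
  shows "wt x F = wt x {T \<in> F. T \<subseteq> S}"
  unfolding wt_def
proof (rule sum.mono_neutral_right[OF assms(1)])
  show "\<forall>T\<in>F - {T \<in> F. T \<subseteq> S}. (\<Prod>v\<in>T. x v) = 0"
  proof
    fix T assume "T \<in> F - {T \<in> F. T \<subseteq> S}"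
    then obtain v where "v \<in> T" "v \<notin> S" "finite T" using assms(2) by auto
    then show "(\<Prod>v\<in>T. x v) = 0" using assms(3) by (meson prod_zero)
  qed
qed auto

definition mass :: "'a set \<Rightarrow> ('a \<Rightarrow> nat) \<Rightarrow> real" where
  "mass V x = (\<Sum>v\<in>V. real (x v))"

text \<open>The threshold is 0.999 times mass^3/64, the degree in the balanced case; removing a unit
  of weight below it gains a definite amount against mass^4/256.\<close>

definition no_low :: "'a set \<Rightarrow> 'a set set \<Rightarrow> ('a \<Rightarrow> nat) \<Rightarrow> bool" where
  "no_low V E x \<longleftrightarrow>
     (\<forall>v. 0 < x v \<longrightarrow> 999 / 64000 * mass V x ^ 3 \<le> wt (\<lambda>v. real (x v)) (lnk E v))"

lemma mass_update:
  assumes "finite V" "v \<in> V"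
  shows "mass V (x(v := k)) = mass V x + real k - real (x v)"
proof -
  have "mass V y = real (y v) + (\<Sum>u\<in>V - {v}. real (y u))" for y
    unfolding mass_def by (rule sum.remove[OF assms])
  then show ?thesis by (simp add: sum.cong[of "V - {v}" "V - {v}" "\<lambda>u. real ((x(v := k)) u)"])
qed

text \<open>Symmetrization with integral vertex weights on a fixed edge set. While some vertex has a small
  degree, its weight is decreased; otherwise weight is shifted between two vertices not
  covered by a common edge, in the direction that does not decrease the number of weighted edges.
  When all pairs are covered the links are disjoint and \<open>covered_design\<close> applies.\<close>
lemma symmetrization_induct:
  fixes x :: "'a \<Rightarrow> nat"
  assumes fin: "finite V" and E: "\<And>e. e \<in> E \<Longrightarrow> e \<subseteq> V \<and> card e = 4" and canc: "cancellative E"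
    and xV: "\<forall>v. v \<notin> V \<longrightarrow> x v = 0"
    and low: "\<And>x v. \<forall>v. v \<notin> V \<longrightarrow> x v = 0 \<Longrightarrow> 0 < x v \<Longrightarrow>
      wt (\<lambda>v. real (x v)) (lnk E v) < 999 / 64000 * mass V x ^ 3 \<Longrightarrow>
      P (x(v := x v - 1)) \<Longrightarrow> P x"
    and shift: "\<And>x u v. \<forall>v. v \<notin> V \<longrightarrow> x v = 0 \<Longrightarrow> no_low V E x \<Longrightarrow> 0 < x u \<Longrightarrow> 0 < x v \<Longrightarrow> u \<noteq> v \<Longrightarrow>
      mass V (x(v := x v - 1, u := x u + 1)) = mass V x \<Longrightarrow>
      wt (\<lambda>v. real (x v)) E \<le> wt (\<lambda>w. real ((x(v := x v - 1, u := x u + 1)) w)) E \<Longrightarrow>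
      P (x(v := x v - 1, u := x u + 1)) \<Longrightarrow> P x"
    and rainbow: "\<And>x c. \<forall>v. v \<notin> V \<longrightarrow> x v = 0 \<Longrightarrow> no_low V E x \<Longrightarrow> \<forall>v. c v < (4::nat) \<Longrightarrow>
      \<forall>e\<in>E. e \<subseteq> {v. 0 < x v} \<longrightarrow> inj_on c e \<Longrightarrow> P x"
  shows "P x"
proof -
  have finE: "finite E" using E fin by (intro finite_subset[of E "Pow V"]) auto
  have E': "E \<subseteq> {T. T \<subseteq> V \<and> card T = Suc 3}" using E by auto
  have fine: "\<forall>e\<in>E. finite e" using E fin by (auto intro: finite_subset)
  have finT: "\<forall>T\<in>lnk E s. finite T" for s
    using lnk_uniform[OF E' fin, of s] fin by (auto intro: finite_subset)
  define m1 where "m1 x = (\<Sum>v\<in>V. x v)" for x :: "'a \<Rightarrow> nat"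
  define lam where "lam x = (\<Sum>e\<in>E. \<Prod>v\<in>e. x v)" for x :: "'a \<Rightarrow> nat"
  \<comment> \<open>Shifts keep \<open>m1\<close>. The bounds \<open>lam_le\<close> and
    \<open>sq_le\<close> depend only on \<open>m1\<close>, so subtracting from them turns growth of
    the edge count \<open>lam\<close>, or of the sum of squares, into descent of \<open>m2\<close>
    and \<open>m3\<close>.\<close>
  define m2 where "m2 x = card E * (m1 x) ^ 4 - lam x" for x
  define m3 where "m3 x = (m1 x)\<^sup>2 - (\<Sum>v\<in>V. (x v)\<^sup>2)" for x
  have mass: "mass V x = real (m1 x)" for x by (simp add: mass_def m1_def)
  have lam: "real (lam x) = wt (\<lambda>v. real (x v)) E" for x by (simp add: lam_def wt_def)
  have xle: "x v \<le> m1 x" if "v \<in> V" for x v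
    unfolding m1_def using fin that by (intro member_le_sum) auto
  have lam_le: "lam x \<le> card E * (m1 x) ^ 4" for x
  proof -
    have "(\<Prod>v\<in>e. x v) \<le> (m1 x) ^ 4" if "e \<in> E" for e
    proof -
      have "(\<Prod>v\<in>e. x v) \<le> (\<Prod>v\<in>e. m1 x)" using E[OF that] xle by (intro prod_mono) auto
      then show ?thesis using E[OF that] by simp
    qed
    then show ?thesis unfolding lam_def using sum_bounded_above[of E _ "(m1 x) ^ 4"] by simp
  qed
  have sq_le: "(\<Sum>v\<in>V. (x v)\<^sup>2) \<le> (m1 x)\<^sup>2" for x
  proof -
    have "(\<Sum>v\<in>V. (x v)\<^sup>2) \<le> (\<Sum>v\<in>V. x v * m1 x)"
      using xle by (intro sum_mono) (simp add: power2_eq_square)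
    then show ?thesis by (simp add: m1_def power2_eq_square sum_distrib_right)
  qed
  from xV show ?thesis
  proof (induction x rule: wf_induct_rule[OF wf_measures[of "[m1, m2, m3]"]])
    case (1 x)
    note IH = "1.IH" and xV = "1.prems"[rule_format]
    define X where "X = (\<lambda>v. real (x v))"
    define S where "S = {v. 0 < x v}"
    have nn: "\<forall>v. 0 \<le> X v" by (simp add: X_def)
    have SV: "S \<subseteq> V" using xV by (metis (mono_tags, lifting) S_def mem_Collect_eq neq0_conv subsetI)
    have finS: "finite S" using fin SV by (rule rev_finite_subset)
    have XS: "(\<Sum>v\<in>S. X v) = mass V x"
      unfolding mass_def using fin SV by (subst sum.mono_neutral_left[of V S]) (auto simp: S_def X_def)
    have X0: "\<forall>v. v \<notin> S \<longrightarrow> X v = 0" by (simp add: X_def S_def)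
    show ?case
    proof (cases "no_low V E x")
      case False
      then obtain v where v: "0 < x v" "wt X (lnk E v) < 999 / 64000 * mass V x ^ 3"
        by (auto simp: no_low_def X_def not_le)
      have vV: "v \<in> V" using v xV by (metis neq0_conv)
      define x' where "x' = x(v := x v - 1)"
      have "real (m1 x') < real (m1 x)"
        using mass_update[OF fin vV, of x "x v - 1"] v(1) unfolding mass x'_def by simp
      then have mem: "(x', x) \<in> measures [m1, m2, m3]" by simp
      have "\<forall>v. v \<notin> V \<longrightarrow> x' v = 0" using xV vV by (auto simp: x'_def)
      then have "P x'" by (rule IH[OF mem])
      then show ?thesis using v xV unfolding X_def x'_def by (intro low[of x v]) auto
    next
      case noLow: True
      show ?thesis
      proof (cases "\<exists>a\<in>S. \<exists>b\<in>S. a \<noteq> b \<and> \<not> cov E a b")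
        case True
        then obtain a b where ab: "a \<in> S" "b \<in> S" "a \<noteq> b" "\<not> cov E a b" by auto
        let ?d = "\<lambda>v. wt X (lnk E v)"
        \<comment> \<open>Weight moves to the vertex of larger degree; on a tie it moves to the
          heavier vertex, so that the sum of squares grows strictly.\<close>
        obtain u v where uv: "u \<in> S" "v \<in> S" "u \<noteq> v" "\<not> cov E u v"
          "?d v < ?d u \<or> (?d v = ?d u \<and> x v \<le> x u)"
        proof (cases "?d b < ?d a \<or> (?d b = ?d a \<and> x b \<le> x a)")
          case True
          then show ?thesis using ab that by blast
        next
          case False
          then have "?d a < ?d b \<or> (?d a = ?d b \<and> x a \<le> x b)" by linarith
          then show ?thesis using ab that cov_sym by metis
        qed
        have uvV: "u \<in> V" "v \<in> V" and pos: "0 < x u" "0 < x v" using uv SV by (auto simp: S_def)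
        define x' where "x' = x(v := x v - 1, u := x u + 1)"
        define X1 where "X1 = X(v := X v + (- 1))"
        define X' where "X' = (\<lambda>w. real (x' w))"
        have X': "X' = X1(u := X1 u + 1)"
          using pos uv(3) by (intro ext) (auto simp: X'_def X_def x'_def X1_def)
        \<comment> \<open>As \<open>u\<close> and \<open>v\<close> are uncovered, the degree of
          \<open>u\<close> does not involve the weight of \<open>v\<close>, and the change of the
          edge count is exactly \<open>?d u - ?d v\<close>.\<close>
        have "wt X1 (lnk E u) = ?d u"
          using uv(4) by (intro wt_cong) (auto simp: X1_def lnk_def cov_def)
        then have lamX: "wt X' E = wt X E - ?d v + ?d u"
          unfolding X' wt_add[OF finE fine] unfolding X1_def wt_add[OF finE fine] by simp
        have mass': "mass V x' = mass V x"
          unfolding x'_def using pos uv(3) by (simp add: mass_update[OF fin] uvV)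
        then have m1': "m1 x' = m1 x" by (simp add: mass)
        have mem: "(x', x) \<in> measures [m1, m2, m3]"
        proof (cases "?d v < ?d u")
          case True
          then have "real (lam x) < real (lam x')" using lamX by (simp add: lam X_def X'_def)
          then have "m2 x' < m2 x" using lam_le[of x'] m1' by (simp add: m2_def)
          then show ?thesis using m1' by simp
        next
          case False
          then have eq: "?d v = ?d u" "x v \<le> x u" using uv(5) by auto
          then have "real (lam x) = real (lam x')" using lamX by (simp add: lam X_def X'_def)
          then have m2': "m2 x' = m2 x" using m1' by (simp add: m2_def)
          have sq: "(\<Sum>w\<in>V. (y w)\<^sup>2) = (y u)\<^sup>2 + ((y v)\<^sup>2 + (\<Sum>w\<in>V - {u} - {v}. (y w)\<^sup>2))"
            for y :: "'a \<Rightarrow> nat"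
            using sum.remove[OF fin uvV(1), of "\<lambda>w. (y w)\<^sup>2"] sum.remove[of "V - {u}" v "\<lambda>w. (y w)\<^sup>2"]
              fin uvV uv(3) by simp
          have "(\<Sum>w\<in>V - {u} - {v}. (x' w)\<^sup>2) = (\<Sum>w\<in>V - {u} - {v}. (x w)\<^sup>2)"
            by (intro sum.cong) (auto simp: x'_def)
          moreover have "(x u)\<^sup>2 + (x v)\<^sup>2 < (x' u)\<^sup>2 + (x' v)\<^sup>2"
          proof -
            obtain k where k: "x v = Suc k" using pos by (cases "x v") auto
            obtain d where d: "x u = Suc k + d" using eq(2) k le_Suc_ex by metis
            show ?thesis using uv(3) by (simp add: x'_def k d power2_eq_square algebra_simps)
          qed
          ultimately have "(\<Sum>w\<in>V. (x w)\<^sup>2) < (\<Sum>w\<in>V. (x' w)\<^sup>2)" using sq[of x] sq[of x'] by simp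
          then have "m3 x' < m3 x" using sq_le[of x'] m1' by (simp add: m3_def)
          then show ?thesis using m1' m2' by simp
        qed
        have "\<forall>v. v \<notin> V \<longrightarrow> x' v = 0" using xV uvV by (auto simp: x'_def)
        then have "P x'" by (rule IH[OF mem])
        then show ?thesis
          using xV noLow pos uv(3) mass' lamX uv(5) unfolding x'_def X_def X'_def by (intro shift[of x u v]) auto
      next
        case False
        define E0 where "E0 = {e \<in> E. e \<subseteq> S}"
        have wtlnk: "wt X (lnk E0 s) = wt X (lnk E s)" if "s \<in> S" for s
        proof -
          have "lnk E0 s = {T \<in> lnk E s. T \<subseteq> S}" using that by (auto simp: lnk_def E0_def)
          then show ?thesis using wt_supp[OF finite_lnk[OF finE, of s] finT X0] by simp
        qed
        have "\<exists>f :: 'a \<Rightarrow> nat. inj_on f S \<and> (\<forall>v. f v < 4)"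
        proof (cases "S = {}")
          case True
          then show ?thesis by (intro exI[of _ "\<lambda>_. 0"]) simp
        next
          case ne: False
          have "card S = 4"
          proof (rule covered_design[OF finS ne _ nn])
            show "0 < X s" if "s \<in> S" for s using that by (simp add: X_def S_def)
            show "e \<subseteq> S \<and> card e = 4" if "e \<in> E0" for e using that E by (auto simp: E0_def)
            show "lnk E0 u \<inter> lnk E0 v = {}" if uv: "u \<in> S" "v \<in> S" "u \<noteq> v" for u v
            proof -
              have "cov E u v" using False uv by blast
              then have "lnk E u \<inter> lnk E v = {}" using canc uv(3) unfolding cancellative_def by blast
              moreover have "E0 \<subseteq> E" by (auto simp: E0_def)
              ultimately show ?thesis using lnk_mono[of E0 E] by blast
            qed
            show "999 / 64000 * (\<Sum>s\<in>S. X s) ^ 3 \<le> wt X (lnk E0 s)" if "s \<in> S" for s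
              using noLow that unfolding wtlnk[OF that] XS by (auto simp: no_low_def S_def X_def)
          qed
          then obtain f where f: "bij_betw f S {0..<4::nat}"
            using ex_bij_betw_finite_nat[OF finS] by auto
          define f' where "f' v = (if v \<in> S then f v else 0)" for v
          have "inj_on f' S" using f by (auto simp: bij_betw_def inj_on_def f'_def)
          moreover have "f' v < 4" for v
            using bij_betw_apply[OF f, of v] by (simp add: f'_def)
          ultimately show ?thesis by blast
        qed
        then obtain f :: "'a \<Rightarrow> nat" where "inj_on f S" "\<forall>v. f v < 4" by auto
        then show ?thesis
          using xV noLow by (intro rainbow[of x f]) (auto simp: S_def intro: inj_on_subset)
      qed
    qed
  qed
qed

section \<open>Weighted cancellative 4-graphs: bound and stability\<close>

lemma rainbow_weight_le:
  fixes x :: "'a \<Rightarrow> nat"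
  assumes fin: "finite V" and E: "\<And>e. e \<in> E \<Longrightarrow> e \<subseteq> V \<and> card e = 4"
    and c: "\<forall>v. c v < (4::nat)" "\<forall>e\<in>E. e \<subseteq> {v. 0 < x v} \<longrightarrow> inj_on c e"
  shows "wt (\<lambda>v. real (x v)) E \<le> mass V x ^ 4 / 256"
proof -
  have finE: "finite E" using E fin by (intro finite_subset[of E "Pow V"]) auto
  have fine: "\<forall>e\<in>E. finite e" using E fin by (auto intro: finite_subset)
  have "wt (\<lambda>v. real (x v)) E = wt (\<lambda>v. real (x v)) {e \<in> E. e \<subseteq> {v. 0 < x v}}"
    by (rule wt_supp[OF finE fine]) simp
  also have "\<dots> \<le> (\<Sum>v\<in>V. real (x v)) ^ 4 / 256"
    using c E by (intro wt_rainbow_le[OF fin, of c]) auto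
  finally show ?thesis by (simp add: mass_def)
qed

text \<open>Removing a unit of weight from mass W lowers W^4/256 by at least W^3/64 - 6 W^2/256, and
  the edge count by less than 999/64000 W^3. The former is larger once W^3/64000 >= 6 W^2/256, that
  is W >= 1500; below that the trivial bound W^4 goes into the additive constant.\<close>

lemma cancellative_weighted_bound:
  fixes x :: "'a \<Rightarrow> nat"
  assumes fin: "finite V" and E: "\<And>e. e \<in> E \<Longrightarrow> e \<subseteq> V \<and> card e = 4" and canc: "cancellative E"
    and xV: "\<forall>v. v \<notin> V \<longrightarrow> x v = 0"
  shows "wt (\<lambda>v. real (x v)) E \<le> mass V x ^ 4 / 256 + 1500 ^ 4"
proof (rule symmetrization_induct[OF fin E canc xV])
  have finE: "finite E" using E fin by (intro finite_subset[of E "Pow V"]) auto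
  have fine: "\<forall>e\<in>E. finite e" using E fin by (auto intro: finite_subset)
  fix x :: "'a \<Rightarrow> nat" assume xV: "\<forall>v. v \<notin> V \<longrightarrow> x v = 0"
  define W where "W = mass V x"
  define X where "X = (\<lambda>v. real (x v))"
  have W0: "0 \<le> W" unfolding W_def mass_def by (intro sum_nonneg) auto
  {
    fix v assume v: "0 < x v" "wt (\<lambda>v. real (x v)) (lnk E v) < 999 / 64000 * mass V x ^ 3"
      and IH: "wt (\<lambda>w. real ((x(v := x v - 1)) w)) E \<le> mass V (x(v := x v - 1)) ^ 4 / 256 + 1500 ^ 4"
    have vV: "v \<in> V" using v xV by (metis neq0_conv)
    show "wt (\<lambda>v. real (x v)) E \<le> mass V x ^ 4 / 256 + 1500 ^ 4"
    proof (cases "W \<le> 1500")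
      case True
      have "wt X E \<le> (\<Sum>v\<in>V. X v) ^ 4"
        using E by (intro wt_card_le fin) (auto simp: X_def)
      also have "\<dots> = W ^ 4" by (simp add: W_def mass_def X_def)
      also have "\<dots> \<le> 1500 ^ 4" using W0 True by (intro power_mono)
      finally show ?thesis using zero_le_power[OF W0, of 4] unfolding X_def W_def by linarith
    next
      case False
      have up: "(\<lambda>w. real ((x(v := x v - 1)) w)) = X(v := X v + (- 1))"
        using v by (intro ext) (auto simp: X_def)
      have m: "mass V (x(v := x v - 1)) = W - 1"
        using mass_update[OF fin vV, of x "x v - 1"] v(1) by (simp add: W_def)
      have "wt X E \<le> (W - 1) ^ 4 / 256 + 1500 ^ 4 + wt X (lnk E v)"
        using IH unfolding m up wt_add[OF finE fine] by simp
      moreover have "(W - 1) ^ 4 = W ^ 4 - 4 * W ^ 3 + 6 * W\<^sup>2 - (4 * W - 1)"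
        by (simp add: power4_eq_xxxx power3_eq_cube power2_eq_square algebra_simps)
      moreover have "1500 * W\<^sup>2 \<le> W * W\<^sup>2" using False by (intro mult_right_mono) auto
      then have "1500 * W\<^sup>2 \<le> W ^ 3" by (simp add: power3_eq_cube power2_eq_square)
      ultimately have "wt X E \<le> W ^ 4 / 256 + 1500 ^ 4"
        using v(2) False unfolding X_def[symmetric] W_def[symmetric] by linarith
      then show ?thesis by (simp add: X_def W_def)
    qed
  next
    fix u v assume "mass V (x(v := x v - 1, u := x u + 1)) = mass V x"
      "wt (\<lambda>v. real (x v)) E \<le> wt (\<lambda>w. real ((x(v := x v - 1, u := x u + 1)) w)) E"
      "wt (\<lambda>w. real ((x(v := x v - 1, u := x u + 1)) w)) E
        \<le> mass V (x(v := x v - 1, u := x u + 1)) ^ 4 / 256 + 1500 ^ 4"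
    then show "wt (\<lambda>v. real (x v)) E \<le> mass V x ^ 4 / 256 + 1500 ^ 4" by simp
  next
    fix c :: "'a \<Rightarrow> nat" assume c: "\<forall>v. c v < 4" "\<forall>e\<in>E. e \<subseteq> {v. 0 < x v} \<longrightarrow> inj_on c e"
    show "wt (\<lambda>v. real (x v)) E \<le> mass V x ^ 4 / 256 + 1500 ^ 4"
      using rainbow_weight_le[OF fin E c] by simp
  }
qed

text \<open>The colouring obtained for a completely symmetrized weighting is carried back through the shifts
  by \<open>rainbow_extension\<close>, so the exceptional set only collects the weight that was removed, and each
  unit of it lowers the deficit \<open>mass^4 / 256 - wt\<close> by at least \<open>kap\<close>. The
  slack 2 in the lower bound on the mass leaves room to exclude, by \<open>cancellative_weighted_bound\<close>, that
  too much weight is removed.\<close>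
lemma cancellative_weighted_stability:
  fixes x :: "'a \<Rightarrow> nat" and N :: real
  assumes fin: "finite V" and E: "\<And>e. e \<in> E \<Longrightarrow> e \<subseteq> V \<and> card e = 4"
    and canc: "cancellative E" and N: "1000000 \<le> N"
    and xV: "\<forall>v. v \<notin> V \<longrightarrow> x v = 0"
    and kap: "kap = N ^ 3 / 100000"
    and w: "mass V x \<le> N" "3999 / 4000 * N - 2 \<le> mass V x"
    and D: "mass V x ^ 4 / 256 - wt (\<lambda>v. real (x v)) E \<le> kap * (mass V x - 3999 / 4000 * N)"
  shows "\<exists>Z (c :: 'a \<Rightarrow> nat). Z \<subseteq> {v. 0 < x v} \<and>
    kap * (\<Sum>v\<in>Z. real (x v)) \<le> mass V x ^ 4 / 256 - wt (\<lambda>v. real (x v)) E \<and>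
    (\<forall>v. c v < 4) \<and> (\<forall>e\<in>E. e \<subseteq> {v. 0 < x v} - Z \<longrightarrow> inj_on c e) \<and>
    (\<forall>v\<in>{v. 0 < x v} - Z. 1555 / 100000 * N ^ 3 \<le> wt (\<lambda>v. real (x v)) (lnk E v))"
    (is "?Q x")
proof -
  define P where "P x \<longleftrightarrow> (mass V x \<le> N \<longrightarrow> 3999 / 4000 * N - 2 \<le> mass V x \<longrightarrow>
    mass V x ^ 4 / 256 - wt (\<lambda>v. real (x v)) E \<le> kap * (mass V x - 3999 / 4000 * N) \<longrightarrow> ?Q x)"
    for x :: "'a \<Rightarrow> nat"
  have finE: "finite E" using E fin by (intro finite_subset[of E "Pow V"]) auto
  have E': "E \<subseteq> {T. T \<subseteq> V \<and> card T = Suc 3}" using E by auto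
  have fine: "\<forall>e\<in>E. finite e" using E fin by (auto intro: finite_subset)
  have finT: "\<forall>T\<in>lnk E s. finite T" for s
    using lnk_uniform[OF E' fin, of s] fin by (auto intro: finite_subset)
  have N3: "0 < N ^ 3" using N by simp
  have kap0: "0 < kap" using N3 by (simp add: kap)
  have kapbig: "1500 ^ 4 < kap"
  proof -
    have "1000000 ^ 3 \<le> N ^ 3" using N by (intro power_mono) auto
    then show ?thesis by (simp add: kap)
  qed
  \<comment> \<open>The mass never falls more than N/4000 + 2 below \<open>N\<close>, which costs a
    factor 0.999 in the cube; then 0.999 * 999/64000 is still above the 0.01555 claimed.\<close>
  have cube: "999 / 1000 * N ^ 3 \<le> W ^ 3" if "3999 / 4000 * N - 2 \<le> W" for W
  proof -
    have "(9997 / 10000 * N) ^ 3 \<le> W ^ 3" using that N by (intro power_mono) auto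
    moreover have "(9997 / 10000 * N) ^ 3 \<ge> 999 / 1000 * N ^ 3"
      unfolding power_mult_distrib using N3 by (intro mult_right_mono) (auto simp: power3_eq_cube)
    ultimately show ?thesis by linarith
  qed
  have base: "?Q x"
    if xV: "\<forall>v. v \<notin> V \<longrightarrow> x v = 0" and nl: "no_low V E x" and w: "3999 / 4000 * N - 2 \<le> mass V x"
      and c: "\<forall>v. c v < (4::nat)" "\<forall>e\<in>E. e \<subseteq> {v. 0 < x v} \<longrightarrow> inj_on c e" for x :: "'a \<Rightarrow> nat" and c
  proof -
    have "wt (\<lambda>v. real (x v)) E \<le> mass V x ^ 4 / 256" by (rule rainbow_weight_le[OF fin E c])
    moreover have "1555 / 100000 * N ^ 3 \<le> wt (\<lambda>v. real (x v)) (lnk E v)" if "0 < x v" for v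
    proof -
      have "999 / 64000 * mass V x ^ 3 \<le> wt (\<lambda>v. real (x v)) (lnk E v)"
        using nl that by (simp add: no_low_def)
      then show ?thesis using cube[OF w] N3 by linarith
    qed
    ultimately show ?thesis using c by (intro exI[of _ "{}"] exI[of _ c]) auto
  qed
  have "P x"
  proof (rule symmetrization_induct[OF fin E canc xV])
    fix x :: "'a \<Rightarrow> nat" and v
    assume xV: "\<forall>v. v \<notin> V \<longrightarrow> x v = 0" and v: "0 < x v"
      "wt (\<lambda>v. real (x v)) (lnk E v) < 999 / 64000 * mass V x ^ 3" and IH: "P (x(v := x v - 1))"
    show "P x"
      unfolding P_def
    proof (intro impI)
      assume w: "mass V x \<le> N" "3999 / 4000 * N - 2 \<le> mass V x"
        and D: "mass V x ^ 4 / 256 - wt (\<lambda>v. real (x v)) E \<le> kap * (mass V x - 3999 / 4000 * N)"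
      have vV: "v \<in> V" using v xV by (metis neq0_conv)
      define X where "X = (\<lambda>v. real (x v))"
      define x' where "x' = x(v := x v - 1)"
      define X' where "X' = (\<lambda>v. real (x' v))"
      define W where "W = mass V x"
      have W: "3999 / 4000 * N - 2 \<le> W" "W \<le> N" using w by (auto simp: W_def)
      have D: "W ^ 4 / 256 - wt X E \<le> kap * (W - 3999 / 4000 * N)" using D by (simp add: W_def X_def)
      have X': "X' = X(v := X v + (- 1))" using v by (intro ext) (auto simp: X'_def X_def x'_def)
      have wt': "wt X' E = wt X E - wt X (lnk E v)" unfolding X' wt_add[OF finE fine] by simp
      have m: "mass V x' = W - 1"
        using mass_update[OF fin vV, of x "x v - 1"] v(1) by (simp add: W_def x'_def)
      \<comment> \<open>The main term of the gain is W^3/64000, about 1.56 * 10^-5 N^3;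
        \<open>kap\<close> is 10^-5 N^3 and leaves room for the term 6 W^2/256.\<close>
      have gain: "(W - 1) ^ 4 / 256 - wt X' E \<le> W ^ 4 / 256 - wt X E - kap"
      proof -
        have "(W - 1) ^ 4 = W ^ 4 - 4 * W ^ 3 + 6 * W\<^sup>2 - (4 * W - 1)"
          by (simp add: power4_eq_xxxx power3_eq_cube power2_eq_square algebra_simps)
        moreover have "1000000 * W\<^sup>2 \<le> N * N\<^sup>2"
          using N W by (intro mult_mono power_mono) auto
        then have "1000000 * W\<^sup>2 \<le> N ^ 3" by (simp add: power3_eq_cube power2_eq_square)
        moreover have "1 \<le> W" using W N by linarith
        moreover have "wt X (lnk E v) \<le> 999 / 64000 * W ^ 3" using v(2) by (simp add: X_def W_def)
        ultimately show ?thesis using wt' cube[OF W(1)] N3 unfolding kap by linarith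
      qed
      have g2: "kap * (W - 1 - 3999 / 4000 * N) = kap * (W - 3999 / 4000 * N) - kap"
        by (simp add: algebra_simps)
      \<comment> \<open>If the mass left the permitted range, the hypothesis on the deficit would
        make it at most \<open>- kap\<close>, below the \<open>- 1500 ^ 4\<close> guaranteed for
        every weighting.\<close>
      have "3999 / 4000 * N - 2 \<le> W - 1"
      proof (rule ccontr)
        assume "\<not> ?thesis"
        then have "kap * (W - 1 - 3999 / 4000 * N) \<le> kap * (- 2)" using kap0 by (intro mult_left_mono) auto
        then have "W ^ 4 / 256 - wt X E \<le> - kap" using D g2 by linarith
        moreover have "wt X E \<le> W ^ 4 / 256 + 1500 ^ 4"
          using cancellative_weighted_bound[OF fin E canc xV] by (simp add: X_def W_def)
        ultimately show False using kapbig by linarith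
      qed
      moreover have "(W - 1) ^ 4 / 256 - wt X' E \<le> kap * (W - 1 - 3999 / 4000 * N)"
        unfolding g2 using gain D by linarith
      moreover have "W - 1 \<le> N" using W by simp
      ultimately obtain Z' c where Z': "Z' \<subseteq> {v. 0 < x' v}" "kap * (\<Sum>v\<in>Z'. X' v) \<le> (W - 1) ^ 4 / 256 - wt X' E"
        "\<forall>v. c v < (4::nat)" "\<forall>e\<in>E. e \<subseteq> {v. 0 < x' v} - Z' \<longrightarrow> inj_on c e"
        "\<forall>v\<in>{v. 0 < x' v} - Z'. 1555 / 100000 * N ^ 3 \<le> wt X' (lnk E v)"
        using IH unfolding P_def x'_def[symmetric] m X'_def[symmetric]
        by (elim impE exE conjE) (assumption | rule that)+
      define S where "S = {v. 0 < x v}"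
      define S' where "S' = {v. 0 < x' v}"
      have S'S: "S' \<subseteq> S" by (auto simp: S'_def S_def x'_def split: if_splits)
      have SV: "S \<subseteq> V" using xV by (metis (mono_tags, lifting) S_def mem_Collect_eq neq0_conv subsetI)
      have finS: "finite S" using fin SV by (rule rev_finite_subset)
      \<comment> \<open>A vertex whose last unit was just removed is outside \<open>S'\<close> and
        joins the exceptional set. Since \<open>X\<close> exceeds \<open>X'\<close> only at
        \<open>v\<close> and only by 1, its weight grows by at most 1, which \<open>gain\<close>
        pays for.\<close>
      define Z where "Z = S - (S' - Z')"
      have SZ: "S - Z = S' - Z'" using S'S by (auto simp: Z_def)
      have X'X: "X' u \<le> X u" for u by (simp add: X'_def X_def x'_def)
      have "(\<Sum>v\<in>Z. X v) \<le> (\<Sum>v\<in>Z'. X' v) + 1"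
      proof -
        have sub: "Z' \<subseteq> Z" using Z'(1) S'S unfolding Z_def S'_def by blast
        have zero: "\<forall>w\<in>Z - Z'. X' w = 0" by (auto simp: Z_def S'_def X'_def)
        have finZ: "finite Z" using finS by (simp add: Z_def)
        have "(\<Sum>w\<in>Z. X w) \<le> (\<Sum>w\<in>Z. X' w + (if w = v then 1 else 0))"
          unfolding X' by (intro sum_mono) simp
        also have "\<dots> = (\<Sum>w\<in>Z. X' w) + (\<Sum>w\<in>Z. if w = v then 1 else 0)" by (rule sum.distrib)
        also have "\<dots> \<le> (\<Sum>w\<in>Z. X' w) + 1" using finZ by simp
        also have "(\<Sum>w\<in>Z. X' w) = (\<Sum>w\<in>Z'. X' w)" by (rule sum.mono_neutral_right[OF finZ sub zero])
        finally show ?thesis .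
      qed
      then have "kap * (\<Sum>v\<in>Z. X v) \<le> kap * ((\<Sum>v\<in>Z'. X' v) + 1)" using kap0 by (intro mult_left_mono) auto
      also have "\<dots> \<le> W ^ 4 / 256 - wt X E" using Z'(2) gain by (simp add: distrib_left)
      finally have c1: "kap * (\<Sum>v\<in>Z. X v) \<le> W ^ 4 / 256 - wt X E" .
      have c2: "1555 / 100000 * N ^ 3 \<le> wt X (lnk E u)" if "u \<in> S - Z" for u
      proof -
        have "wt X' (lnk E u) \<le> wt X (lnk E u)"
          unfolding wt_def using X'X by (intro sum_mono prod_mono) (auto simp: X'_def)
        moreover have "1555 / 100000 * N ^ 3 \<le> wt X' (lnk E u)"
          using Z'(5) that unfolding SZ S'_def by blast
        ultimately show ?thesis by linarith
      qed
      show "?Q x"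
        unfolding X_def[symmetric] S_def[symmetric] W_def[symmetric]
      proof (intro exI[of _ Z] exI[of _ c] conjI)
        show "Z \<subseteq> S" by (auto simp: Z_def)
        show "\<forall>e\<in>E. e \<subseteq> S - Z \<longrightarrow> inj_on c e" unfolding SZ using Z'(4) by (simp add: S'_def)
      qed (use c1 c2 Z'(3) in auto)
    qed
  next
    fix x :: "'a \<Rightarrow> nat" and u v
    assume xV: "\<forall>v. v \<notin> V \<longrightarrow> x v = 0" and nl: "no_low V E x" and uv: "0 < x u" "0 < x v" "u \<noteq> v"
      and m: "mass V (x(v := x v - 1, u := x u + 1)) = mass V x"
      and inc: "wt (\<lambda>v. real (x v)) E \<le> wt (\<lambda>w. real ((x(v := x v - 1, u := x u + 1)) w)) E"
      and IH: "P (x(v := x v - 1, u := x u + 1))"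
    show "P x"
      unfolding P_def
    proof (intro impI)
      assume w: "mass V x \<le> N" "3999 / 4000 * N - 2 \<le> mass V x"
        and D: "mass V x ^ 4 / 256 - wt (\<lambda>v. real (x v)) E \<le> kap * (mass V x - 3999 / 4000 * N)"
      define X where "X = (\<lambda>v. real (x v))"
      define x' where "x' = x(v := x v - 1, u := x u + 1)"
      define X' where "X' = (\<lambda>v. real (x' v))"
      define W where "W = mass V x"
      have W: "3999 / 4000 * N - 2 \<le> W" "W \<le> N" using w by (auto simp: W_def)
      have D: "W ^ 4 / 256 - wt X E \<le> kap * (W - 3999 / 4000 * N)" using D by (simp add: W_def X_def)
      have m: "mass V x' = W" using m by (simp add: x'_def W_def)
      have inc: "wt X E \<le> wt X' E" using inc by (simp add: X_def X'_def x'_def)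
      have "W ^ 4 / 256 - wt X' E \<le> kap * (W - 3999 / 4000 * N)" using D inc by linarith
      then obtain Z' c where Z': "Z' \<subseteq> {v. 0 < x' v}" "kap * (\<Sum>v\<in>Z'. X' v) \<le> W ^ 4 / 256 - wt X' E"
        "\<forall>v. c v < (4::nat)" "\<forall>e\<in>E. e \<subseteq> {v. 0 < x' v} - Z' \<longrightarrow> inj_on c e"
        "\<forall>v\<in>{v. 0 < x' v} - Z'. 1555 / 100000 * N ^ 3 \<le> wt X' (lnk E v)"
        using IH W unfolding P_def x'_def[symmetric] m X'_def[symmetric]
        by (elim impE exE conjE) (assumption | rule that)+
      define S where "S = {v. 0 < x v}"
      define S' where "S' = {v. 0 < x' v}"
      have S'S: "S' \<subseteq> S" using uv by (auto simp: S'_def S_def x'_def split: if_splits)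
      have SV: "S \<subseteq> V" using xV by (metis (mono_tags, lifting) S_def mem_Collect_eq neq0_conv subsetI)
      have finS: "finite S" using fin SV by (rule rev_finite_subset)
      define Y where "Y = S - (S' - Z')"
      have SY: "S - Y = S' - Z'" using S'S by (auto simp: Y_def)
      have XS: "(\<Sum>v\<in>S. X v) = W"
        unfolding W_def mass_def using fin SV
        by (subst sum.mono_neutral_left[of V S]) (auto simp: S_def X_def)
      have "kap * (\<Sum>v\<in>Z'. X' v) \<le> kap * (W - 3999 / 4000 * N)"
        using Z'(2) inc D by linarith
      then have Z'4000: "(\<Sum>v\<in>Z'. X' v) \<le> W - 3999 / 4000 * N" using kap0 by simp
      have sub: "Z' \<subseteq> Y" using Z'(1) S'S unfolding Y_def S'_def by blast
      have zero: "\<forall>w\<in>Y - Z'. X' w = 0" by (auto simp: Y_def S'_def X'_def)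
      have finY: "finite Y" using finS by (simp add: Y_def)
      have "(\<Sum>w\<in>Y. X w) \<le> (\<Sum>w\<in>Y. X' w + (if w = v then 1 else 0))"
        using uv by (intro sum_mono) (simp add: X_def X'_def x'_def)
      also have "\<dots> = (\<Sum>w\<in>Y. X' w) + (\<Sum>w\<in>Y. if w = v then 1 else 0)" by (rule sum.distrib)
      also have "\<dots> \<le> (\<Sum>w\<in>Y. X' w) + 1" using finY by simp
      also have "(\<Sum>w\<in>Y. X' w) = (\<Sum>w\<in>Z'. X' w)"
        by (rule sum.mono_neutral_right[OF finY sub zero])
      \<comment> \<open>\<open>Z'\<close> weighs at most W - 3999/4000 N <= W/4000; the unit taken
        from \<open>v\<close> is absorbed by the other W/4000.\<close>
      finally have Ysum: "(\<Sum>w\<in>Y. X w) \<le> W / 2000" using Z'4000 W N by linarith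
      have nn: "\<forall>v. 0 \<le> X v" by (simp add: X_def)
      define E0 where "E0 = {e \<in> E. e \<subseteq> S}"
      have X0: "\<forall>v. v \<notin> S \<longrightarrow> X v = 0" by (simp add: X_def S_def)
      have W3: "0 < W ^ 3" using cube[OF W(1)] N3 by linarith
      have deg: "155 / 10000 * W ^ 3 \<le> wt X (lnk E0 s)" if "s \<in> S" for s
      proof -
        have "lnk E0 s = {T \<in> lnk E s. T \<subseteq> S}" using that by (auto simp: lnk_def E0_def)
        then have "wt X (lnk E0 s) = wt X (lnk E s)"
          using wt_supp[OF finite_lnk[OF finE, of s] finT X0] by simp
        moreover have "999 / 64000 * W ^ 3 \<le> wt X (lnk E s)"
          using nl that by (auto simp: no_low_def S_def X_def W_def)
        ultimately show ?thesis using W3 by linarith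
      qed
      have disj: "wt X (lnk E0 s \<inter> lnk E0 s') \<le> W ^ 3 / 2000" if "s \<noteq> s'" "cov E0 s s'" for s s'
      proof -
        have "cov E s s'" using that by (auto simp: cov_def E0_def)
        then have "lnk E s \<inter> lnk E s' = {}" using canc that(1) unfolding cancellative_def by blast
        then have "lnk E0 s \<inter> lnk E0 s' = {}" using lnk_mono[of E0 E] by (fastforce simp: E0_def)
        then show ?thesis using W3 by (simp add: wt_def)
      qed
      \<comment> \<open>Here all degrees are large, so the extension colours the entire support:
        each shift resets the exceptional set to the empty set, and errors do not accumulate over
        shifts.\<close>
      have "\<exists>c' :: 'a \<Rightarrow> nat. (\<forall>s. c' s < 4) \<and> (\<forall>e\<in>E0. inj_on c' e)"
      proof (rule rainbow_extension[OF finS _ nn _ order_refl XS[symmetric]])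
        show "0 < W" using W N by linarith
        show "Y \<subseteq> S" by (auto simp: Y_def)
        show "inj_on c e" if "e \<in> E0" "e \<subseteq> S - Y" for e
          using that Z'(4) unfolding SY by (auto simp: E0_def S'_def)
      qed (use Ysum Z'(3) deg disj E in \<open>auto simp: E0_def S_def X_def Y_def\<close>)
      then obtain c' :: "'a \<Rightarrow> nat" where "\<forall>s. c' s < 4" "\<forall>e\<in>E. e \<subseteq> {v. 0 < x v} \<longrightarrow> inj_on c' e"
        by (auto simp: E0_def S_def)
      then show "?Q x" by (rule base[OF xV nl w(2)])
    qed
  next
    fix x :: "'a \<Rightarrow> nat" and c :: "'a \<Rightarrow> nat"
    assume *: "\<forall>v. v \<notin> V \<longrightarrow> x v = 0" "no_low V E x" "\<forall>v. c v < 4"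
      "\<forall>e\<in>E. e \<subseteq> {v. 0 < x v} \<longrightarrow> inj_on c e"
    show "P x"
      unfolding P_def
    proof (intro impI)
      assume "3999 / 4000 * N - 2 \<le> mass V x"
      then show "?Q x" by (rule base[OF *(1,2) _ *(3,4)])
    qed
  qed
  from this[unfolded P_def, THEN mp, THEN mp, THEN mp, OF w D] show ?thesis .
qed

text \<open>The weighted statement for the indicator of \<open>V\<close>. The permitted deficit is
  \<open>kap * N / 4000\<close>, with \<open>kap\<close> = N^3/100000; this is the N^4/400000000 in
  the hypothesis.\<close>

lemma cancellative_stability:
  fixes V :: "'a set"
  assumes fin: "finite V" and E: "\<And>e. e \<in> E \<Longrightarrow> e \<subseteq> V \<and> card e = 4"
    and canc: "cancellative E" and n: "1000000 \<le> card V"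
    and dense: "real (card V) ^ 4 / 256 - real (card V) ^ 4 / 400000000 \<le> real (card E)"
  shows "\<exists>Z (c :: 'a \<Rightarrow> nat). Z \<subseteq> V \<and> real (card Z) \<le> real (card V) / 4000 \<and>
    (\<forall>v. c v < 4) \<and> (\<forall>e\<in>E. e \<subseteq> V - Z \<longrightarrow> inj_on c e) \<and>
    (\<forall>v\<in>V - Z. 1555 / 100000 * real (card V) ^ 3 \<le> real (card (lnk E v)))"
proof -
  define N where "N = real (card V)"
  define kap where "kap = N ^ 3 / 100000"
  define x :: "'a \<Rightarrow> nat" where "x v = (if v \<in> V then 1 else 0)" for v
  have N: "1000000 \<le> N" using n by (simp add: N_def)
  have mass: "mass V x = N" by (simp add: mass_def x_def N_def)
  have supp: "{v. 0 < x v} = V" by (auto simp: x_def)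
  have wt1: "wt (\<lambda>v. real (x v)) F = real (card F)" if "\<And>T. T \<in> F \<Longrightarrow> T \<subseteq> V" for F
    using wt_cong[of F "\<lambda>v. real (x v)" "\<lambda>_. 1"] that by (force simp: x_def)
  have wtE: "wt (\<lambda>v. real (x v)) E = real (card E)" using E by (intro wt1) auto
  have wtl: "wt (\<lambda>v. real (x v)) (lnk E v) = real (card (lnk E v))" for v
    using E by (intro wt1) (auto simp: lnk_def)
  have D: "N ^ 4 / 256 - real (card E) \<le> kap * (N / 4000)"
    using dense by (simp add: N_def kap_def power4_eq_xxxx power3_eq_cube)
  have "kap * (N - 3999 / 4000 * N) = kap * (N / 4000)" by simp
  then obtain Z and c :: "'a \<Rightarrow> nat" where Z: "Z \<subseteq> V" "kap * (\<Sum>v\<in>Z. real (x v)) \<le> N ^ 4 / 256 - real (card E)"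
    "\<forall>v. c v < 4" "\<forall>e\<in>E. e \<subseteq> V - Z \<longrightarrow> inj_on c e"
    "\<forall>v\<in>V - Z. 1555 / 100000 * N ^ 3 \<le> real (card (lnk E v))"
    using cancellative_weighted_stability[OF fin E canc N _ kap_def, of x] D N
    unfolding mass supp wtE wtl by (auto simp: x_def)
  have "(\<Sum>v\<in>Z. real (x v)) = real (card Z)"
    using Z(1) by (simp add: x_def subset_iff sum.cong[of Z Z "\<lambda>v. real (if v \<in> V then 1 else 0)" "\<lambda>_. 1"])
  then have "kap * real (card Z) \<le> kap * (N / 4000)" using Z(2) D by simp
  then have "real (card Z) \<le> N / 4000" using N by (simp add: kap_def)
  then show ?thesis using Z unfolding N_def by blast
qed

section \<open>Generalized triangles\<close>

text \<open>The copies of \<open>T4\<close>, with \<open>T = {1, 2, 3}\<close> and \<open>x, y, z, w = 4, 5, 6, 7\<close>; the seven vertices are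
  distinct because of \<open>card S = 7\<close>.\<close>
definition tri :: "'a set set \<Rightarrow> 'a set \<Rightarrow> bool" where
  "tri E S \<longleftrightarrow> (\<exists>T x y z w. S = T \<union> {x, y, z, w} \<and> card T = 3 \<and> card S = 7 \<and>
     insert x T \<in> E \<and> insert y T \<in> E \<and> {x, y, z, w} \<in> E)"

definition tri_free :: "'a set set \<Rightarrow> bool" where
  "tri_free E \<longleftrightarrow> (\<forall>S. \<not> tri E S)"

lemma tri_mono: "tri F S \<Longrightarrow> F \<subseteq> E \<Longrightarrow> tri E S"
  unfolding tri_def by blast

lemma card_4_pair:
  assumes "card e = 4" "u \<in> e" "v \<in> e" "u \<noteq> v"
  obtains z w where "e = {u, v, z, w}" "u \<noteq> z" "u \<noteq> w" "v \<noteq> z" "v \<noteq> w" "z \<noteq> w"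
proof -
  have "finite e" using assms(1) by (metis card.infinite zero_neq_numeral)
  then have "card (e - {u, v}) = 2" using assms by (simp add: card_Diff_subset)
  then obtain z w where zw: "e - {u, v} = {z, w}" "z \<noteq> w" by (auto simp: card_2_iff)
  then have "e = {u, v, z, w}" using assms by auto
  moreover have "z \<noteq> u" "z \<noteq> v" "w \<noteq> u" "w \<noteq> v" using zw by auto
  ultimately show ?thesis using that zw(2) by metis
qed

lemma triI:
  assumes "T \<in> lnk E u" "T \<in> lnk E v" "u \<noteq> v" "e \<in> E" "u \<in> e" "v \<in> e" "card e = 4" "card T = 3"
    and "T \<inter> e = {}"
  shows "tri E (T \<union> e)"
proof -
  obtain z w where e: "e = {u, v, z, w}" using card_4_pair[OF assms(7,5,6,3)] by metis
  have "finite e" "finite T" using assms(7,8) by (metis card.infinite zero_neq_numeral)+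
  then have "card (T \<union> e) = 7" using assms by (simp add: card_Un_disjoint)
  moreover have "T \<union> e = T \<union> {u, v, z, w}" "insert u T \<in> E" "insert v T \<in> E" "{u, v, z, w} \<in> E"
    using assms(1,2,4) e by (auto simp: lnk_def)
  ultimately show ?thesis unfolding tri_def using assms(8) by blast
qed

text \<open>The maximized quantity forces every covered pair to have codegree more than \<open>3 n\<close>, which leaves
  an edge through the pair that avoids a given common triple of the two links.\<close>
lemma tri_free_cleaning:
  fixes V :: "'a set"
  assumes fin: "finite V" and E: "\<And>e. e \<in> E \<Longrightarrow> e \<subseteq> V \<and> card e = 4" and free: "tri_free E"
  obtains F where "F \<subseteq> E" "cancellative F" "card E \<le> card F + (3 * card V + 1) * (card V)\<^sup>2"
proof -
  define n where "n = card V"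
  define U where "U F = {p. p \<subseteq> V \<and> card p = 2 \<and> (\<forall>e\<in>F. \<not> p \<subseteq> e)}" for F :: "'a set set"
  define phi where "phi F = card F + (3 * n + 1) * card (U F)" for F
  have finE: "finite E" using E fin by (intro finite_subset[of E "Pow V"]) auto
  have finU: "finite (U F)" for F using fin by (intro finite_subset[of "U F" "Pow V"]) (auto simp: U_def)
  have "finite (phi ` Pow E)" "phi ` Pow E \<noteq> {}" using finE by auto
  then have "Max (phi ` Pow E) \<in> phi ` Pow E" by (rule Max_in)
  then obtain F where F: "F \<subseteq> E" "phi F = Max (phi ` Pow E)" by auto
  have max: "phi G \<le> phi F" if "G \<subseteq> E" for G using that F(2) finE by simp
  have finF: "finite F" using finE F(1) by (rule rev_finite_subset)
  have "card (U F) \<le> card {p. p \<subseteq> V \<and> card p = 2}"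
    using fin by (intro card_mono) (auto simp: U_def)
  also have "\<dots> = n choose 2" using n_subsets[OF fin] by (simp add: n_def)
  also have "\<dots> \<le> n * (n - 1)" by (simp add: choose_two)
  also have "\<dots> \<le> n * n" by (rule mult_le_mono2) simp
  finally have "(3 * n + 1) * card (U F) \<le> (3 * n + 1) * n\<^sup>2"
    unfolding power2_eq_square by (rule mult_le_mono2)
  then have "phi F \<le> card F + (3 * n + 1) * n\<^sup>2" unfolding phi_def by linarith
  moreover have "card E \<le> phi E" by (simp add: phi_def)
  ultimately have count: "card E \<le> card F + (3 * card V + 1) * (card V)\<^sup>2"
    using max[of E] by (simp add: n_def)
  have "lnk F u \<inter> lnk F v = {}" if uv: "u \<noteq> v" "cov F u v" for u v
  proof (rule ccontr)
    assume "lnk F u \<inter> lnk F v \<noteq> {}"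
    then obtain T where T: "T \<in> lnk F u" "T \<in> lnk F v" by auto
    define C where "C = {e \<in> F. u \<in> e \<and> v \<in> e}"
    have uvV: "u \<in> V" "v \<in> V" using uv F(1) E by (auto simp: cov_def)
    have finC: "finite C" using finF by (simp add: C_def)
    have T3: "T \<subseteq> V \<and> card T = 3 \<and> finite T \<and> u \<notin> T \<and> v \<notin> T"
    proof -
      have "insert u T \<in> E" "u \<notin> T" "v \<notin> T" using T F(1) by (auto simp: lnk_def)
      then have *: "insert u T \<subseteq> V" "card (insert u T) = 4" using E by auto
      then have "finite (insert u T)" using fin by (metis finite_subset)
      then show ?thesis using * \<open>u \<notin> T\<close> \<open>v \<notin> T\<close> by auto
    qed
    \<comment> \<open>Deleting at most 3n edges to uncover {u, v} would gain 3n + 1 in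
      \<open>phi\<close>.\<close>
    have big: "3 * n < card C"
    proof (rule ccontr)
      assume small: "\<not> 3 * n < card C"
      have "card (F - C) = card F - card C" using finC by (intro card_Diff_subset) (auto simp: C_def)
      moreover have "card C \<le> card F" using finF by (intro card_mono) (auto simp: C_def)
      moreover have "insert {u, v} (U F) \<subseteq> U (F - C)" using uv uvV by (auto simp: U_def C_def)
      then have "card (insert {u, v} (U F)) \<le> card (U (F - C))" by (intro card_mono finU)
      moreover have "{u, v} \<notin> U F" using uv by (auto simp: U_def cov_def)
      ultimately have c: "card F \<le> card (F - C) + 3 * n" "card (U F) + 1 \<le> card (U (F - C))"
        using small finU by auto
      have "(3 * n + 1) * (card (U F) + 1) \<le> (3 * n + 1) * card (U (F - C))"
        using c(2) by (rule mult_le_mono2)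
      then have "phi F < phi (F - C)" using c(1) by (simp add: phi_def)
      then show False using max[of "F - C"] F(1) by auto
    qed
    have "card {e \<in> C. e \<inter> T \<noteq> {}} \<le> 3 * n"
    proof -
      \<comment> \<open>Such an edge is determined by a vertex \<open>a\<close> of \<open>T\<close>,
        with 3 choices, and one more vertex, with \<open>n\<close> choices.\<close>
      have "{e \<in> C. e \<inter> T \<noteq> {}} \<subseteq> (\<lambda>(a, b). {u, v, a, b}) ` (T \<times> V)"
      proof
        fix e assume "e \<in> {e \<in> C. e \<inter> T \<noteq> {}}"
        then have e: "e \<in> F" "u \<in> e" "v \<in> e" and "e \<inter> T \<noteq> {}" by (auto simp: C_def)
        then obtain a where a: "a \<in> e" "a \<in> T" by auto
        have e4: "e \<subseteq> V" "card e = 4" using E F(1) e by auto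
        obtain z w where zw: "e = {u, v, z, w}" using card_4_pair[OF e4(2) e(2,3) uv(1)] by metis
        have "a = z \<or> a = w" using a T3 zw by auto
        then have "e = {u, v, a, if a = z then w else z}" using zw by auto
        moreover have "(if a = z then w else z) \<in> V" using e4(1) zw by auto
        ultimately show "e \<in> (\<lambda>(a, b). {u, v, a, b}) ` (T \<times> V)"
          using a by (intro image_eqI[of _ _ "(a, if a = z then w else z)"]) auto
      qed
      then have "card {e \<in> C. e \<inter> T \<noteq> {}} \<le> card ((\<lambda>(a, b). {u, v, a, b}) ` (T \<times> V))"
        using T3 fin by (intro card_mono) auto
      also have "\<dots> \<le> card (T \<times> V)" using T3 fin by (intro card_image_le) auto
      finally show ?thesis using T3 by (simp add: n_def card_cartesian_product)
    qed
    then have "{e \<in> C. e \<inter> T \<noteq> {}} \<noteq> C" using big by (metis not_le)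
    then obtain e where e: "e \<in> C" "e \<inter> T = {}" by auto
    then have "tri F (T \<union> e)"
      using T T3 uv(1) E F(1) by (intro triI[of T F u v e]) (auto simp: C_def)
    then show False using free tri_mono[OF _ F(1)] unfolding tri_free_def by blast
  qed
  then have "cancellative F" unfolding cancellative_def by blast
  then show ?thesis using that F(1) count by blast
qed

text \<open>Cleaning loses at most 4 n^3 edges. The difference between the tolerances 1/400000000
  and 1/500000000 is n^4/2000000000, which covers this loss for n at least 8 * 10^9.\<close>

lemma tri_free_stability:
  fixes V :: "'a set"
  assumes fin: "finite V" and E: "\<And>e. e \<in> E \<Longrightarrow> e \<subseteq> V \<and> card e = 4" and free: "tri_free E"
    and n: "10000000000 \<le> card V"
    and dense: "real (card V) ^ 4 / 256 - real (card V) ^ 4 / 500000000 \<le> real (card E)"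
  obtains F Z and c :: "'a \<Rightarrow> nat" where "F \<subseteq> E" "Z \<subseteq> V" "real (card Z) \<le> real (card V) / 4000"
    "\<And>v. c v < 4" "\<And>e. e \<in> F \<Longrightarrow> e \<subseteq> V - Z \<Longrightarrow> inj_on c e"
    "\<And>v. v \<in> V - Z \<Longrightarrow> 1555 / 100000 * real (card V) ^ 3 \<le> real (card (lnk F v))"
proof -
  define N where "N = real (card V)"
  have N: "10000000000 \<le> N" using n by (simp add: N_def)
  obtain F where F: "F \<subseteq> E" "cancellative F" "card E \<le> card F + (3 * card V + 1) * (card V)\<^sup>2"
    using tri_free_cleaning[OF fin E free] by metis
  have "real (card E) \<le> real (card F + (3 * card V + 1) * (card V)\<^sup>2)" using F(3) by (simp only: of_nat_le_iff)
  then have "real (card E) \<le> real (card F) + (3 * N + 1) * N\<^sup>2"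
    by (simp add: N_def distrib_right)
  moreover have "(3 * N + 1) * N\<^sup>2 \<le> (4 * N) * N\<^sup>2" using N by (intro mult_right_mono) auto
  moreover have "10000000000 * N ^ 3 \<le> N * N ^ 3" using N by (intro mult_right_mono) auto
  moreover have "(4 * N) * N\<^sup>2 = 4 * N ^ 3" "N * N ^ 3 = N ^ 4"
    by (simp_all add: power4_eq_xxxx power3_eq_cube power2_eq_square)
  ultimately have "N ^ 4 / 256 - N ^ 4 / 400000000 \<le> real (card F)"
    using dense unfolding N_def[symmetric] by linarith
  then have "\<exists>Z (c :: 'a \<Rightarrow> nat). Z \<subseteq> V \<and> real (card Z) \<le> real (card V) / 4000 \<and>
    (\<forall>v. c v < 4) \<and> (\<forall>e\<in>F. e \<subseteq> V - Z \<longrightarrow> inj_on c e) \<and>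
    (\<forall>v\<in>V - Z. 1555 / 100000 * real (card V) ^ 3 \<le> real (card (lnk F v)))"
    unfolding N_def using E F(1) n by (intro cancellative_stability[OF fin _ F(2)]) auto
  then obtain Z and c :: "'a \<Rightarrow> nat" where Z: "Z \<subseteq> V \<and> real (card Z) \<le> real (card V) / 4000 \<and>
    (\<forall>v. c v < 4) \<and> (\<forall>e\<in>F. e \<subseteq> V - Z \<longrightarrow> inj_on c e) \<and>
    (\<forall>v\<in>V - Z. 1555 / 100000 * real (card V) ^ 3 \<le> real (card (lnk F v)))"
    by (elim exE)
  show ?thesis by (rule that[OF F(1), of Z c]) (use Z in blast)+
qed

text \<open>In a \<open>T4\<close>-free 4-graph links of covered vertices need not be disjoint, but
  each common triple meets every edge covering the two, so there are at most 4 n^2 of them. This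
  suffices for the extension step, which then colours all of \<open>E\<close>, not just the cleaned
  part \<open>F\<close>.\<close>

lemma tri_free_min_degree:
  fixes V :: "'a set"
  assumes fin: "finite V" and E: "\<And>e. e \<in> E \<Longrightarrow> e \<subseteq> V \<and> card e = 4" and free: "tri_free E"
    and n: "10000000000 \<le> card V"
    and dense: "real (card V) ^ 4 / 256 - real (card V) ^ 4 / 500000000 \<le> real (card E)"
    and deg: "\<And>v. v \<in> V \<Longrightarrow> 155 / 10000 * real (card V) ^ 3 \<le> real (card (lnk E v))"
  obtains c :: "'a \<Rightarrow> nat" where "\<And>v. c v < 4" "\<And>e. e \<in> E \<Longrightarrow> inj_on c e"
proof -
  define N where "N = real (card V)"
  have N: "10000000000 \<le> N" using n by (simp add: N_def)
  have E': "E \<subseteq> {T. T \<subseteq> V \<and> card T = Suc 3}" using E by auto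
  obtain F Z and c :: "'a \<Rightarrow> nat" where F: "F \<subseteq> E" "Z \<subseteq> V" "real (card Z) \<le> N / 4000"
    "\<And>v. c v < 4" "\<And>e. e \<in> F \<Longrightarrow> e \<subseteq> V - Z \<Longrightarrow> inj_on c e"
    "\<And>v. v \<in> V - Z \<Longrightarrow> 1555 / 100000 * N ^ 3 \<le> real (card (lnk F v))"
    using tri_free_stability[OF fin E free n dense] unfolding N_def by metis
  have common: "real (card (lnk E s \<inter> lnk E s')) \<le> N ^ 3 / 2000" if "s \<noteq> s'" "cov E s s'" for s s'
  proof -
    obtain e where e: "e \<in> E" "s \<in> e" "s' \<in> e" using \<open>cov E s s'\<close> by (auto simp: cov_def)
    have e4: "e \<subseteq> V" "card e = 4" using E e by auto
    have meet: "lnk E s \<inter> lnk E s' \<subseteq> {T. T \<subseteq> V \<and> card T = Suc 2 \<and> T \<inter> e \<noteq> {}}"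
    proof
      fix T assume T: "T \<in> lnk E s \<inter> lnk E s'"
      then have T3: "T \<subseteq> V" "card T = 3" using lnk_uniform[OF E' fin, of s] by auto
      have "T \<inter> e \<noteq> {}"
      proof
        assume "T \<inter> e = {}"
        then have "tri E (T \<union> e)" using T T3 e e4 \<open>s \<noteq> s'\<close> by (intro triI[of T E s s' e]) auto
        then show False using free by (simp add: tri_free_def)
      qed
      then show "T \<in> {T. T \<subseteq> V \<and> card T = Suc 2 \<and> T \<inter> e \<noteq> {}}" using T3 by simp
    qed
    have "wt (\<lambda>_. 1) (lnk E s \<inter> lnk E s') \<le> (\<Sum>v\<in>e. 1) * (\<Sum>v\<in>V. 1) ^ 2"
      by (rule wt_hit_le[OF fin e4(1) meet]) simp
    then have "real (card (lnk E s \<inter> lnk E s')) \<le> 4 * N\<^sup>2" using e4 by (simp add: N_def)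
    also have "8000 * N\<^sup>2 \<le> N * N\<^sup>2" using N by (intro mult_right_mono) auto
    then have "4 * N\<^sup>2 \<le> N ^ 3 / 2000" by (simp add: power3_eq_cube power2_eq_square)
    finally show ?thesis .
  qed
  have "\<exists>c' :: 'a \<Rightarrow> nat. (\<forall>s. c' s < 4) \<and> (\<forall>e\<in>E. inj_on c' e)"
  proof (rule rainbow_extension[OF fin _ _ E F(1), of "\<lambda>_. 1" N Z c])
    show "155 / 10000 * N ^ 3 \<le> wt (\<lambda>_. 1) (lnk F s)" if "s \<in> V - Z" for s
    proof -
      have "0 \<le> N ^ 3" using N by simp
      then show ?thesis using F(6)[OF that] by simp
    qed
  qed (use F deg N common in \<open>auto simp: N_def\<close>)
  then show ?thesis using that by blast
qed

section \<open>The exact result without disjoint copies\<close>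

text \<open>The edge number of T_4(n,4): the four factors are the sizes of a balanced partition into
  four classes.\<close>

definition turan4 :: "nat \<Rightarrow> nat" where
  "turan4 n = (n div 4) * ((n + 1) div 4) * ((n + 2) div 4) * ((n + 3) div 4)"

lemma div4_ge: "(real k - 3) / 4 \<le> real (k div 4)"
proof -
  have "k \<le> 4 * (k div 4) + 3" by presburger
  then have "real k \<le> real (4 * (k div 4) + 3)" by (simp only: of_nat_le_iff)
  then show ?thesis by simp
qed

text \<open>Passing to n + 1 shifts the factors: three stay, and \<open>n div 4\<close> is replaced
  by \<open>n div 4 + 1\<close>.\<close>

lemma turan4_Suc:
  "real (turan4 (Suc n)) =
    real (turan4 n) + real ((n + 1) div 4) * real ((n + 2) div 4) * real ((n + 3) div 4)"
proof -
  define P where "P = ((n + 1) div 4) * ((n + 2) div 4) * ((n + 3) div 4)"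
  have "turan4 (Suc n) = (n + 1) div 4 * ((n + 2) div 4) * ((n + 3) div 4) * ((n + 4) div 4)"
    unfolding turan4_def by (intro arg_cong2[where f = "(*)"] arg_cong[where f = "\<lambda>k. k div 4"]) auto
  moreover have "(n + 4) div 4 = n div 4 + 1" by presburger
  ultimately have "turan4 (Suc n) = P * (n div 4 + 1)" unfolding P_def by (simp only:)
  moreover have "turan4 n = P * (n div 4)" unfolding turan4_def P_def by (simp only: mult_ac)
  ultimately have "turan4 (Suc n) = turan4 n + P" by simp
  then have "real (turan4 (Suc n)) = real (turan4 n) + real P" by simp
  then show ?thesis by (simp add: P_def)
qed

lemma turan4_Suc_ge:
  assumes "3 \<le> n"
  shows "real (turan4 n) + ((real n - 3) / 4) ^ 3 \<le> real (turan4 (Suc n))"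
proof -
  have "((real n - 3) / 4) * ((real n - 3) / 4) * ((real n - 3) / 4) \<le>
      real ((n + 1) div 4) * real ((n + 2) div 4) * real ((n + 3) div 4)"
    using assms div4_ge[of "n + 1"] div4_ge[of "n + 2"] div4_ge[of "n + 3"]
    by (intro mult_mono) auto
  then show ?thesis unfolding turan4_Suc power3_eq_cube by linarith
qed

lemma turan4_lower: "((real n - 3) / 4) ^ 4 \<le> real (turan4 n)" if "3 \<le> n"
proof -
  have d: "(real n - 3) / 4 \<le> real (k div 4)" if "n \<le> k" for k
    using div4_ge[of k] that by simp
  have "(real n - 3) / 4 * ((real n - 3) / 4) * ((real n - 3) / 4) * ((real n - 3) / 4) \<le>
      real (n div 4) * real ((n + 1) div 4) * real ((n + 2) div 4) * real ((n + 3) div 4)"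
    using that by (intro mult_mono d mult_nonneg_nonneg) auto
  then show ?thesis unfolding turan4_def by (simp add: power4_eq_xxxx)
qed

lemma turan4_pos: "0 < turan4 n" if "4 \<le> n"
  using that by (simp add: turan4_def div_greater_zero_iff)

section \<open>Balanced class sizes maximize the product\<close>

lemma prod_4: "(\<Prod>i<4. f i) = f 0 * f 1 * f 2 * (f (3::nat) :: 'a :: comm_monoid_mult)"
  unfolding lessThan_4 by (simp add: mult_ac)

lemma sum_4: "(\<Sum>i<4. f i) = f 0 + f 1 + f 2 + (f (3::nat) :: 'a :: comm_monoid_add)"
  unfolding lessThan_4 by (simp add: add_ac)

lemma turan4_values:
  "turan4 (4 * q) = q * q * q * q"
  "turan4 (4 * q + 1) = q * q * q * (q + 1)"
  "turan4 (4 * q + 2) = q * q * (q + 1) * (q + 1)"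
  "turan4 (4 * q + 3) = q * (q + 1) * (q + 1) * (q + 1)"
  "turan4 (4 * q + 4) = (q + 1) * (q + 1) * (q + 1) * (q + 1)"
proof -
  have d: "(4 * q + r) div 4 = q + r div 4" for r by simp
  show "turan4 (4 * q) = q * q * q * q"
    "turan4 (4 * q + 1) = q * q * q * (q + 1)"
    "turan4 (4 * q + 2) = q * q * (q + 1) * (q + 1)"
    "turan4 (4 * q + 3) = q * (q + 1) * (q + 1) * (q + 1)"
    "turan4 (4 * q + 4) = (q + 1) * (q + 1) * (q + 1) * (q + 1)"
    unfolding turan4_def add.assoc d by simp_all
qed

lemma shifted_prod_eq_turan4:
  assumes "b0 = 0 \<or> b0 = 1" "b1 = 0 \<or> b1 = 1" "b2 = 0 \<or> b2 = 1" "b3 = 0 \<or> b3 = (1::nat)"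
  shows "(q + b0) * (q + b1) * (q + b2) * (q + b3) = turan4 (4 * q + (b0 + b1 + b2 + b3))"
  using assms
  by (elim disjE; hypsubst)
    (simp_all only: add_0_right add_0_left one_add_one numeral_plus_one one_plus_numeral
      numeral_plus_numeral arith_simps turan4_values, simp_all only: mult_ac)

lemma balanced_prod_eq_turan4:
  fixes f :: "nat \<Rightarrow> nat"
  assumes "\<forall>i<4. \<forall>j<4. f i \<le> f j + 1"
  shows "(\<Prod>i<4. f i) = turan4 (\<Sum>i<4. f i)"
proof -
  define q where "q = Min (f ` {..<4})"
  have "q \<in> f ` {..<4}" unfolding q_def by (intro Min_in) (auto simp: lessThan_4)
  then obtain k where k: "k < 4" "q = f k" by auto
  define b where "b i = f i - q" for i
  have fb: "f i = q + b i \<and> (b i = 0 \<or> b i = 1)" if "i < 4" for i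
  proof -
    have "q \<le> f i" unfolding q_def using that by (intro Min_le) auto
    moreover have "f i \<le> q + 1" using assms that k by auto
    ultimately show ?thesis by (auto simp: b_def)
  qed
  have f: "f 0 = q + b 0" "f 1 = q + b 1" "f 2 = q + b 2" "f 3 = q + b 3" using fb by auto
  have "b 0 = 0 \<or> b 0 = 1" "b 1 = 0 \<or> b 1 = 1" "b 2 = 0 \<or> b 2 = 1" "b 3 = 0 \<or> b 3 = 1" using fb by auto
  moreover have "(\<Sum>i<4. f i) = 4 * q + (b 0 + b 1 + b 2 + b 3)" unfolding sum_4 f by simp
  moreover have "(\<Prod>i<4. f i) = (q + b 0) * (q + b 1) * (q + b 2) * (q + b 3)" unfolding prod_4 f ..
  ultimately show ?thesis using shifted_prod_eq_turan4[of "b 0" "b 1" "b 2" "b 3" q] by simp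
qed

text \<open>Smoothing: moving one unit from a larger to a smaller factor keeps the sum, decreases
  the sum of squares and does not decrease the product. Positivity in the equality case excludes
  product 0, which unbalanced sizes also attain when the sum is below 4.\<close>

lemma prod_le_turan4:
  fixes f :: "nat \<Rightarrow> nat"
  shows "(\<Prod>i<4. f i) \<le> turan4 (\<Sum>i<4. f i)"
    and "0 < turan4 (\<Sum>i<4. f i) \<Longrightarrow> (\<Prod>i<4. f i) = turan4 (\<Sum>i<4. f i) \<Longrightarrow> \<forall>i<4. \<forall>j<4. f i \<le> f j + 1"
proof -
  have "(\<Prod>i<4. f i) \<le> turan4 (\<Sum>i<4. f i) \<and> (0 < turan4 (\<Sum>i<4. f i) \<longrightarrow>
    (\<Prod>i<4. f i) = turan4 (\<Sum>i<4. f i) \<longrightarrow> (\<forall>i<4. \<forall>j<4. f i \<le> f j + 1))"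
  proof (induction f rule: measure_induct_rule[of "\<lambda>f. \<Sum>i<4. (f i)\<^sup>2"])
    case (less f)
    show ?case
    proof (cases "\<forall>i<4. \<forall>j<4. f i \<le> f j + 1")
      case True
      then show ?thesis using balanced_prod_eq_turan4[of f] by simp
    next
      case False
      then obtain i j where ij: "i < 4" "j < 4" "f j + 2 \<le> f i" by (auto simp: not_le)
      then have ne: "i \<noteq> j" by auto
      define g where "g = f(i := f i - 1, j := f j + 1)"
      obtain d where d: "f i = f j + 2 + d" using ij(3) le_Suc_ex by metis
      have gi: "g i = f j + 1 + d" "g j = f j + 1" using ne d by (auto simp: g_def)
      have rem_sum: "(\<Sum>k<4. h k) = h i + (h j + (\<Sum>k\<in>{..<4} - {i} - {j}. h k))" for h :: "nat \<Rightarrow> nat"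
        using sum.remove[of "{..<4}" i h] sum.remove[of "{..<4} - {i}" j h] ij ne by simp
      have rem_prod: "(\<Prod>k<4. h k) = h i * (h j * (\<Prod>k\<in>{..<4} - {i} - {j}. h k))" for h :: "nat \<Rightarrow> nat"
        using prod.remove[of "{..<4}" i h] prod.remove[of "{..<4} - {i}" j h] ij ne by simp
      have sq: "(\<Sum>k\<in>{..<4} - {i} - {j}. (g k)\<^sup>2) = (\<Sum>k\<in>{..<4} - {i} - {j}. (f k)\<^sup>2)"
        by (intro sum.cong) (auto simp: g_def)
      have su: "(\<Sum>k\<in>{..<4} - {i} - {j}. g k) = (\<Sum>k\<in>{..<4} - {i} - {j}. f k)"
        by (intro sum.cong) (auto simp: g_def)
      define R where "R = (\<Prod>k\<in>{..<4} - {i} - {j}. f k)"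
      have pr: "(\<Prod>k\<in>{..<4} - {i} - {j}. g k) = R"
        unfolding R_def by (intro prod.cong) (auto simp: g_def)
      have "(\<Sum>k<4. (g k)\<^sup>2) < (\<Sum>k<4. (f k)\<^sup>2)"
        unfolding rem_sum[of "\<lambda>k. (g k)\<^sup>2"] rem_sum[of "\<lambda>k. (f k)\<^sup>2"] sq
        by (simp add: gi d power2_eq_square algebra_simps)
      then have IH: "(\<Prod>i<4. g i) \<le> turan4 (\<Sum>i<4. g i)" using less by blast
      have sum_eq: "(\<Sum>k<4. g k) = (\<Sum>k<4. f k)"
        unfolding rem_sum[of g] rem_sum[of f] su by (simp add: gi d)
      have g: "(\<Prod>k<4. g k) = (f j + 1 + d) * ((f j + 1) * R)" unfolding rem_prod[of g] pr gi ..
      have f: "(\<Prod>k<4. f k) = (f j + 2 + d) * (f j * R)" unfolding rem_prod[of f] R_def[symmetric] d ..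
      \<comment> \<open>The move adds (1 + d) R. For a maximal product this forces
        \<open>R = 0\<close>, and then the product itself vanishes.\<close>
      have gf: "(\<Prod>k<4. g k) = (\<Prod>k<4. f k) + (1 + d) * R" unfolding g f by (simp add: algebra_simps)
      show ?thesis
      proof (intro conjI impI)
        show "(\<Prod>i<4. f i) \<le> turan4 (\<Sum>i<4. f i)" using IH gf sum_eq by simp
        assume pos: "0 < turan4 (\<Sum>i<4. f i)" and eq: "(\<Prod>i<4. f i) = turan4 (\<Sum>i<4. f i)"
        then have "R = 0" using IH gf sum_eq by simp
        then have "(\<Prod>k<4. f k) = 0" using f by simp
        then show "\<forall>i<4. \<forall>j<4. f i \<le> f j + 1" using pos eq by simp
      qed
    qed
  qed
  then show "(\<Prod>i<4. f i) \<le> turan4 (\<Sum>i<4. f i)"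
    and "0 < turan4 (\<Sum>i<4. f i) \<Longrightarrow> (\<Prod>i<4. f i) = turan4 (\<Sum>i<4. f i) \<Longrightarrow> \<forall>i<4. \<forall>j<4. f i \<le> f j + 1"
    by blast+
qed

definition balanced :: "'a set \<Rightarrow> ('a \<Rightarrow> nat) \<Rightarrow> bool" where
  "balanced V c \<longleftrightarrow> (\<forall>v\<in>V. c v < 4) \<and>
     (\<forall>i<4. \<forall>j<4. card {v\<in>V. c v = i} \<le> card {v\<in>V. c v = j} + 1)"

lemma card_crossing:
  assumes "finite V"
  shows "card (crossing V c {..<4}) = (\<Prod>i<4. card {v\<in>V. c v = i})"
proof -
  have "real (card (crossing V c {..<4})) = (\<Prod>i<4. \<Sum>s\<in>{s\<in>V. c s = i}. 1)"
    using wt_crossing[OF assms, of "{..<4}" "\<lambda>_. 1" c] by simp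
  then have "real (card (crossing V c {..<4})) = real (\<Prod>i<4. card {v\<in>V. c v = i})" by simp
  then show ?thesis by (simp only: of_nat_eq_iff)
qed

lemma sum_card_classes:
  assumes "finite V" "\<And>v. v \<in> V \<Longrightarrow> c v < (4::nat)"
  shows "(\<Sum>i<4. card {v\<in>V. c v = i}) = card V"
proof -
  have "real (\<Sum>i<4. card {v\<in>V. c v = i}) = real (card V)"
    using sum_colour_classes[of V c "\<lambda>_. 1"] assms by simp
  then show ?thesis by (simp only: of_nat_eq_iff)
qed

lemma crossing_eq_rainbow:
  assumes "\<And>v. v \<in> V \<Longrightarrow> c v < (4::nat)"
  shows "crossing V c {..<4} = {e. e \<subseteq> V \<and> card e = 4 \<and> inj_on c e}"
proof (intro set_eqI iffI)
  fix e assume "e \<in> crossing V c {..<4}"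
  then have e: "e \<subseteq> V" "inj_on c e" "c ` e = {..<4}" by (auto simp: crossing_def)
  then have "card e = 4" using card_image[OF e(2)] by simp
  then show "e \<in> {e. e \<subseteq> V \<and> card e = 4 \<and> inj_on c e}" using e by simp
next
  fix e assume "e \<in> {e. e \<subseteq> V \<and> card e = 4 \<and> inj_on c e}"
  then show "e \<in> crossing V c {..<4}" using assms by (intro rainbow_eq_crossing) auto
qed

lemma rainbow_le_turan4:
  fixes V :: "'a set"
  assumes fin: "finite V" and E: "\<And>e. e \<in> E \<Longrightarrow> e \<subseteq> V \<and> card e = 4"
    and c: "\<And>v. c v < (4::nat)" "\<And>e. e \<in> E \<Longrightarrow> inj_on c e"
  shows "card E \<le> turan4 (card V)"
    and "card E = turan4 (card V) \<Longrightarrow> 4 \<le> card V \<Longrightarrow>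
      E = {e. e \<subseteq> V \<and> card e = 4 \<and> inj_on c e} \<and> balanced V c"
proof -
  have sub: "E \<subseteq> crossing V c {..<4}" using E c by (auto simp: crossing_eq_rainbow)
  have finC: "finite (crossing V c {..<4})" by (rule finite_crossing[OF fin])
  have le1: "card E \<le> card (crossing V c {..<4})" by (rule card_mono[OF finC sub])
  have sumV: "(\<Sum>i<4. card {v\<in>V. c v = i}) = card V" by (intro sum_card_classes fin c)
  note le2 = prod_le_turan4[of "\<lambda>i. card {v\<in>V. c v = i}", unfolded sumV card_crossing[OF fin, symmetric]]
  show "card E \<le> turan4 (card V)" using le1 le2(1) by linarith
  assume eq: "card E = turan4 (card V)" "4 \<le> card V"
  then have eqs: "card E = card (crossing V c {..<4})" "card (crossing V c {..<4}) = turan4 (card V)"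
    using le1 le2(1) by linarith+
  have "E = crossing V c {..<4}" by (rule card_subset_eq[OF finC sub eqs(1)])
  then have "E = {e. e \<subseteq> V \<and> card e = 4 \<and> inj_on c e}"
    using crossing_eq_rainbow[of V c, OF c(1)] by (rule trans)
  moreover have "balanced V c" using le2(2)[OF turan4_pos[OF eq(2)] eqs(2)] c by (simp add: balanced_def)
  ultimately show "E = {e. e \<subseteq> V \<and> card e = 4 \<and> inj_on c e} \<and> balanced V c" ..
qed

section \<open>Deleting vertices of small degree\<close>

lemma card_delete_vertex:
  assumes "finite E"
  shows "card E = card {e \<in> E. v \<notin> e} + card (lnk E v)"
proof -
  have "card {e \<in> E. v \<in> e} = card (lnk E v)"
    by (rule bij_betw_same_card[of "\<lambda>e. e - {v}"], rule bij_betw_byWitness[where f' = "insert v"])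
      (auto simp: lnk_def insert_absorb)
  moreover have "card E = card {e \<in> E. v \<in> e} + card {e \<in> E. v \<notin> e}"
    using assms by (subst card_Un_disjoint[symmetric]) (auto intro: arg_cong[of _ _ card])
  ultimately show ?thesis by simp
qed

text \<open>The number of vertices from which \<open>tri_free_min_degree\<close> applies.\<close>

definition M0 :: nat where "M0 = 10000000000"

text \<open>\<open>turan4\<close> grows by about n^3/64 = 0.015625 n^3 per vertex, more than the
  degree 0.0155 n^3. The spare 1 drives the excess argument below and excludes low degrees in the
  extremal case.\<close>

lemma low_degree_step:
  fixes d :: real
  assumes "M0 \<le> n" "d < 155 / 10000 * real (Suc n) ^ 3"
  shows "real (turan4 n) + d + 1 \<le> real (turan4 (Suc n))"
proof -
  define N where "N = real n"
  have N: "10000000000 \<le> N" using assms(1) by (simp add: N_def M0_def)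
  have "(998 / 1000 * (N + 1)) ^ 3 \<le> (N - 3) ^ 3" using N by (intro power_mono) auto
  then have "(998 / 1000) ^ 3 * (N + 1) ^ 3 \<le> (N - 3) ^ 3" by (simp only: power_mult_distrib)
  moreover have "994 / 1000 * (N + 1) ^ 3 \<le> (998 / 1000) ^ 3 * (N + 1) ^ 3"
    using N by (intro mult_right_mono) (auto simp: power3_eq_cube)
  ultimately have a: "994 / 1000 * (N + 1) ^ 3 \<le> (N - 3) ^ 3" by linarith
  have b: "((N - 3) / 4) ^ 3 = (N - 3) ^ 3 / 64" by (simp add: power_divide)
  have "100000 ^ 3 \<le> (N + 1) ^ 3" using N by (intro power_mono) auto
  then have "155 / 10000 * (N + 1) ^ 3 + 1 \<le> ((N - 3) / 4) ^ 3" using a b by simp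
  moreover have "3 \<le> n" using assms(1) by (simp add: M0_def)
  ultimately show ?thesis using turan4_Suc_ge[of n] assms(2) by (simp add: N_def add.commute)
qed

lemma turan4_dense:
  assumes "M0 \<le> n"
  shows "real n ^ 4 / 256 - real n ^ 4 / 1000000000 \<le> real (turan4 n)"
proof -
  define N where "N = real n"
  have N: "10000000000 \<le> N" using assms(1) by (simp add: N_def M0_def)
  define r where "r = (1 - 3 / 10000000000 :: real)"
  have "(r * N) ^ 4 \<le> (N - 3) ^ 4" using N by (intro power_mono) (auto simp: r_def)
  then have "r ^ 4 * N ^ 4 \<le> (N - 3) ^ 4" by (simp only: power_mult_distrib)
  moreover have "1 - 2 / 1000000000 \<le> r ^ 4" by (simp add: r_def power4_eq_xxxx)
  then have "(1 - 2 / 1000000000) * N ^ 4 \<le> r ^ 4 * N ^ 4" by (rule mult_right_mono) simp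
  moreover have "((N - 3) / 4) ^ 4 = (N - 3) ^ 4 / 256" by (simp add: power_divide)
  moreover have "((N - 3) / 4) ^ 4 \<le> real (turan4 n)"
    using turan4_lower[of n] assms by (simp add: N_def M0_def)
  moreover have "0 \<le> N ^ 4" by simp
  moreover have "0 \<le> N ^ 4" by simp
  ultimately have "(1 - 2 / 1000000000) * N ^ 4 \<le> 256 * real (turan4 n)" "0 \<le> N ^ 4" by linarith+
  then show ?thesis unfolding N_def[symmetric] by (simp add: left_diff_distrib)
qed

lemma tri_free_delete: "tri_free E \<Longrightarrow> tri_free {e \<in> E. v \<notin> e}"
  using tri_mono[of "{e \<in> E. v \<notin> e}" _ E] by (auto simp: tri_free_def)

text \<open>Deleting a vertex of small degree raises the excess over \<open>turan4\<close> by at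
  least 1. At \<open>M0\<close> vertices the excess is at most \<open>M0 ^ 4\<close>, so at
  \<open>M0 + k\<close> it is at most \<open>M0 ^ 4 - k\<close>, unless the deletions stop earlier
  at large minimum degree, where the 4-graph is 4-partite and has no excess. For k >= M0^4 both
  alternatives give the Turan bound.\<close>

lemma tri_free_le_turan4_or_excess:
  fixes V :: "'a set"
  assumes "finite V" "\<And>e. e \<in> E \<Longrightarrow> e \<subseteq> V \<and> card e = 4" "tri_free E" "card V = M0 + k"
  shows "card E \<le> turan4 (M0 + k) \<or> card E + k \<le> turan4 (M0 + k) + M0 ^ 4"
  using assms
proof (induction k arbitrary: V E)
  case 0
  have "wt (\<lambda>_. 1) E \<le> (\<Sum>v\<in>V. 1) ^ 4" using 0 by (intro wt_card_le) auto
  then have "real (card E) \<le> real (card V ^ 4)" by simp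
  then have "card E \<le> card V ^ 4" by (simp only: of_nat_le_iff)
  then show ?case using 0(4) by simp
next
  case (Suc k)
  note fin = Suc.prems(1) and E = Suc.prems(2) and free = Suc.prems(3) and n = Suc.prems(4)
  have finE: "finite E" using E fin by (intro finite_subset[of E "Pow V"]) auto
  show ?case
  proof (cases "\<exists>v\<in>V. real (card (lnk E v)) < 155 / 10000 * real (card V) ^ 3")
    case True
    then obtain v where v: "v \<in> V" "real (card (lnk E v)) < 155 / 10000 * real (card V) ^ 3" by auto
    define E' where "E' = {e \<in> E. v \<notin> e}"
    have "real (turan4 (M0 + k)) + real (card (lnk E v)) + 1 \<le> real (turan4 (Suc (M0 + k)))"
      using v(2) n by (intro low_degree_step) auto
    then have "real (turan4 (M0 + k) + card (lnk E v) + 1) \<le> real (turan4 (M0 + Suc k))" by simp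
    then have step: "turan4 (M0 + k) + card (lnk E v) + 1 \<le> turan4 (M0 + Suc k)"
      by (simp only: of_nat_le_iff)
    have "card E' \<le> turan4 (M0 + k) \<or> card E' + k \<le> turan4 (M0 + k) + M0 ^ 4"
    proof (rule Suc.IH[of "V - {v}"])
      show "tri_free E'" unfolding E'_def by (rule tri_free_delete[OF free])
      show "card (V - {v}) = M0 + k" using n v(1) fin by simp
    qed (use E fin in \<open>auto simp: E'_def\<close>)
    then show ?thesis using card_delete_vertex[OF finE, of v] step unfolding E'_def by linarith
  next
    case False
    show ?thesis
    proof (cases "card E \<le> turan4 (M0 + Suc k)")
      case dense: False
      have nM: "M0 \<le> card V" using n by simp
      have "real (turan4 (card V)) \<le> real (card E)" using dense n by simp
      then have d: "real (card V) ^ 4 / 256 - real (card V) ^ 4 / 500000000 \<le> real (card E)"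
        using turan4_dense[OF nM] zero_le_power[of "real (card V)" 4] by linarith
      obtain c :: "'a \<Rightarrow> nat" where "\<And>v. c v < 4" "\<And>e. e \<in> E \<Longrightarrow> inj_on c e"
        using tri_free_min_degree[OF fin E free _ d] nM False unfolding M0_def by (metis not_less)
      then have "card E \<le> turan4 (card V)" using E by (intro rainbow_le_turan4[OF fin]) auto
      then show ?thesis using n by simp
    qed simp
  qed
qed

lemma tri_free_le_turan4:
  fixes V :: "'a set"
  assumes "finite V" "\<And>e. e \<in> E \<Longrightarrow> e \<subseteq> V \<and> card e = 4" "tri_free E" "M0 + M0 ^ 4 \<le> card V"
  shows "card E \<le> turan4 (card V)"
proof -
  obtain k where k: "card V = M0 + k" "M0 ^ 4 \<le> k" using assms(4) le_Suc_ex[of M0 "card V"] by auto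
  then show ?thesis using tri_free_le_turan4_or_excess[OF assms(1-3) k(1)] by auto
qed

text \<open>Deleting a vertex of small degree would leave more than \<open>turan4\<close> edges on
  one vertex fewer. So all degrees are large, the 4-graph is 4-partite, and equality forces all
  transversals and balanced classes.\<close>

lemma tri_free_extremal:
  fixes V :: "'a set"
  assumes fin: "finite V" and E: "\<And>e. e \<in> E \<Longrightarrow> e \<subseteq> V \<and> card e = 4" and free: "tri_free E"
    and n: "M0 + M0 ^ 4 < card V" and eq: "card E = turan4 (card V)"
  obtains c where "E = {e. e \<subseteq> V \<and> card e = 4 \<and> inj_on c e}" "balanced V c"
proof -
  have finE: "finite E" using E fin by (intro finite_subset[of E "Pow V"]) auto
  obtain k where k: "card V = Suc k" "M0 + M0 ^ 4 \<le> k" using n by (cases "card V") auto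
  have nM: "M0 \<le> card V" using n by simp
  have deg: "155 / 10000 * real (card V) ^ 3 \<le> real (card (lnk E v))" if v: "v \<in> V" for v
  proof (rule ccontr)
    assume low: "\<not> ?thesis"
    define E' where "E' = {e \<in> E. v \<notin> e}"
    have "real (turan4 k) + real (card (lnk E v)) + 1 \<le> real (turan4 (Suc k))"
      using low k by (intro low_degree_step) auto
    then have "real (turan4 k + card (lnk E v) + 1) \<le> real (card E)" using eq k by simp
    then have "turan4 k + card (lnk E v) + 1 \<le> card E" by (simp only: of_nat_le_iff)
    moreover have "card E' \<le> turan4 (card (V - {v}))"
    proof (rule tri_free_le_turan4)
      show "tri_free E'" unfolding E'_def by (rule tri_free_delete[OF free])
    qed (use E fin v k in \<open>auto simp: E'_def\<close>)
    moreover have "card (V - {v}) = k" using k v fin by simp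
    ultimately show False using card_delete_vertex[OF finE, of v] unfolding E'_def by simp
  qed
  have d: "real (card V) ^ 4 / 256 - real (card V) ^ 4 / 500000000 \<le> real (card E)"
    using turan4_dense[OF nM] zero_le_power[of "real (card V)" 4] unfolding eq by linarith
  obtain c :: "'a \<Rightarrow> nat" where c: "\<And>v. c v < 4" "\<And>e. e \<in> E \<Longrightarrow> inj_on c e"
    using tri_free_min_degree[OF fin E free _ d deg] nM unfolding M0_def by metis
  have "4 \<le> card V" using nM by (simp add: M0_def)
  then have "E = {e. e \<subseteq> V \<and> card e = 4 \<and> inj_on c e} \<and> balanced V c"
    using rainbow_le_turan4(2)[OF fin E, where c = c] c eq by blast
  then show ?thesis using that by blast
qed

section \<open>Vertices of large degree\<close>

text \<open>Only vertex sets are recorded, since disjointness concerns nothing else. They have 7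
  elements, so disjoint ones are distinct and \<open>card P\<close> counts copies.\<close>

definition packs :: "nat \<Rightarrow> 'a set set \<Rightarrow> bool" where
  "packs k E \<longleftrightarrow> (\<exists>P. finite P \<and> card P = k \<and> (\<forall>S\<in>P. tri E S) \<and> pairwise disjnt P)"

lemma tri_card: "tri E S \<Longrightarrow> card S = 7" "tri E S \<Longrightarrow> finite S" "tri E S \<Longrightarrow> S \<noteq> {}"
proof -
  show "tri E S \<Longrightarrow> card S = 7" by (auto simp: tri_def)
  then show "tri E S \<Longrightarrow> finite S" "tri E S \<Longrightarrow> S \<noteq> {}" by (auto intro: card_ge_0_finite)
qed

lemma tri_avoid:
  assumes "tri {e \<in> E. e \<inter> U = {}} S"
  shows "S \<inter> U = {}"
  using assms by (auto simp: tri_def)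

lemma tri_subset:
  assumes "tri E S" "\<And>e. e \<in> E \<Longrightarrow> e \<subseteq> V"
  shows "S \<subseteq> V"
proof -
  obtain T x y z w where "S = T \<union> {x, y, z, w}" "insert x T \<in> E" "{x, y, z, w} \<in> E"
    using assms(1) by (auto simp: tri_def)
  then show ?thesis using assms(2) by blast
qed

lemma packs_0: "packs 0 E"
  by (auto simp: packs_def intro: exI[of _ "{}"])

lemma packing_insert:
  assumes "finite P" "\<forall>S\<in>P. tri E S" "pairwise disjnt P" "tri E S" "S \<inter> \<Union>P = {}"
  shows "finite (insert S P)" "\<forall>S\<in>insert S P. tri E S" "pairwise disjnt (insert S P)"
    "card (insert S P) = Suc (card P)"
proof -
  have "S \<notin> P" using assms(5) tri_card(3)[OF assms(4)] by blast
  then show "card (insert S P) = Suc (card P)" using assms(1) by simp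
  show "pairwise disjnt (insert S P)"
    using assms(3,5) by (auto simp: pairwise_insert disjnt_def)
qed (use assms in auto)

lemma card_Union_packing:
  assumes "finite P" "\<forall>S\<in>P. tri E S"
  shows "card (\<Union>P) \<le> 7 * card P" "finite (\<Union>P)"
proof -
  have "card (\<Union>P) \<le> (\<Sum>S\<in>P. card S)" by (rule card_Union_le_sum_card)
  also have "\<dots> = (\<Sum>S\<in>P. 7)" using assms(2) tri_card(1) by (intro sum.cong) auto
  finally show "card (\<Union>P) \<le> 7 * card P" by simp
  show "finite (\<Union>P)" using assms tri_card(2) by auto
qed

text \<open>\<open>U\<close> is the vertex set of a packing of at most \<open>k\<close> copies whose
  size is the largest possible; a copy avoiding \<open>U\<close> would enlarge it.\<close>

lemma maximal_packing:
  assumes np: "\<not> packs (Suc k) E" and E: "\<And>e. e \<in> E \<Longrightarrow> e \<subseteq> V"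
  obtains U where "U \<subseteq> V" "finite U" "card U \<le> 7 * k" "tri_free {e \<in> E. e \<inter> U = {}}"
proof -
  have "\<exists>m\<le>k. packs m E \<and> \<not> packs (Suc m) E"
    using np
  proof (induction k)
    case 0
    then show ?case using packs_0 by auto
  next
    case (Suc k)
    then show ?case by (cases "packs (Suc k) E") (auto intro: le_SucI)
  qed
  then obtain m where m: "m \<le> k" "packs m E" "\<not> packs (Suc m) E" by auto
  then obtain P where P: "finite P" "card P = m" "\<forall>S\<in>P. tri E S" "pairwise disjnt P"
    by (auto simp: packs_def)
  have "tri_free {e \<in> E. e \<inter> \<Union>P = {}}"
    unfolding tri_free_def
  proof (intro allI notI)
    fix S assume S: "tri {e \<in> E. e \<inter> \<Union>P = {}} S"
    have "tri E S" by (rule tri_mono[OF S]) auto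
    then have "packs (Suc m) E"
      using packing_insert[OF P(1,3,4) _ tri_avoid[OF S]] P(2) unfolding packs_def by metis
    then show False using m by simp
  qed
  moreover have "\<Union>P \<subseteq> V" using P(3) tri_subset[OF _ E] by blast
  moreover have "card (\<Union>P) \<le> 7 * k" using card_Union_packing[OF P(1,3)] P(2) m(1) by simp
  ultimately show ?thesis using that card_Union_packing(2)[OF P(1,3)] by blast
qed

lemma card_hit_le:
  assumes "finite V" "Y \<subseteq> V" "F \<subseteq> {T. T \<subseteq> V \<and> card T = Suc k \<and> T \<inter> Y \<noteq> {}}"
  shows "real (card F) \<le> real (card Y) * real (card V) ^ k"
  using wt_hit_le[OF assms, of "\<lambda>_. 1"] by simp

text \<open>Collects the conclusions of \<open>rainbow_structure\<close> on all but a few vertices: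
  the links in \<open>F\<close> fill at least 0.015 of the at most 0.0178 n^3 transversal triples
  avoiding the own class.\<close>

definition near_partite ::
    "'a set \<Rightarrow> 'a set set \<Rightarrow> 'a set \<Rightarrow> ('a \<Rightarrow> nat) \<Rightarrow> 'a set set \<Rightarrow> bool" where
  "near_partite V E W c F \<longleftrightarrow> W \<subseteq> V \<and> F \<subseteq> E \<and> real (card (V - W)) \<le> real (card V) / 3000 \<and>
    (\<forall>s. c s < 4) \<and>
    (\<forall>s\<in>W. lnk F s \<subseteq> crossing W c ({..<4} - {c s}) \<and>
      15 / 1000 * real (card V) ^ 3 \<le> real (card (lnk F s))) \<and>
    (\<forall>j<4. real (card (crossing W c ({..<4} - {j}))) \<le> 178 / 10000 * real (card V) ^ 3)"

text \<open>Deleting a maximal packing costs at most 7t n^3 <= 7 * 10^-10 n^4 edges, and comparing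
  with n - t instead of n vertices about 2 * 10^-12 n^4 more. With the 10^-9 from
  \<open>turan4_dense\<close> the density stays within 2 * 10^-9 of 1/256, as stability
  requires.\<close>

lemma near_partiteI:
  fixes V :: "'a set"
  assumes fin: "finite V" and E: "\<And>e. e \<in> E \<Longrightarrow> e \<subseteq> V \<and> card e = 4"
    and np: "\<not> packs (Suc t) E" and n: "2 * M0 \<le> card V" and t: "real t \<le> real (card V) / 10000000000"
    and dense: "turan4 (card V - t) \<le> card E"
  obtains W c F where "near_partite V E W c F"
proof -
  define n where "n = real (card V)"
  have n0: "20000000000 \<le> n" using n by (simp add: n_def M0_def)
  obtain U where U: "U \<subseteq> V" "finite U" "card U \<le> 7 * t" "tri_free {e \<in> E. e \<inter> U = {}}"
    using maximal_packing[OF np, of V] E by blast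
  define V1 where "V1 = V - U"
  define E1 where "E1 = {e \<in> E. e \<inter> U = {}}"
  define n1 where "n1 = real (card V1)"
  have finV1: "finite V1" using fin by (simp add: V1_def)
  have E1: "e \<subseteq> V1 \<and> card e = 4" if "e \<in> E1" for e using that E[of e] by (auto simp: E1_def V1_def)
  have cU: "real (card U) \<le> 7 / 10000000000 * n" using U(3) t by (simp add: n_def)
  have "card V1 = card V - card U" unfolding V1_def using U by (intro card_Diff_subset) auto
  moreover have "card U \<le> card V" using U(1) fin by (rule card_mono[rotated])
  ultimately have n1: "n1 = n - real (card U)" by (simp add: n1_def n_def)
  have n1le: "n1 \<le> n" "(1 - 7 / 10000000000) * n \<le> n1" using n1 cU by auto
  have n4: "0 \<le> n ^ 4" by simp
  have "real (card E) \<le> real (card E1) + real (card {e \<in> E. e \<inter> U \<noteq> {}})"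
  proof -
    have "E = E1 \<union> {e \<in> E. e \<inter> U \<noteq> {}}" by (auto simp: E1_def)
    then have "card E \<le> card E1 + card {e \<in> E. e \<inter> U \<noteq> {}}" by (metis card_Un_le)
    then show ?thesis by simp
  qed
  moreover have "real (card {e \<in> E. e \<inter> U \<noteq> {}}) \<le> real (card U) * n ^ 3"
    unfolding n_def using E by (intro card_hit_le[OF fin U(1)]) auto
  moreover have "real (card U) * n ^ 3 \<le> 7 / 10000000000 * n * n ^ 3"
    using cU n0 by (intro mult_right_mono) auto
  moreover have "7 / 10000000000 * n * n ^ 3 = 7 / 10000000000 * n ^ 4"
    by (simp add: power4_eq_xxxx power3_eq_cube)
  ultimately have lose: "real (card E) - 7 / 10000000000 * n ^ 4 \<le> real (card E1)" by linarith
  have tn: "real (card V - t) = n - real t" using t by (simp add: n_def of_nat_diff)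
  have "M0 \<le> card V - t"
  proof -
    have "real M0 \<le> n - real t" using t n0 n by (simp add: n_def)
    then show ?thesis using tn by simp
  qed
  then have dE: "(n - real t) ^ 4 / 256 - (n - real t) ^ 4 / 1000000000 \<le> real (card E)"
    using turan4_dense[of "card V - t"] dense unfolding tn by linarith
  have "((1 - 1 / 10000000000) * n) ^ 4 \<le> (n - real t) ^ 4"
    using t n0 by (intro power_mono) (auto simp: n_def)
  then have "(1 - 1 / 10000000000) ^ 4 * n ^ 4 \<le> (n - real t) ^ 4" by (simp only: power_mult_distrib)
  moreover have "(1 - 5 / 10000000000 :: real) \<le> (1 - 1 / 10000000000) ^ 4" by (simp add: power4_eq_xxxx)
  then have "(1 - 5 / 10000000000) * n ^ 4 \<le> (1 - 1 / 10000000000) ^ 4 * n ^ 4"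
    using n4 by (rule mult_right_mono)
  ultimately have "(1 - 5 / 10000000000) * n ^ 4 \<le> (n - real t) ^ 4" by (rule order_trans[rotated])
  moreover define p where "p = (n - real t) ^ 4"
  moreover define q where "q = n ^ 4"
  ultimately have "(1 / 256 - 2 / 1000000000) * q \<le> real (card E1)"
    using dE lose n4 by simp
  then have "(1 / 256 - 2 / 1000000000) * n ^ 4 \<le> real (card E1)" by (simp only: q_def)
  moreover have "(1 / 256 - 2 / 1000000000) * n1 ^ 4 \<le> (1 / 256 - 2 / 1000000000) * n ^ 4"
    using n1le n0 by (intro mult_left_mono power_mono) auto
  ultimately have d1: "n1 ^ 4 / 256 - n1 ^ 4 / 500000000 \<le> real (card E1)"
    by (simp add: left_diff_distrib)
  have n1big: "10000000000 \<le> card V1"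
  proof -
    have "real 10000000000 \<le> n1" using n1le n0 by simp
    then show ?thesis unfolding n1_def by (simp only: of_nat_le_iff)
  qed
  obtain F Z and c :: "'a \<Rightarrow> nat" where F: "F \<subseteq> E1" "Z \<subseteq> V1" "real (card Z) \<le> n1 / 4000"
    "\<And>v. c v < 4" "\<And>e. e \<in> F \<Longrightarrow> e \<subseteq> V1 - Z \<Longrightarrow> inj_on c e"
    "\<And>v. v \<in> V1 - Z \<Longrightarrow> 1555 / 100000 * n1 ^ 3 \<le> real (card (lnk F v))"
    using tri_free_stability[OF finV1 E1 U(4)[folded E1_def] n1big d1[unfolded n1_def]]
    unfolding n1_def by metis
  define W where "W = V1 - Z"
  define F' where "F' = {e \<in> F. e \<subseteq> W}"
  have finW: "finite W" using finV1 by (simp add: W_def)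
  have finZ: "finite Z" using finV1 F(2) by (rule rev_finite_subset)
  have VW: "V - W \<subseteq> U \<union> Z" by (auto simp: W_def V1_def)
  have "card (V - W) \<le> card (U \<union> Z)" using VW U(2) finZ by (intro card_mono) auto
  also have "\<dots> \<le> card U + card Z" by (rule card_Un_le)
  finally have "real (card (V - W)) \<le> real (card U) + real (card Z)" by simp
  then have cVW: "real (card (V - W)) \<le> n / 3000" using cU F(3) n1le n0 by linarith
  have WV: "W \<subseteq> V" by (auto simp: W_def V1_def)
  have Wne: "W \<noteq> {}"
  proof
    assume "W = {}"
    then have "n \<le> n / 3000" using cVW by (simp add: n_def)
    then show False using n0 by simp
  qed
  have n13: "99 / 100 * n ^ 3 \<le> n1 ^ 3"
  proof -
    have "(999 / 1000 * n) ^ 3 \<le> n1 ^ 3" using n1le n0 by (intro power_mono) auto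
    then have "(999 / 1000) ^ 3 * n ^ 3 \<le> n1 ^ 3" by (simp only: power_mult_distrib)
    moreover have "99 / 100 * n ^ 3 \<le> (999 / 1000) ^ 3 * n ^ 3"
      using n0 by (intro mult_right_mono) (auto simp: power3_eq_cube)
    ultimately show ?thesis by linarith
  qed
  have deg: "15 / 1000 * n ^ 3 \<le> real (card (lnk F' s))" if s: "s \<in> W" for s
  proof -
    have lF: "lnk F s \<subseteq> {T. T \<subseteq> V1 \<and> card T = 3}"
      using lnk_uniform[of F V1 3 s] F(1) E1 finV1 by auto
    have "lnk F s = lnk F' s \<union> {T \<in> lnk F s. T \<inter> Z \<noteq> {}}"
      using lF s by (auto simp: F'_def lnk_def W_def)
    then have "card (lnk F s) \<le> card (lnk F' s) + card {T \<in> lnk F s. T \<inter> Z \<noteq> {}}"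
      by (metis card_Un_le)
    moreover have "real (card {T \<in> lnk F s. T \<inter> Z \<noteq> {}}) \<le> real (card Z) * n1\<^sup>2"
      unfolding n1_def using lF by (intro card_hit_le[OF finV1 F(2)]) auto
    moreover have "real (card Z) * n1\<^sup>2 \<le> n1 / 4000 * n1\<^sup>2" using F(3) by (rule mult_right_mono) simp
    moreover have "n1 / 4000 * n1\<^sup>2 = n1 ^ 3 / 4000" by (simp add: power3_eq_cube power2_eq_square)
    moreover have "1555 / 100000 * n1 ^ 3 \<le> real (card (lnk F s))" using F(6) s by (simp add: W_def)
    moreover have "0 \<le> n ^ 3" using n0 by simp
    ultimately show ?thesis using n13 by linarith
  qed
  have F'W: "e \<subseteq> W \<and> card e = 4 \<and> inj_on c e" if "e \<in> F'" for e
    using that F(1,5) E1 by (auto simp: F'_def W_def)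
  have xW: "(\<Sum>s\<in>W. 1) \<le> n" using card_mono[OF fin WV] by (simp add: n_def)
  have deg': "15 / 1000 * n ^ 3 \<le> wt (\<lambda>_. 1) (lnk F' s)" if "s \<in> W" for s using deg[OF that] by simp
  have "lnk F' s \<subseteq> crossing W c ({..<4} - {c s})" if "s \<in> W" for s
    by (rule rainbow_structure(1)[OF finW Wne _ _ F(4) F'W xW deg' that]) auto
  moreover have "real (card (crossing W c ({..<4} - {j}))) \<le> 178 / 10000 * n ^ 3" if "j < 4" for j
    using rainbow_structure(2)[OF finW Wne _ _ F(4) F'W xW deg' that] by simp
  moreover have "F' \<subseteq> E" using F(1) by (auto simp: F'_def E1_def)
  ultimately have "near_partite V E W c F'"
    unfolding near_partite_def n_def[symmetric] using WV cVW F(4) deg by blast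
  then show ?thesis by (rule that)
qed

lemma exists_avoiding:
  assumes fin: "finite V" and XV: "Y \<subseteq> V" and A: "A \<subseteq> {T. T \<subseteq> V \<and> card T = 3}"
    and card: "real (card Y) * real (card V) ^ 2 < real (card A)"
  obtains T where "T \<in> A" "T \<inter> Y = {}"
proof -
  have "{T \<in> A. T \<inter> Y \<noteq> {}} \<noteq> A"
  proof
    assume "{T \<in> A. T \<inter> Y \<noteq> {}} = A"
    then have "A \<subseteq> {T. T \<subseteq> V \<and> card T = Suc 2 \<and> T \<inter> Y \<noteq> {}}" using A by auto
    then have "real (card A) \<le> real (card Y) * real (card V) ^ 2" by (rule card_hit_le[OF fin XV])
    then show False using card by simp
  qed
  then show ?thesis using that by blast
qed

text \<open>It suffices to find an edge through \<open>v\<close> avoiding \<open>X\<close> with two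
  vertices sharing 0.004 n^3 link triples: at most 0.003 n^3 of these meet \<open>X\<close> or the
  edge, so one completes a copy. If a link triple of \<open>v\<close> has two vertices of one class,
  take these. Otherwise all link triples in \<open>W - X\<close> are transversal, and
  \<open>v\<close> itself is paired with a vertex of a suitable class.\<close>

lemma big_vertex_tri:
  fixes V :: "'a set"
  assumes fin: "finite V" and E: "\<And>e. e \<in> E \<Longrightarrow> e \<subseteq> V \<and> card e = 4"
    and np: "near_partite V E W c F" and n: "2 * M0 \<le> card V"
    and v: "v \<in> V" "30 / 1000 * real (card V) ^ 3 \<le> real (card (lnk E v))"
    and X: "X \<subseteq> V" "v \<notin> X" "real (card X) \<le> real (card V) / 2000"
  shows "\<exists>S. tri E S \<and> v \<in> S \<and> S \<inter> X = {}"
proof -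
  define n where "n = real (card V)"
  have n0: "20000000000 \<le> n" using n by (simp add: n_def M0_def)
  have n3: "0 < n ^ 3" using n0 by simp
  define cr where "cr j = crossing W c ({..<4} - {j})" for j
  have WV: "W \<subseteq> V" and FE: "F \<subseteq> E" and VW: "real (card (V - W)) \<le> n / 3000" and c4: "\<And>s. c s < 4"
    and lF: "\<And>s. s \<in> W \<Longrightarrow> lnk F s \<subseteq> cr (c s)"
    and deg: "\<And>s. s \<in> W \<Longrightarrow> 15 / 1000 * n ^ 3 \<le> real (card (lnk F s))"
    and crle: "\<And>j. j < 4 \<Longrightarrow> real (card (cr j)) \<le> 178 / 10000 * n ^ 3"
    using np unfolding near_partite_def n_def cr_def by blast+
  have finW: "finite W" using fin WV by (rule rev_finite_subset)
  have fincr: "finite (cr j)" for j unfolding cr_def by (rule finite_crossing[OF finW])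
  have lE: "lnk E s \<subseteq> {T. T \<subseteq> V \<and> card T = 3}" for s
    using lnk_uniform[of E V 3 s] E fin by auto
  have lFE: "lnk F s \<subseteq> lnk E s" for s by (rule lnk_mono[OF FE])
  have inter: "real (card A) + real (card B) - real (card (cr j)) \<le> real (card (A \<inter> B))"
    if "A \<subseteq> cr j" "B \<subseteq> cr j" for A B j
    using wt_inter_ge[OF that fincr, of "\<lambda>_. 1"] by simp
  have finish: "\<exists>S. tri E S \<and> v \<in> S \<and> S \<inter> X = {}"
    if A: "A \<subseteq> lnk E u" "A \<subseteq> lnk E u'" "4 / 1000 * n ^ 3 \<le> real (card A)"
      and e: "e \<in> E" "v \<in> e" "e \<inter> X = {}" "u \<in> e" "u' \<in> e" "u \<noteq> u'" for A u u' e
  proof -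
    have e4: "e \<subseteq> V" "card e = 4" using E e(1) by auto
    have "real (card (X \<union> e)) \<le> real (card X) + 4" using card_Un_le[of X e] e4 by simp
    then have "real (card (X \<union> e)) \<le> n / 2000 + 4" using X(3) by (simp add: n_def)
    then have "real (card (X \<union> e)) * n\<^sup>2 \<le> (n / 2000 + 4) * n\<^sup>2" by (rule mult_right_mono) simp
    also have "\<dots> < (3 / 1000 * n) * n\<^sup>2" using n0 by (intro mult_strict_right_mono) auto
    also have "\<dots> = 3 / 1000 * n ^ 3" by (simp add: power3_eq_cube power2_eq_square)
    finally have less: "real (card (X \<union> e)) * real (card V) ^ 2 < real (card A)"
      using A(3) n3 unfolding n_def[symmetric] by linarith
    have AV: "A \<subseteq> {T. T \<subseteq> V \<and> card T = 3}" using A(1) lE by (rule order_trans)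
    obtain T where T: "T \<in> A" "T \<inter> (X \<union> e) = {}"
      using exists_avoiding[OF fin Un_least[OF X(1) e4(1)] AV less] .
    then have "card T = 3" using AV by blast
    then have "tri E (T \<union> e)" using T A e e4 by (intro triI[of T E u u' e]) auto
    then show ?thesis using e T by (intro exI[of _ "T \<union> e"]) auto
  qed
  define L where "L = {T \<in> lnk E v. T \<subseteq> W - X}"
  have "29 / 1000 * n ^ 3 \<le> real (card L)"
  proof -
    have "lnk E v = L \<union> {T \<in> lnk E v. T \<inter> ((V - W) \<union> X) \<noteq> {}}"
      using lE[of v] by (auto simp: L_def)
    then have "card (lnk E v) \<le> card L + card {T \<in> lnk E v. T \<inter> ((V - W) \<union> X) \<noteq> {}}"
      by (metis card_Un_le)
    moreover have "real (card {T \<in> lnk E v. T \<inter> ((V - W) \<union> X) \<noteq> {}}) \<le> real (card ((V - W) \<union> X)) * n\<^sup>2"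
      unfolding n_def using lE[of v] X(1) by (intro card_hit_le[OF fin]) auto
    moreover have "real (card ((V - W) \<union> X)) \<le> n / 1000"
      using card_Un_le[of "V - W" X] VW X(3) n0 by (simp add: n_def)
    then have "real (card ((V - W) \<union> X)) * n\<^sup>2 \<le> n / 1000 * n\<^sup>2" by (rule mult_right_mono) simp
    moreover have "n / 1000 * n\<^sup>2 = n ^ 3 / 1000" by (simp add: power3_eq_cube power2_eq_square)
    ultimately show ?thesis using v(2) unfolding n_def[symmetric] by linarith
  qed
  note Lbig = this
  have L3: "card T = 3 \<and> T \<subseteq> W \<and> T \<inter> X = {} \<and> insert v T \<in> E \<and> v \<notin> T" if "T \<in> L" for T
    using that lE[of v] by (auto simp: L_def lnk_def)
  show ?thesis
  proof (cases "\<forall>T\<in>L. inj_on c T")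
    case False
    then obtain T u u' where T: "T \<in> L" "u \<in> T" "u' \<in> T" "c u = c u'" "u \<noteq> u'"
      by (auto simp: inj_on_def)
    then have W: "u \<in> W" "u' \<in> W" using L3 by blast+
    have "lnk F u' \<subseteq> cr (c u)" using lF[OF W(2)] T(4) by simp
    then have "4 / 1000 * n ^ 3 \<le> real (card (lnk F u \<inter> lnk F u'))"
      using inter[OF lF[OF W(1)], of "lnk F u'"] deg[OF W(1)] deg[OF W(2)] crle[OF c4[of u]] n3
      by linarith
    then show ?thesis
      using L3[OF T(1)] T X(2) lFE by (intro finish[of "lnk F u \<inter> lnk F u'" u u' "insert v T"]) auto
  next
    case inj: True
    have Lcr: "\<exists>j<4. T \<in> cr j" if T: "T \<in> L" for T
    proof -
      have "card (c ` T) = 3" using inj T L3[OF T] by (simp add: card_image)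
      moreover have sub: "c ` T \<subseteq> {..<4}" using c4 by auto
      ultimately have "card ({..<4} - c ` T) = 1" by (simp add: card_Diff_subset finite_subset[OF sub])
      then obtain j where j: "{..<4} - c ` T = {j}" by (auto simp: card_1_singleton_iff)
      then have "c ` T = {..<4} - {j}" "j < 4" using sub by auto
      then show ?thesis using inj T L3[OF T] by (auto simp: cr_def crossing_def)
    qed
    \<comment> \<open>A quarter of 0.029. The link cannot lie in \<open>cr j\<close> alone, as 0.029
      > 0.0178, so some edge through \<open>v\<close> contains a vertex \<open>u\<close> of colour
      \<open>j\<close>; then \<open>v\<close> and \<open>u\<close> share at least 0.00725 + 0.015 -
      0.0178 > 0.004.\<close>
    have "\<exists>j<4. 725 / 100000 * n ^ 3 \<le> real (card (L \<inter> cr j))"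
    proof (rule ccontr)
      assume no: "\<not> ?thesis"
      have "L = (\<Union>j<4. L \<inter> cr j)" using Lcr by blast
      then have "card L \<le> (\<Sum>j<4. card (L \<inter> cr j))" using card_UN_le[of "{..<4}" "\<lambda>j. L \<inter> cr j"] by simp
      then have "real (card L) \<le> real (\<Sum>j<4. card (L \<inter> cr j))" by (simp only: of_nat_le_iff)
      also have "\<dots> = (\<Sum>j<4. real (card (L \<inter> cr j)))" by simp
      also have "\<dots> < (\<Sum>j<(4::nat). 725 / 100000 * n ^ 3)"
        using no by (intro sum_strict_mono) (auto simp: not_le lessThan_empty_iff)
      finally show False using Lbig by simp
    qed
    then obtain j where j: "j < 4" "725 / 100000 * n ^ 3 \<le> real (card (L \<inter> cr j))" by auto
    have "\<not> L \<subseteq> cr j"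
    proof
      assume "L \<subseteq> cr j"
      then have "card L \<le> card (cr j)" by (rule card_mono[OF fincr])
      then show False using Lbig crle[OF j(1)] n3 by linarith
    qed
    then obtain T where T: "T \<in> L" "T \<notin> cr j" by auto
    then obtain j' where j': "T \<in> cr j'" using Lcr by blast
    then have "j \<in> c ` T" using T j(1) by (auto simp: cr_def crossing_def)
    then obtain u where u: "u \<in> T" "c u = j" by auto
    then have uW: "u \<in> W" using L3[OF T(1)] by blast
    have "L \<inter> cr j \<subseteq> cr j" "lnk F u \<subseteq> cr j" using lF[OF uW] u by auto
    then have "4 / 1000 * n ^ 3 \<le> real (card ((L \<inter> cr j) \<inter> lnk F u))"
      using inter[of "L \<inter> cr j" j "lnk F u"] deg[OF uW] crle[OF j(1)] j(2) n3 by linarith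
    then show ?thesis
      using L3[OF T(1)] u X(2) lFE
      by (intro finish[of "(L \<inter> cr j) \<inter> lnk F u" v u "insert v T"]) (auto simp: L_def)
  qed
qed

text \<open>Greedy: each \<open>b\<close> gets a copy avoiding the previous copies and the vertices
  of \<open>B\<close> still to be served. A served vertex trades its share 8 for the 7 of a new
  copy, so the size condition is preserved.\<close>

lemma big_vertices_packing:
  fixes V :: "'a set"
  assumes fin: "finite V" and E: "\<And>e. e \<in> E \<Longrightarrow> e \<subseteq> V \<and> card e = 4"
    and np: "near_partite V E W c F" and n: "2 * M0 \<le> card V"
    and B: "finite B" "B \<subseteq> {v \<in> V. 30 / 1000 * real (card V) ^ 3 \<le> real (card (lnk E v))}"
    and P: "finite P" "\<forall>S\<in>P. tri E S" "pairwise disjnt P" "\<Union>P \<inter> B = {}"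
    and small: "real (7 * card P + 8 * card B) \<le> real (card V) / 2000"
  shows "packs (card P + card B) E"
  using B P small
proof (induction B arbitrary: P rule: finite_induct)
  case empty
  then show ?case unfolding packs_def by auto
next
  case (insert b B)
  define X where "X = \<Union>P \<union> B"
  have "card X \<le> card (\<Union>P) + card B" unfolding X_def by (rule card_Un_le)
  then have "card X \<le> 7 * card P + 8 * card (insert b B)"
    using card_Union_packing(1)[OF insert.prems(2,3)] insert.hyps by simp
  then have cX: "real (card X) \<le> real (card V) / 2000" using insert.prems(6) by linarith
  have "\<Union>P \<subseteq> V" using insert.prems(3) tri_subset[of E _ V] E by blast
  then have XV: "X \<subseteq> V" using insert.prems(1) by (auto simp: X_def)
  have bX: "b \<notin> X" using insert.prems(5) insert.hyps by (auto simp: X_def)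
  obtain S where S: "tri E S" "b \<in> S" "S \<inter> X = {}"
    using big_vertex_tri[OF fin E np n _ _ XV bX cX] insert.prems(1) by auto
  have disj: "S \<inter> \<Union>P = {}" using S(3) by (auto simp: X_def)
  note P' = packing_insert[OF insert.prems(2,3,4) S(1) disj]
  have "packs (card (insert S P) + card B) E"
  proof (rule insert.IH[OF _ P'(1,2,3)])
    show "\<Union>(insert S P) \<inter> B = {}" using S(3) insert.prems(5) by (auto simp: X_def)
    show "real (7 * card (insert S P) + 8 * card B) \<le> real (card V) / 2000"
      using insert.prems(6) insert.hyps unfolding P'(4) by simp
  qed (use insert.prems(1) in auto)
  then show ?case using insert.hyps unfolding P'(4) by simp
qed

section \<open>Counting edges when large vertices are missing\<close>

lemma card_edges_meeting:
  assumes "finite V" "B \<subseteq> V"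
  shows "card {e. e \<subseteq> V \<and> card e = k \<and> e \<inter> B \<noteq> {}} + ((card V - card B) choose k) = card V choose k"
proof -
  have fin: "finite {e. e \<subseteq> V \<and> card e = k}" using assms(1) by simp
  have "{e. e \<subseteq> V \<and> card e = k} = {e. e \<subseteq> V \<and> card e = k \<and> e \<inter> B \<noteq> {}} \<union> {e. e \<subseteq> V - B \<and> card e = k}"
    by auto
  moreover have "card ({e. e \<subseteq> V \<and> card e = k \<and> e \<inter> B \<noteq> {}} \<union> {e. e \<subseteq> V - B \<and> card e = k}) =
      card {e. e \<subseteq> V \<and> card e = k \<and> e \<inter> B \<noteq> {}} + card {e. e \<subseteq> V - B \<and> card e = k}"
    using assms(1) by (intro card_Un_disjoint) (auto intro: finite_subset[OF _ fin])
  moreover have "card {e. e \<subseteq> V - B \<and> card e = k} = (card V - card B) choose k"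
    using n_subsets[of "V - B" k] assms finite_subset by (metis card_Diff_subset finite_Diff)
  ultimately show ?thesis using n_subsets[OF assms(1), of k] by simp
qed

lemma binomial_diff_ge: "real k * real (m choose r) \<le> real ((m + k) choose Suc r) - real (m choose Suc r)"
proof (induction k)
  case (Suc k)
  have "m choose r \<le> (m + k) choose r" by (rule binomial_right_mono) simp
  then have "real (m choose r) \<le> real ((m + k) choose r)" by simp
  moreover have "(m + Suc k) choose Suc r = ((m + k) choose r) + ((m + k) choose Suc r)" by simp
  ultimately show ?case using Suc by (simp add: distrib_right)
qed simp

lemma turan4_diff_ge:
  assumes "3 \<le> m"
  shows "real k * ((real m - 3) / 4) ^ 3 \<le> real (turan4 (m + k)) - real (turan4 m)"
proof (induction k)
  case (Suc k)
  have "((real m - 3) / 4) ^ 3 \<le> ((real (m + k) - 3) / 4) ^ 3" using assms by (intro power_mono) auto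
  moreover have "real (turan4 (m + k)) + ((real (m + k) - 3) / 4) ^ 3 \<le> real (turan4 (m + Suc k))"
    using turan4_Suc_ge[of "m + k"] assms by simp
  moreover have "real (Suc k) * ((real m - 3) / 4) ^ 3 = real k * ((real m - 3) / 4) ^ 3 + ((real m - 3) / 4) ^ 3"
    by (simp add: distrib_right)
  ultimately show ?case using Suc by linarith
qed simp

lemma not_packs_1: "\<not> packs 1 E \<Longrightarrow> tri_free E"
proof -
  have "packs 1 E" if "tri E S" for S
    using that unfolding packs_def by (intro exI[of _ "{S}"]) auto
  then show "\<not> packs 1 E \<Longrightarrow> tri_free E" by (auto simp: tri_free_def)
qed

text \<open>The extremal number is C(n,4) - C(n-t,4) + \<open>turan4 (n - t)\<close>; the binomial
  of n - t stands on the other side to avoid truncated subtraction.\<close>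

theorem disjoint_tri_extremal:
  fixes V :: "'a set"
  assumes fin: "finite V" and E: "\<And>e. e \<in> E \<Longrightarrow> e \<subseteq> V \<and> card e = 4"
    and np: "\<not> packs (Suc t) E" and n: "2 * (M0 + M0 ^ 4) \<le> card V"
    and t: "real t \<le> real (card V) / 10000000000"
    and dense: "(card V choose 4) + turan4 (card V - t) \<le> card E + ((card V - t) choose 4)"
  shows "card E + ((card V - t) choose 4) = (card V choose 4) + turan4 (card V - t)"
    and "\<exists>B c. B \<subseteq> V \<and> card B = t \<and> balanced (V - B) c \<and>
      E = {e. e \<subseteq> V \<and> card e = 4 \<and> (e \<inter> B = {} \<longrightarrow> inj_on c e)}"
proof -
  define n where "n = real (card V)"
  have nM: "2 * M0 \<le> card V" using n by simp
  have n0: "20000000000 \<le> n" using nM by (simp add: n_def M0_def)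
  have n3: "0 < n ^ 3" using n0 by simp
  have finE: "finite E" using E fin by (intro finite_subset[of E "Pow V"]) auto
  have tle: "t \<le> card V" using t n0 by (simp add: n_def)
  have "(card V - t) choose 4 \<le> card V choose 4" by (rule binomial_right_mono) simp
  then have "turan4 (card V - t) \<le> card E" using dense by linarith
  then obtain W c0 F where W: "near_partite V E W c0 F"
    using near_partiteI[OF fin E np nM t] by blast
  define B where "B = {v \<in> V. 30 / 1000 * real (card V) ^ 3 \<le> real (card (lnk E v))}"
  have BV: "B \<subseteq> V" by (auto simp: B_def)
  have finB: "finite B" using fin BV by (rule rev_finite_subset)
  have t2000: "8 * (real t + 1) \<le> n / 2000" using t n0 by (simp add: n_def)
  define s where "s = card B"
  \<comment> \<open>Starting from the empty packing, t + 1 large vertices would already produce t +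
    1 disjoint copies.\<close>
  have st: "s \<le> t"
  proof (rule ccontr)
    assume "\<not> s \<le> t"
    then have "Suc t \<le> card B" by (simp add: s_def)
    then obtain B0 where B0: "B0 \<subseteq> B" "card B0 = Suc t" "finite B0" by (rule obtain_subset_with_card_n)
    have "packs (card ({} :: 'a set set) + card B0) E"
      using B0 t2000 by (intro big_vertices_packing[OF fin E W nM]) (auto simp: B_def n_def)
    then show False using np B0 by simp
  qed
  define E2 where "E2 = {e \<in> E. e \<inter> B = {}}"
  define V2 where "V2 = V - B"
  have finV2: "finite V2" using fin by (simp add: V2_def)
  have cV2: "card V2 = card V - s" unfolding V2_def s_def using finB BV by (rule card_Diff_subset)
  have E2: "e \<subseteq> V2 \<and> card e = 4" if "e \<in> E2" for e using that E[of e] by (auto simp: E2_def V2_def)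
  have finE2: "finite E2" using finE by (simp add: E2_def)
  \<comment> \<open>Copies in \<open>E2\<close> avoid \<open>B\<close>, so each of the
    \<open>s\<close> large vertices could add one more copy to a packing of t - s + 1 of
    them.\<close>
  have np2: "\<not> packs (Suc (t - s)) E2"
  proof
    assume "packs (Suc (t - s)) E2"
    then obtain P where P: "finite P" "card P = Suc (t - s)" "\<forall>S\<in>P. tri E2 S" "pairwise disjnt P"
      by (auto simp: packs_def)
    have "\<forall>S\<in>P. tri E S" using P(3) tri_mono[of E2 _ E] by (auto simp: E2_def)
    moreover have "\<Union>P \<inter> B = {}" using P(3) tri_avoid[of E B] unfolding E2_def by blast
    moreover have "real (7 * card P + 8 * card B) \<le> real (card V) / 2000"
    proof -
      have "7 * card P + 8 * card B \<le> 8 * (t + 1)" using P(2) st by (simp add: s_def)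
      then have "real (7 * card P + 8 * card B) \<le> real (8 * (t + 1))" by (simp only: of_nat_le_iff)
      then show ?thesis using t2000 by (simp add: n_def)
    qed
    ultimately have "packs (card P + card B) E"
      using P(1,4) finB by (intro big_vertices_packing[OF fin E W nM]) (auto simp: B_def)
    then show False using np P(2) st by (simp add: s_def)
  qed
  define M where "M = {e. e \<subseteq> V \<and> card e = 4 \<and> e \<inter> B \<noteq> {}}"
  have finM: "finite M" using fin by (intro finite_subset[of M "Pow V"]) (auto simp: M_def)
  have M: "card M + ((card V - s) choose 4) = card V choose 4"
    unfolding M_def s_def by (rule card_edges_meeting[OF fin BV])
  have EM: "E \<subseteq> M \<union> E2" using E by (auto simp: M_def E2_def)
  have disj: "M \<inter> E2 = {}" by (auto simp: M_def E2_def)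
  have cE: "card E \<le> card M + card E2"
    using card_mono[OF _ EM] card_Un_disjoint[OF finM finE2 disj] finM finE2 by simp
  have "s = t"
  proof (rule ccontr)
    assume "s \<noteq> t"
    then have st': "s < t" using st by simp
    define r where "r = t - s"
    have r: "0 < r" "t = s + r" using st' by (auto simp: r_def)
    obtain U where U: "U \<subseteq> V2" "finite U" "card U \<le> 7 * r" "tri_free {e \<in> E2. e \<inter> U = {}}"
      using maximal_packing[OF np2, of V2] E2 unfolding r_def by blast
    have big: "8 * t \<le> card V"
    proof -
      have "real (8 * t) \<le> real (card V)" using t n0 by (simp add: n_def)
      then show ?thesis by (simp only: of_nat_le_iff)
    qed
    \<comment> \<open>Filling \<open>U\<close> up to exactly 7r vertices makes n - t = m + 6r and n
      - s = m + 7r exact, so that the Turan numbers and binomials can be compared.\<close>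
    have "7 * r - card U \<le> card (V2 - U)"
      using U big r(2) cV2 by (simp add: card_Diff_subset)
    then obtain U' where U': "U' \<subseteq> V2 - U" "card U' = 7 * r - card U" "finite U'"
      by (rule obtain_subset_with_card_n)
    define U3 where "U3 = U \<union> U'"
    have U3: "U3 \<subseteq> V2" "finite U3" using U U' by (auto simp: U3_def)
    have cU3: "card U3 = 7 * r"
      using card_Un_disjoint[of U U'] U U' by (auto simp: U3_def)
    define E3 where "E3 = {e \<in> E2. e \<inter> U3 = {}}"
    define m where "m = card V - s - 7 * r"
    have m: "card V = m + s + 7 * r" using big r(2) by (simp add: m_def)
    have cV3: "card (V2 - U3) = m"
      using card_Diff_subset[OF U3(2,1)] cU3 cV2 by (simp add: m_def)
    have mn: "99999999 / 100000000 * n \<le> real m"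
    proof -
      have "n = real m + real s + 7 * real r" using m by (simp add: n_def)
      moreover have "real s + 7 * real r \<le> 7 * real t" using r(2) by simp
      ultimately show ?thesis using t n0 by (simp add: n_def)
    qed
    have "tri_free E3"
      unfolding tri_free_def
    proof (intro allI notI)
      fix S assume "tri E3 S"
      then have "tri {e \<in> E2. e \<inter> U = {}} S" by (rule tri_mono) (auto simp: E3_def U3_def)
      then show False using U(4) by (simp add: tri_free_def)
    qed
    moreover have "M0 + M0 ^ 4 \<le> m"
    proof -
      have "real (2 * (M0 + M0 ^ 4)) \<le> real (card V)" using n by (simp only: of_nat_le_iff)
      then have "real (M0 + M0 ^ 4) \<le> real m" using mn n0 by (simp add: n_def)
      then show ?thesis by (simp only: of_nat_le_iff)
    qed
    moreover have "e \<subseteq> V2 - U3 \<and> card e = 4" if "e \<in> E3" for e using that E2 by (auto simp: E3_def)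
    ultimately have E3le: "card E3 \<le> turan4 m"
      using tri_free_le_turan4[of "V2 - U3" E3] finV2 cV3 by simp
    have "card E2 \<le> card E3 + card (\<Union>u\<in>U3. {e \<in> E2. u \<in> e})"
    proof -
      have "E2 \<subseteq> E3 \<union> (\<Union>u\<in>U3. {e \<in> E2. u \<in> e})" by (auto simp: E3_def)
      then have "card E2 \<le> card (E3 \<union> (\<Union>u\<in>U3. {e \<in> E2. u \<in> e}))"
        using finE2 U3(2) by (intro card_mono) (auto simp: E3_def)
      then show ?thesis using card_Un_le order_trans by blast
    qed
    moreover have "card (\<Union>u\<in>U3. {e \<in> E2. u \<in> e}) \<le> (\<Sum>u\<in>U3. card {e \<in> E2. u \<in> e})"
      by (rule card_UN_le[OF U3(2)])
    ultimately have "card E2 \<le> card E3 + (\<Sum>u\<in>U3. card {e \<in> E2. u \<in> e})" by linarith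
    then have "real (card E2) \<le> real (card E3) + (\<Sum>u\<in>U3. real (card {e \<in> E2. u \<in> e}))"
      by (metis of_nat_add of_nat_le_iff of_nat_sum)
    also have "(\<Sum>u\<in>U3. real (card {e \<in> E2. u \<in> e})) \<le> (\<Sum>u\<in>U3. 30 / 1000 * n ^ 3)"
    proof (rule sum_mono)
      fix u assume "u \<in> U3"
      then have u: "u \<in> V" "u \<notin> B" using U3 by (auto simp: V2_def)
      have "card {e \<in> E2. u \<in> e} \<le> card {e \<in> E. u \<in> e}"
        using finE by (intro card_mono) (auto simp: E2_def)
      moreover have "card {e \<in> E. u \<in> e} = card (lnk E u)"
        using wt_star[of E "\<lambda>_. 1" u] finE E fin by (auto intro: finite_subset)
      ultimately show "real (card {e \<in> E2. u \<in> e}) \<le> 30 / 1000 * n ^ 3"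
        using u by (simp add: B_def n_def)
    qed
    also have "\<dots> = 210 / 1000 * (real r * n ^ 3)" using cU3 by simp
    finally have cE2: "real (card E2) \<le> real (turan4 m) + 210 / 1000 * (real r * n ^ 3)"
      using E3le by simp
    \<comment> \<open>The fraction 15/62 is slightly below 1/4 with cube above 0.014; it gives a
      convenient lower bound for the growth of \<open>turan4\<close> per vertex.\<close>
    have m13: "99 / 100 * n ^ 3 \<le> real m ^ 3" "(15 / 62 * n) ^ 3 \<le> ((real m - 3) / 4) ^ 3"
    proof -
      have "(999 / 1000 * n) ^ 3 \<le> real m ^ 3" using mn n0 by (intro power_mono) auto
      then have "(999 / 1000) ^ 3 * n ^ 3 \<le> real m ^ 3" by (simp only: power_mult_distrib)
      moreover have "99 / 100 * n ^ 3 \<le> (999 / 1000) ^ 3 * n ^ 3"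
        using n3 by (intro mult_right_mono) (auto simp: power3_eq_cube)
      ultimately show "99 / 100 * n ^ 3 \<le> real m ^ 3" by linarith
      show "(15 / 62 * n) ^ 3 \<le> ((real m - 3) / 4) ^ 3" using mn n0 by (intro power_mono) auto
    qed
    have Vt: "card V - t = m + 6 * r" "card V - s = m + 7 * r" using m r(2) by auto
    have "real (6 * r) * ((real m - 3) / 4) ^ 3 \<le> real (turan4 (m + 6 * r)) - real (turan4 m)"
      using mn n0 by (intro turan4_diff_ge) auto
    moreover have "real (6 * r) * (14 / 1000 * n ^ 3) \<le> real (6 * r) * ((real m - 3) / 4) ^ 3"
    proof (rule mult_left_mono)
      have "14 / 1000 * n ^ 3 \<le> (15 / 62) ^ 3 * n ^ 3"
        using n3 by (intro mult_right_mono) (auto simp: power3_eq_cube)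
      also have "\<dots> = (15 / 62 * n) ^ 3" by (simp only: power_mult_distrib)
      finally show "14 / 1000 * n ^ 3 \<le> ((real m - 3) / 4) ^ 3" using m13(2) by linarith
    qed simp
    ultimately have T: "84 / 1000 * (real r * n ^ 3) \<le> real (turan4 (m + 6 * r)) - real (turan4 m)"
      by simp
    have "real r * real ((m + 6 * r) choose 3) \<le>
        real ((m + 6 * r + r) choose Suc 3) - real ((m + 6 * r) choose Suc 3)" by (rule binomial_diff_ge)
    moreover have "real r * (16 / 100 * n ^ 3) \<le> real r * real ((m + 6 * r) choose 3)"
    proof (rule mult_left_mono)
      have "(16 / 100 * n ^ 3) \<le> (real m - 2) ^ 3 / 6"
      proof -
        have "(999 / 1000 * n) ^ 3 \<le> (real m - 2) ^ 3" using mn n0 by (intro power_mono) auto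
        then have "(999 / 1000) ^ 3 * n ^ 3 \<le> (real m - 2) ^ 3" by (simp only: power_mult_distrib)
        moreover have "99 / 100 * n ^ 3 \<le> (999 / 1000) ^ 3 * n ^ 3"
          using n3 by (intro mult_right_mono) (auto simp: power3_eq_cube)
        ultimately show ?thesis using n3 by linarith
      qed
      also have "(real m - 2) ^ 3 / 6 \<le> real (m choose 3)"
      proof -
        have m3: "3 \<le> m" using mn n0 by simp
        have "real (m choose 3) = (\<Prod>i = 0..<3. (real m - real i) / real (3 - i))"
          unfolding binomial_altdef_of_nat[OF m3] using m3 by (intro prod.cong) (auto simp: of_nat_diff)
        also have "\<dots> = real m * (real m - 1) * (real m - 2) / 6" by (simp add: numeral_eq_Suc)
        also have "\<dots> \<ge> (real m - 2) * (real m - 2) * (real m - 2) / 6"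
          using m3 by (intro divide_right_mono mult_mono) auto
        finally show ?thesis by (simp add: power3_eq_cube)
      qed
      also have "real (m choose 3) \<le> real ((m + 6 * r) choose 3)" by (simp add: binomial_right_mono)
      finally show "16 / 100 * n ^ 3 \<le> real ((m + 6 * r) choose 3)" .
    qed simp
    ultimately have C: "16 / 100 * (real r * n ^ 3) \<le>
        real ((card V - s) choose 4) - real ((card V - t) choose 4)"
      unfolding Vt by (simp add: numeral_eq_Suc add_ac)
    have "real ((card V choose 4) + turan4 (card V - t)) \<le> real (card E + ((card V - t) choose 4))"
      using dense by (simp only: of_nat_le_iff)
    moreover have "real (card M + ((card V - s) choose 4)) = real (card V choose 4)" using M by simp
    moreover have "real (card E) \<le> real (card M) + real (card E2)" using cE by simp
    \<comment> \<open>In units of r n^3, having only \<open>s\<close> large vertices forfeits 0.16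
      from the binomials and 0.084 from the Turan numbers, together 0.244, and gains at most 0.21
      from edges meeting \<open>U3\<close>.\<close>
    moreover have "0 < real r * n ^ 3" using r(1) n3 by simp
    ultimately show False using C T cE2 unfolding Vt by simp
  qed
  then have free2: "tri_free E2" using np2 by (intro not_packs_1) simp
  have cV2': "card V2 = card V - t" using cV2 \<open>s = t\<close> by simp
  have nt: "M0 + M0 ^ 4 < card V - t"
  proof -
    have "real (2 * (M0 + M0 ^ 4)) \<le> n" unfolding n_def using n by (simp only: of_nat_le_iff)
    then have "real (M0 + M0 ^ 4) < real (card V) - real t" using t n0 by (simp add: n_def)
    then have "real (M0 + M0 ^ 4) < real (card V - t)" using tle by (simp add: of_nat_diff)
    then show ?thesis by (simp only: of_nat_less_iff)
  qed
  have le2: "card E2 \<le> turan4 (card V - t)"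
    using tri_free_le_turan4[OF finV2 E2 free2] nt cV2' by simp
  have eqs: "card E2 = turan4 (card V - t)" "card E = card M + card E2"
    using le2 cE dense M[unfolded \<open>s = t\<close>] by linarith+
  show "card E + ((card V - t) choose 4) = (card V choose 4) + turan4 (card V - t)"
    using eqs M \<open>s = t\<close> by simp
  have "E = M \<union> E2"
    using card_subset_eq[OF _ EM] eqs(2) card_Un_disjoint[OF finM finE2 disj] finM finE2 by simp
  obtain c where c: "E2 = {e. e \<subseteq> V2 \<and> card e = 4 \<and> inj_on c e}" "balanced V2 c"
    using tri_free_extremal[OF finV2 E2 free2] nt eqs(1) unfolding cV2' by metis
  have "E = {e. e \<subseteq> V \<and> card e = 4 \<and> (e \<inter> B = {} \<longrightarrow> inj_on c e)}"
    unfolding \<open>E = M \<union> E2\<close> c(1) M_def V2_def by blast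
  then show "\<exists>B c. B \<subseteq> V \<and> card B = t \<and> balanced (V - B) c \<and>
      E = {e. e \<subseteq> V \<and> card e = 4 \<and> (e \<inter> B = {} \<longrightarrow> inj_on c e)}"
    using BV c(2) \<open>s = t\<close> unfolding V2_def s_def by blast
qed

section \<open>Isomorphism classes\<close>

lemma hypergraph_edges: "hypergraph H \<Longrightarrow> e \<in> edges H \<Longrightarrow> e \<subseteq> verts H"
  by (simp add: hypergraph_def)

lemma isomorphic_sym:
  assumes "isomorphic G H"
  shows "isomorphic H G"
proof -
  obtain f where f: "bij_betw f (verts G) (verts H)" "(\<lambda>e. f ` e) ` edges G = edges H"
    and hyp: "hypergraph G" "hypergraph H"
    using assms by (auto simp: isomorphic_def)
  define g where "g = inv_into (verts G) f"
  have g: "bij_betw g (verts H) (verts G)" unfolding g_def by (rule bij_betw_inv_into[OF f(1)])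
  have gf: "g ` f ` e = e" if "e \<in> edges G" for e
    unfolding g_def using f(1) hypergraph_edges[OF hyp(1) that]
    by (simp add: bij_betw_def inv_into_image_cancel)
  have "(\<lambda>e. g ` e) ` edges H = (\<lambda>e. g ` f ` e) ` edges G"
    unfolding f(2)[symmetric] by (simp add: image_image)
  also have "\<dots> = edges G" using gf by simp
  finally show ?thesis using g hyp by (auto simp: isomorphic_def)
qed

lemma isomorphic_trans:
  assumes "isomorphic G H" "isomorphic H K"
  shows "isomorphic G K"
proof -
  obtain f g where f: "bij_betw f (verts G) (verts H)" "(\<lambda>e. f ` e) ` edges G = edges H"
    and g: "bij_betw g (verts H) (verts K)" "(\<lambda>e. g ` e) ` edges H = edges K"
    and hyp: "hypergraph G" "hypergraph K"
    using assms by (auto simp: isomorphic_def)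
  have "bij_betw (g \<circ> f) (verts G) (verts K)" by (rule bij_betw_trans[OF f(1) g(1)])
  moreover have "(\<lambda>e. (g \<circ> f) ` e) ` edges G = edges K"
    unfolding g(2)[symmetric] f(2)[symmetric] by (simp add: image_image image_comp)
  ultimately show ?thesis using hyp unfolding isomorphic_def by blast
qed

lemma iso_class_eq:
  assumes "isomorphic G H"
  shows "iso_class G = iso_class H"
proof -
  have "isomorphic K G \<longleftrightarrow> isomorphic K H" for K :: "nat hypergraph"
    using isomorphic_trans[of K G H] isomorphic_trans[of K H G] isomorphic_sym[OF assms] assms by metis
  then show ?thesis by (simp add: iso_class_def)
qed

lemma copy_imp_tri:
  assumes "is_copy_in C T4 H"
  shows "tri (edges H) (verts C)"
proof -
  have "isomorphic C T4" using assms by (simp add: is_copy_in_def)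
  then have "isomorphic T4 C" by (rule isomorphic_sym)
  then obtain g where g: "bij_betw g {1..7::nat} (verts C)"
    "(\<lambda>e. g ` e) ` {{1,2,3,4}, {1,2,3,5}, {4,5,6,7}} = edges C"
    by (auto simp: isomorphic_def T4_def)
  have inj: "inj_on g {1..7}" using g(1) by (simp add: bij_betw_def)
  have "card (g ` {1,2,3}) = card {1,2,3::nat}" by (intro card_image inj_on_subset[OF inj]) auto
  then have c3: "card (g ` {1,2,3}) = 3" by simp
  have c7: "card (verts C) = 7" using bij_betw_same_card[OF g(1)] by simp
  have "{1..7::nat} = {1,2,3} \<union> {4,5,6,7}" by auto
  then have S: "verts C = g ` {1,2,3} \<union> {g 4, g 5, g 6, g 7}"
    using g(1) by (auto simp: bij_betw_def)
  have "g ` {1,2,3,4} \<in> edges C" "g ` {1,2,3,5} \<in> edges C" "g ` {4,5,6,7} \<in> edges C"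
    unfolding g(2)[symmetric] by blast+
  moreover have "edges C \<subseteq> edges H" using assms by (simp add: is_copy_in_def)
  moreover have "g ` {1,2,3,4} = insert (g 4) (g ` {1,2,3})" "g ` {1,2,3,5} = insert (g 5) (g ` {1,2,3})"
    "g ` {4,5,6,7} = {g 4, g 5, g 6, g 7}" by auto
  ultimately have "insert (g 4) (g ` {1,2,3}) \<in> edges H" "insert (g 5) (g ` {1,2,3}) \<in> edges H"
    "{g 4, g 5, g 6, g 7} \<in> edges H" by auto
  then show ?thesis unfolding tri_def using S c3 c7 by blast
qed

lemma tri_imp_copy:
  assumes "tri (edges H) S" "hypergraph H"
  shows "\<exists>C. is_copy_in C T4 H \<and> verts C = S"
proof -
  obtain T x y z w where S: "S = T \<union> {x, y, z, w}" "card T = 3" "card S = 7"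
    "insert x T \<in> edges H" "insert y T \<in> edges H" "{x, y, z, w} \<in> edges H"
    using assms(1) by (auto simp: tri_def)
  obtain a b c where T: "T = {a, b, c}" using S(2) by (auto simp: card_3_iff)
  let ?xs = "[a, b, c, x, y, z, w]"
  have xs: "set ?xs = S" using S T by auto
  have "distinct ?xs" by (rule card_distinct) (use xs S(3) in simp)
  define g where "g i = ?xs ! (i - 1)" for i :: nat
  have g: "g 1 = a" "g 2 = b" "g 3 = c" "g 4 = x" "g 5 = y" "g 6 = z" "g 7 = w"
    by (simp_all add: g_def numeral_eq_Suc)
  have seven: "{1..7::nat} = {1,2,3,4,5,6,7}" by auto
  have gS: "g ` {1..7} = S" unfolding seven using g S T by auto
  have "inj_on g {1..7}" by (rule eq_card_imp_inj_on) (use gS S(3) in auto)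
  then have bij: "bij_betw g {1..7} S" using gS by (simp add: bij_betw_def)
  define C where "C = Hypergraph S {insert x T, insert y T, {x, y, z, w}}"
  have "(\<lambda>e. g ` e) ` {{1,2,3,4}, {1,2,3,5}, {4,5,6,7}} = {insert x T, insert y T, {x, y, z, w}}"
    using g T by (simp add: insert_commute)
  moreover have "hypergraph T4" by (auto simp: hypergraph_def T4_def)
  moreover have "hypergraph C"
    using S(1,3) card_ge_0_finite[of S] by (auto simp: hypergraph_def C_def)
  ultimately have "isomorphic T4 C"
    using bij unfolding isomorphic_def by (intro conjI exI[of _ g]) (simp_all add: T4_def C_def)
  then have "isomorphic C T4" by (rule isomorphic_sym)
  moreover have "S \<subseteq> verts H" by (rule tri_subset[OF assms(1) hypergraph_edges[OF assms(2)]])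
  ultimately show ?thesis
    using S(4,5,6) by (intro exI[of _ C]) (auto simp: is_copy_in_def C_def)
qed

lemma contains_iff_packs:
  assumes "hypergraph H"
  shows "contains_disjoint_copies k T4 H \<longleftrightarrow> packs k (edges H)"
proof
  assume "contains_disjoint_copies k T4 H"
  then obtain C where C: "\<forall>i<k. is_copy_in (C i) T4 H"
    "\<forall>i<k. \<forall>j<k. i \<noteq> j \<longrightarrow> verts (C i) \<inter> verts (C j) = {}"
    by (auto simp: contains_disjoint_copies_def)
  have tri: "tri (edges H) (verts (C i))" if "i < k" for i using C(1) that copy_imp_tri by blast
  have "inj_on (\<lambda>i. verts (C i)) {..<k}"
  proof (rule inj_onI, rule ccontr)
    fix i j assume ij: "i \<in> {..<k}" "j \<in> {..<k}" "verts (C i) = verts (C j)" "i \<noteq> j"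
    then have "verts (C i) = {}" using C(2) by force
    then show False using tri_card(3)[OF tri[of i]] ij by simp
  qed
  then have "card ((\<lambda>i. verts (C i)) ` {..<k}) = k" by (simp add: card_image)
  moreover have "pairwise disjnt ((\<lambda>i. verts (C i)) ` {..<k})"
    using C(2) unfolding pairwise_def disjnt_def by fastforce
  ultimately show "packs k (edges H)"
    unfolding packs_def using tri by (intro exI[of _ "(\<lambda>i. verts (C i)) ` {..<k}"]) auto
next
  assume "packs k (edges H)"
  then obtain P where P: "finite P" "card P = k" "\<forall>S\<in>P. tri (edges H) S" "pairwise disjnt P"
    by (auto simp: packs_def)
  obtain h where h: "bij_betw h {0..<k} P" using ex_bij_betw_nat_finite[OF P(1)] P(2) by auto
  have "\<forall>i. \<exists>C. i < k \<longrightarrow> is_copy_in C T4 H \<and> verts C = h i"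
    using P(3) bij_betw_apply[OF h] tri_imp_copy[OF _ assms] by (metis atLeast0LessThan lessThan_iff)
  then obtain C where C: "\<And>i. i < k \<Longrightarrow> is_copy_in (C i) T4 H \<and> verts (C i) = h i" by metis
  have "verts (C i) \<inter> verts (C j) = {}" if "i < k" "j < k" "i \<noteq> j" for i j
  proof -
    have "h i \<noteq> h j" using h that by (auto simp: bij_betw_def inj_on_def)
    moreover have "h i \<in> P" "h j \<in> P" using bij_betw_apply[OF h] that by auto
    ultimately show ?thesis using P(4) C that by (auto simp: pairwise_def disjnt_def)
  qed
  then show "contains_disjoint_copies k T4 H" unfolding contains_disjoint_copies_def using C by blast
qed

text \<open>An intrinsic description of the join on any vertex type: \<open>B\<close> is the
  complete part, \<open>c\<close> the partition of the rest. It allows comparison with the sum type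
  of \<open>join\<close> without unfolding nested images.\<close>

definition extremal_structure :: "nat \<Rightarrow> 'a hypergraph \<Rightarrow> 'a set \<Rightarrow> ('a \<Rightarrow> nat) \<Rightarrow> bool" where
  "extremal_structure t H B c \<longleftrightarrow> finite (verts H) \<and> B \<subseteq> verts H \<and> card B = t \<and>
     balanced (verts H - B) c \<and>
     edges H = {e. e \<subseteq> verts H \<and> card e = 4 \<and> (e \<inter> B = {} \<longrightarrow> inj_on c e)}"

section \<open>Extremal structures of equal size are isomorphic\<close>

lemma bij_betw_of_fibres:
  assumes "finite V" "finite V'" "\<And>i. card {v \<in> V. k v = i} = card {v \<in> V'. k' v = i}"
  obtains h where "bij_betw h V V'" "\<And>v. v \<in> V \<Longrightarrow> k' (h v) = k v"
proof -
  have "\<forall>i. \<exists>f. bij_betw f {v \<in> V. k v = i} {v \<in> V'. k' v = i}"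
    using assms by (intro allI finite_same_card_bij) auto
  then obtain f where f: "\<And>i. bij_betw (f i) {v \<in> V. k v = i} {v \<in> V'. k' v = i}" by metis
  define h where "h v = f (k v) v" for v
  have h: "h v \<in> V' \<and> k' (h v) = k v" if "v \<in> V" for v
    using bij_betw_apply[OF f[of "k v"], of v] that by (auto simp: h_def)
  have "inj_on h V"
  proof (rule inj_onI)
    fix u v assume uv: "u \<in> V" "v \<in> V" "h u = h v"
    then have "k u = k v" using h by metis
    then show "u = v" using uv f[of "k v"] by (auto simp: h_def bij_betw_def inj_on_def)
  qed
  moreover have "h ` V = V'"
  proof
    show "h ` V \<subseteq> V'" using h by auto
    show "V' \<subseteq> h ` V"
    proof
      fix w assume "w \<in> V'"
      then have "w \<in> f (k' w) ` {v \<in> V. k v = k' w}" using f[of "k' w"] by (simp add: bij_betw_def)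
      then obtain v where v: "v \<in> V" "k v = k' w" "w = f (k' w) v" by blast
      then have "w = h v" by (simp add: h_def)
      then show "w \<in> h ` V" using v(1) by blast
    qed
  qed
  ultimately have "bij_betw h V V'" by (simp add: bij_betw_def)
  then show ?thesis using that h by blast
qed

text \<open>Balanced sizes take only two consecutive values, so division of the total by 4
  determines how many classes have each size.\<close>

lemma balanced_fibres:
  fixes f :: "nat \<Rightarrow> nat"
  assumes "\<forall>i<4. \<forall>j<4. f i \<le> f j + 1"
  shows "card {i \<in> {..<4}. f i = k} =
    (if k = (\<Sum>i<4. f i) div 4 then 4 - (\<Sum>i<4. f i) mod 4
     else if k = (\<Sum>i<4. f i) div 4 + 1 then (\<Sum>i<4. f i) mod 4 else 0)"
proof -
  define q where "q = Min (f ` {..<4})"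
  have "q \<in> f ` {..<4}" unfolding q_def by (intro Min_in) (auto simp: lessThan_empty_iff)
  then obtain l where l: "l < 4" "q = f l" by auto
  have val: "f i = q \<or> f i = q + 1" if "i < 4" for i
  proof -
    have "q \<le> f i" unfolding q_def using that by (intro Min_le) auto
    moreover have "f i \<le> q + 1" using assms that l by auto
    ultimately show ?thesis by auto
  qed
  define R where "R = {i \<in> {..<4}. f i = q + 1}"
  define Q where "Q = {i \<in> {..<4}. f i = q}"
  have QR: "{..<4} = Q \<union> R" "Q \<inter> R = {}" "finite Q" "finite R" using val by (auto simp: Q_def R_def)
  have "card Q + card R = 4" using card_Un_disjoint[OF QR(3,4,2)] QR(1) by (metis card_lessThan)
  moreover have "0 < card Q" using l QR(3) by (auto simp: Q_def card_gt_0_iff)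
  ultimately have c: "card Q = 4 - card R" "card R < 4" by auto
  have "(\<Sum>i<4. f i) = (\<Sum>i\<in>Q. f i) + (\<Sum>i\<in>R. f i)"
    unfolding QR(1) by (rule sum.union_disjoint[OF QR(3,4,2)])
  also have "(\<Sum>i\<in>Q. f i) = card Q * q" by (simp add: Q_def)
  also have "(\<Sum>i\<in>R. f i) = card R * (q + 1)" by (simp add: R_def)
  also have "card Q * q + card R * (q + 1) = (card Q + card R) * q + card R" by (simp add: algebra_simps)
  also have "\<dots> = 4 * q + card R" using c by simp
  finally have s: "(\<Sum>i<4. f i) = 4 * q + card R" .
  have "(\<Sum>i<4. f i) div 4 = q" "(\<Sum>i<4. f i) mod 4 = card R" unfolding s using c(2) by simp_all
  moreover have "{i \<in> {..<4}. f i = k} = {}" if "k \<noteq> q" "k \<noteq> q + 1"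
    using val that by force
  ultimately show ?thesis using c(1) by (auto simp: Q_def R_def)
qed

text \<open>Two balanced colourings agree in class sizes up to a permutation of the colours; the
  permutation comes from gluing bijections between the colours of equal class size.\<close>

lemma balanced_recolour:
  assumes "finite V" "finite V'" "balanced V c" "balanced V' c'" "card V = card V'"
  obtains p where "inj_on p {..<4::nat}" "\<And>i. card {v \<in> V. p (c v) = i} = card {v \<in> V'. c' v = i}"
proof -
  define f where "f i = card {v \<in> V. c v = i}" for i
  define g where "g i = card {v \<in> V'. c' v = i}" for i
  have c: "c v < 4" if "v \<in> V" for v using assms(3) that by (simp add: balanced_def)
  have c': "c' v < 4" if "v \<in> V'" for v using assms(4) that by (simp add: balanced_def)
  have sums: "(\<Sum>i<4. f i) = (\<Sum>i<4. g i)"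
    using sum_card_classes[OF assms(1), of c] sum_card_classes[OF assms(2), of c'] c c' assms(5)
    unfolding f_def g_def by simp
  have bf: "\<forall>i<4. \<forall>j<4. f i \<le> f j + 1" and bg: "\<forall>i<4. \<forall>j<4. g i \<le> g j + 1"
    using assms(3,4) by (auto simp: balanced_def f_def g_def)
  have eq: "card {i \<in> {..<4}. f i = k} = card {i \<in> {..<4}. g i = k}" for k
    using balanced_fibres[OF bf, of k] balanced_fibres[OF bg, of k] unfolding sums by simp
  obtain p where p: "bij_betw p {..<4} {..<4}" "\<And>i. i \<in> {..<4} \<Longrightarrow> g (p i) = f i"
    using bij_betw_of_fibres[OF _ _ eq] by auto
  have inj: "inj_on p {..<4}" using p(1) by (simp add: bij_betw_def)
  have "card {v \<in> V. p (c v) = i} = card {v \<in> V'. c' v = i}" for i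
  proof (cases "i < 4")
    case True
    then have "i \<in> p ` {..<4}" using p(1) by (simp add: bij_betw_def)
    then obtain j where j: "j < 4" "p j = i" by auto
    have "p (c v) = i \<longleftrightarrow> c v = j" if "v \<in> V" for v
      using inj_on_eq_iff[OF inj, of "c v" j] c[OF that] j by simp
    then have "{v \<in> V. p (c v) = i} = {v \<in> V. c v = j}" by blast
    then show ?thesis using p(2)[of j] j by (simp add: f_def g_def)
  next
    case False
    have "p (c v) < 4" if "v \<in> V" for v using bij_betw_apply[OF p(1), of "c v"] c[OF that] by simp
    then have "{v \<in> V. p (c v) = i} = {}" "{v \<in> V'. c' v = i} = {}" using False c' by auto
    then show ?thesis by (simp only: card.empty)
  qed
  then show ?thesis using that inj by blast
qed

lemma extremal_structure_isomorphic:
  assumes H: "extremal_structure t H B c" and H': "extremal_structure t H' B' c'"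
    and card: "card (verts H) = card (verts H')"
  shows "isomorphic H H'"
proof -
  define V where "V = verts H"
  define V' where "V' = verts H'"
  have fin: "finite V" "finite V'" and B: "B \<subseteq> V" "card B = t" and B': "B' \<subseteq> V'" "card B' = t"
    and bal: "balanced (V - B) c" "balanced (V' - B') c'"
    and EH: "edges H = {e. e \<subseteq> V \<and> card e = 4 \<and> (e \<inter> B = {} \<longrightarrow> inj_on c e)}"
    and EH': "edges H' = {e. e \<subseteq> V' \<and> card e = 4 \<and> (e \<inter> B' = {} \<longrightarrow> inj_on c' e)}"
    using H H' unfolding extremal_structure_def V_def V'_def by blast+
  have finB: "finite B" "finite B'" using fin B B' finite_subset by blast+
  have "card (V - B) = card (V' - B')"
    using card_Diff_subset[OF finB(1) B(1)] card_Diff_subset[OF finB(2) B'(1)] B B' card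
    by (simp add: V_def V'_def)
  then obtain p where p: "inj_on p {..<4::nat}"
    "\<And>i. card {v \<in> V - B. p (c v) = i} = card {v \<in> V' - B'. c' v = i}"
    using balanced_recolour[OF _ _ bal] fin by auto
  \<comment> \<open>The value \<open>None\<close> marks \<open>B\<close> as a fifth class, so a
    single fibrewise bijection matches both \<open>B\<close> and the four classes.\<close>
  define k where "k v = (if v \<in> B then None else Some (p (c v)))" for v
  define k' where "k' v = (if v \<in> B' then None else Some (c' v))" for v
  have "card {v \<in> V. k v = i} = card {v \<in> V'. k' v = i}" for i
  proof (cases i)
    case None
    then have "{v \<in> V. k v = i} = B" "{v \<in> V'. k' v = i} = B'" using B B' by (auto simp: k_def k'_def)
    then show ?thesis using B B' by simp
  next
    case (Some j)
    then have "{v \<in> V. k v = i} = {v \<in> V - B. p (c v) = j}" "{v \<in> V'. k' v = i} = {v \<in> V' - B'. c' v = j}"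
      by (auto simp: k_def k'_def)
    then show ?thesis using p(2) by simp
  qed
  then obtain h where h: "bij_betw h V V'" "\<And>v. v \<in> V \<Longrightarrow> k' (h v) = k v"
    using bij_betw_of_fibres[OF fin] by blast
  have inj: "inj_on h V" and hV: "h ` V = V'" using h(1) by (auto simp: bij_betw_def)
  have hB: "h v \<in> B' \<longleftrightarrow> v \<in> B" if "v \<in> V" for v
    using h(2)[OF that] by (auto simp: k_def k'_def split: if_splits)
  have hc: "c' (h v) = p (c v)" if "v \<in> V - B" for v
    using h(2)[of v] that hB[of v] by (auto simp: k_def k'_def split: if_splits)
  have c4: "c v < 4" if "v \<in> V - B" for v using bal(1) that by (simp add: balanced_def)
  have key: "h ` e \<in> edges H' \<longleftrightarrow> e \<in> edges H" if e: "e \<subseteq> V" for e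
  proof -
    have injh: "inj_on h e" by (rule inj_on_subset[OF inj e])
    have "card (h ` e) = card e" by (rule card_image[OF injh])
    moreover have "h ` e \<subseteq> V'" using e hV by auto
    moreover have "h ` e \<inter> B' = {} \<longleftrightarrow> e \<inter> B = {}" using hB e by blast
    moreover have "inj_on c' (h ` e) \<longleftrightarrow> inj_on c e" if "e \<inter> B = {}"
    proof -
      have eV: "v \<in> V - B" if "v \<in> e" for v using that e \<open>e \<inter> B = {}\<close> by auto
      have "c' (h u) = c' (h v) \<longleftrightarrow> c u = c v" if "u \<in> e" "v \<in> e" for u v
        using hc[OF eV[OF that(1)]] hc[OF eV[OF that(2)]] c4[OF eV[OF that(1)]] c4[OF eV[OF that(2)]] p(1)
        by (auto dest: inj_onD)
      then show ?thesis using injh unfolding inj_on_def by blast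
    qed
    ultimately show ?thesis using e unfolding EH EH' by auto
  qed
  have "(\<lambda>e. h ` e) ` edges H = edges H'"
  proof
    show "(\<lambda>e. h ` e) ` edges H \<subseteq> edges H'" using key EH by auto
    show "edges H' \<subseteq> (\<lambda>e. h ` e) ` edges H"
    proof
      fix e' assume e': "e' \<in> edges H'"
      then have "e' \<subseteq> h ` V" using hV EH' by auto
      then obtain e where "e \<subseteq> V" "e' = h ` e" by (auto simp: subset_image_iff)
      then show "e' \<in> (\<lambda>e. h ` e) ` edges H" using key e' by auto
    qed
  qed
  moreover have "hypergraph H" "hypergraph H'"
    using fin EH EH' by (auto simp: hypergraph_def V_def V'_def)
  ultimately show ?thesis using h(1) unfolding isomorphic_def V_def V'_def by blast
qed

text \<open>Off \<open>B\<close> every edge is transversal to four classes, so two edges over one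
  triple have their last vertices in the same class, and no edge off \<open>B\<close> contains both.
  Thus each copy of \<open>T4\<close> uses a vertex of \<open>B\<close>, and disjoint copies use
  different ones.\<close>

lemma extremal_structure_not_packs:
  assumes H: "extremal_structure t H B c"
  shows "\<not> packs (Suc t) (edges H)"
proof
  have fin: "finite (verts H)" and B: "B \<subseteq> verts H" "card B = t" and bal: "balanced (verts H - B) c"
    and EH: "edges H = {e. e \<subseteq> verts H \<and> card e = 4 \<and> (e \<inter> B = {} \<longrightarrow> inj_on c e)}"
    using H unfolding extremal_structure_def by blast+
  have finB: "finite B" using fin B(1) by (rule rev_finite_subset)
  assume "packs (Suc t) (edges H)"
  then obtain P where P: "finite P" "card P = Suc t" "\<forall>S\<in>P. tri (edges H) S" "pairwise disjnt P"
    by (auto simp: packs_def)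
  have "S \<inter> B \<noteq> {}" if SP: "S \<in> P" for S
  proof
    assume SB: "S \<inter> B = {}"
    obtain T x y z w where S: "S = T \<union> {x, y, z, w}" "card T = 3" "card S = 7"
      "insert x T \<in> edges H" "insert y T \<in> edges H" "{x, y, z, w} \<in> edges H"
      using P(3)[rule_format, OF SP] by (auto simp: tri_def)
    have cross: "e \<in> crossing (verts H - B) c {..<4}" if "e \<in> edges H" "e \<subseteq> S" for e
      using that SB bal unfolding EH by (intro rainbow_eq_crossing) (auto simp: balanced_def)
    have finT: "finite T" using S(2) by (metis card.infinite zero_neq_numeral)
    have fresh: "u \<notin> T \<and> c u \<notin> c ` T \<and> insert (c u) (c ` T) = {..<4}"
      if "insert u T \<in> edges H" "insert u T \<subseteq> S" for u
    proof -
      have u: "u \<notin> T" using that(1) S(2) finT unfolding EH by (auto simp: insert_absorb)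
      have "inj_on c (insert u T)" "c ` insert u T = {..<4}"
        using cross[OF that] by (auto simp: crossing_def)
      then show ?thesis using u by (auto simp: inj_on_def)
    qed
    have "c x = c y" using fresh[OF S(4)] fresh[OF S(5)] S(1) by blast
    moreover have "inj_on c {x, y, z, w}" using cross[OF S(6)] S(1) by (auto simp: crossing_def)
    ultimately have "x = y" by (auto dest: inj_onD)
    then have "S = T \<union> {y, z, w}" using S(1) by auto
    then have "card S \<le> card T + card {y, z, w}" using card_Un_le[of T "{y, z, w}"] by (simp only:)
    also have "card {y, z, w} \<le> 3" by (simp add: card_insert_if)
    finally show False using S(2,3) by simp
  qed
  then have "\<forall>S. \<exists>b. S \<in> P \<longrightarrow> b \<in> S \<inter> B" by blast
  then obtain b where b: "\<And>S. S \<in> P \<Longrightarrow> b S \<in> S \<inter> B" by metis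
  have "inj_on b P"
  proof (rule inj_onI, rule ccontr)
    fix S S' assume S: "S \<in> P" "S' \<in> P" "b S = b S'" "S \<noteq> S'"
    then have "disjnt S S'" using P(4) by (auto simp: pairwise_def)
    then show False using b[OF S(1)] b[OF S(2)] S(3) by (auto simp: disjnt_def)
  qed
  moreover have "b ` P \<subseteq> B" using b by auto
  ultimately have "card P \<le> card B" using finB by (rule card_inj_on_le)
  then show False using P(2) B(2) by simp
qed

lemma card_edges_extremal_structure:
  assumes H: "extremal_structure t H B c"
  shows "card (edges H) + ((card (verts H) - t) choose 4) =
    (card (verts H) choose 4) + turan4 (card (verts H) - t)"
proof -
  define V where "V = verts H"
  have fin: "finite V" and B: "B \<subseteq> V" "card B = t" and bal: "balanced (V - B) c"
    and EH: "edges H = {e. e \<subseteq> V \<and> card e = 4 \<and> (e \<inter> B = {} \<longrightarrow> inj_on c e)}"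
    using H unfolding extremal_structure_def V_def by blast+
  have finB: "finite B" using fin B(1) by (rule rev_finite_subset)
  have cVB: "card (V - B) = card V - t" using card_Diff_subset[OF finB B(1)] B(2) by simp
  have c4: "c v < 4" if "v \<in> V - B" for v using bal that by (simp add: balanced_def)
  define M where "M = {e. e \<subseteq> V \<and> card e = 4 \<and> e \<inter> B \<noteq> {}}"
  define R where "R = crossing (V - B) c {..<4}"
  have R: "R = {e. e \<subseteq> V - B \<and> card e = 4 \<and> inj_on c e}" unfolding R_def by (rule crossing_eq_rainbow[OF c4])
  have "edges H = M \<union> R" "M \<inter> R = {}" unfolding EH M_def R by blast+
  moreover have "finite M" "finite R"
    using fin by (auto simp: M_def R_def intro: finite_crossing finite_subset[of M "Pow V"])
  ultimately have "card (edges H) = card M + card R" by (simp add: card_Un_disjoint)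
  moreover have "card R = turan4 (card V - t)"
  proof -
    have "card R = (\<Prod>i<4. card {v \<in> V - B. c v = i})" unfolding R_def using fin by (intro card_crossing) simp
    also have "\<dots> = turan4 (\<Sum>i<4. card {v \<in> V - B. c v = i})"
      using bal by (intro balanced_prod_eq_turan4) (simp add: balanced_def)
    also have "(\<Sum>i<4. card {v \<in> V - B. c v = i}) = card V - t"
      unfolding cVB[symmetric] using fin c4 by (intro sum_card_classes) auto
    finally show ?thesis .
  qed
  moreover have "card M + ((card V - t) choose 4) = card V choose 4"
    unfolding M_def using card_edges_meeting[OF fin B(1)] B(2) by simp
  ultimately show ?thesis by (simp add: V_def)
qed

section \<open>The join and its copy on natural numbers as extremal structures\<close>

lemma balanced_turan_part: "balanced {1..m} (\<lambda>y. y mod 4)"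
proof -
  have part: "\<lfloor>real m / 4\<rfloor> \<le> int (card {v \<in> {1..m}. v mod 4 = i}) \<and>
      int (card {v \<in> {1..m}. v mod 4 = i}) \<le> \<lfloor>real m / 4\<rfloor> + 1" if "i < 4" for i
  proof -
    have "\<lceil>real m / 4\<rceil> \<le> \<lfloor>real m / 4\<rfloor> + 1" "\<lfloor>real m / 4\<rfloor> \<le> \<lceil>real m / 4\<rceil>" by linarith+
    then show ?thesis using card_turan_part[OF that, of m] by (auto simp: turan_part_def)
  qed
  have "card {v \<in> {1..m}. v mod 4 = i} \<le> card {v \<in> {1..m}. v mod 4 = j} + 1" if "i < 4" "j < 4" for i j
    using part[OF that(1)] part[OF that(2)] by linarith
  then show ?thesis by (simp add: balanced_def)
qed

text \<open>\<open>free_graphs\<close> contains only hypergraphs on natural numbers, whereas the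
  join lives on a sum type, so a copy of it is needed as competitor. Using the last \<open>t\<close>
  numbers for \<open>B\<close> leaves an initial segment, which residues split evenly.\<close>

lemma extremal_structure_exists:
  assumes "t \<le> n"
  obtains H :: "nat hypergraph" and B c where "extremal_structure t H B c" "card (verts H) = n"
proof -
  define E where "E = {e. e \<subseteq> {1..n} \<and> card e = 4 \<and> (e \<inter> {n - t<..n} = {} \<longrightarrow> inj_on (\<lambda>y. y mod 4) e)}"
  have "{1..n} - {n - t<..n} = {1..n - t}" using assms by auto
  then have "extremal_structure t (Hypergraph {1..n} E) {n - t<..n} (\<lambda>y. y mod 4)"
    using assms balanced_turan_part[of "n - t"] by (auto simp: extremal_structure_def E_def)
  then show ?thesis using that by force
qed

lemma card_le_1_iff_inj_on_mod:
  assumes "e \<subseteq> {1..m}"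
  shows "(\<forall>i<4. card (e \<inter> turan_part m 4 i) \<le> 1) \<longleftrightarrow> inj_on (\<lambda>y. y mod 4) e"
proof -
  have fin: "finite (e \<inter> turan_part m 4 i)" for i by (simp add: turan_part_def)
  have "card (e \<inter> turan_part m 4 i) \<le> 1 \<longleftrightarrow> (\<forall>u\<in>e. \<forall>v\<in>e. u mod 4 = i \<longrightarrow> v mod 4 = i \<longrightarrow> u = v)" for i
  proof -
    have "y \<in> e \<inter> turan_part m 4 i \<longleftrightarrow> y \<in> e \<and> y mod 4 = i" for y using assms by (auto simp: turan_part_def)
    then show ?thesis unfolding One_nat_def card_le_Suc0_iff_eq[OF fin] by blast
  qed
  moreover have "u mod 4 < 4" for u :: nat by simp
  ultimately show ?thesis unfolding inj_on_def by metis
qed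

lemma extremal_structure_join:
  "extremal_structure t (join 4 (complete_graph 4 t) (turan_graph 4 m 4)) (Inl ` {1..t})
     (case_sum (\<lambda>_. 0) (\<lambda>y. y mod 4))"
proof -
  let ?B = "Inl ` {1..t} :: (nat + nat) set"
  \<comment> \<open>The colour 0 on the left summand is a dummy: colours matter only off
    \<open>?B\<close>.\<close>
  let ?c = "case_sum (\<lambda>_. 0) (\<lambda>y. y mod 4) :: nat + nat \<Rightarrow> nat"
  let ?J = "join 4 (complete_graph 4 t) (turan_graph 4 m 4)"
  have V: "verts ?J = {1..t} <+> {1..m}" by (simp add: join_def complete_graph_def turan_graph_def)
  have VB: "verts ?J - ?B = Inr ` {1..m}" unfolding V by auto
  have classes: "{v \<in> Inr ` {1..m}. ?c v = i} = Inr ` {v \<in> {1..m}. v mod 4 = i}" for i by auto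
  have bal: "balanced (verts ?J - ?B) ?c"
    using balanced_turan_part[of m] unfolding VB balanced_def classes
    by (simp add: card_image)
  have inr: "e \<subseteq> {1..t} <+> {1..m} \<and> card e = 4 \<and> e \<inter> ?B = {} \<and> inj_on ?c e \<longleftrightarrow>
      e \<in> (\<lambda>e. Inr ` e) ` {e. e \<subseteq> {1..m} \<and> card e = 4 \<and> (\<forall>i<4. card (e \<inter> turan_part m 4 i) \<le> 1)}" for e
  proof
    assume e: "e \<subseteq> {1..t} <+> {1..m} \<and> card e = 4 \<and> e \<inter> ?B = {} \<and> inj_on ?c e"
    then have "e \<subseteq> Inr ` {1..m}" unfolding Plus_def by blast
    then obtain e' where e': "e' \<subseteq> {1..m}" "e = Inr ` e'" by (auto simp: subset_image_iff)
    have "inj_on (\<lambda>y. y mod 4) e'" using e e' by (auto simp: inj_on_def)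
    then show "e \<in> (\<lambda>e. Inr ` e) ` {e. e \<subseteq> {1..m} \<and> card e = 4 \<and> (\<forall>i<4. card (e \<inter> turan_part m 4 i) \<le> 1)}"
      using e e' card_le_1_iff_inj_on_mod[OF e'(1)] by (auto simp: card_image)
  next
    assume "e \<in> (\<lambda>e. Inr ` e) ` {e. e \<subseteq> {1..m} \<and> card e = 4 \<and> (\<forall>i<4. card (e \<inter> turan_part m 4 i) \<le> 1)}"
    then obtain e' where e': "e' \<subseteq> {1..m}" "card e' = 4" "\<forall>i<4. card (e' \<inter> turan_part m 4 i) \<le> 1" "e = Inr ` e'"
      by auto
    have "inj_on (\<lambda>y. y mod 4) e'" using e'(3) card_le_1_iff_inj_on_mod[OF e'(1)] by blast
    then show "e \<subseteq> {1..t} <+> {1..m} \<and> card e = 4 \<and> e \<inter> ?B = {} \<and> inj_on ?c e"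
      using e' by (auto simp: card_image inj_on_def)
  qed
  have inl: "e \<subseteq> ?B \<and> card e = 4 \<longleftrightarrow> e \<in> (\<lambda>e. Inl ` e) ` {e. e \<subseteq> {1..t} \<and> card e = 4}" for e
    by (auto simp: card_image subset_image_iff)
  have "edges ?J = {e. e \<subseteq> verts ?J \<and> card e = 4 \<and> (e \<inter> ?B = {} \<longrightarrow> inj_on ?c e)}"
  proof (rule set_eqI)
    fix e :: "(nat + nat) set"
    have "e \<in> edges ?J \<longleftrightarrow> e \<in> (\<lambda>e. Inl ` e) ` {e. e \<subseteq> {1..t} \<and> card e = 4} \<or>
      e \<in> (\<lambda>e. Inr ` e) ` {e. e \<subseteq> {1..m} \<and> card e = 4 \<and> (\<forall>i<4. card (e \<inter> turan_part m 4 i) \<le> 1)} \<or>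
      (e \<subseteq> {1..t} <+> {1..m} \<and> card e = 4 \<and> e \<inter> ?B \<noteq> {} \<and> e \<inter> Inr ` {1..m} \<noteq> {})"
      by (simp add: join_def complete_graph_def turan_graph_def)
    also have "\<dots> \<longleftrightarrow> (e \<subseteq> ?B \<and> card e = 4) \<or>
      (e \<subseteq> {1..t} <+> {1..m} \<and> card e = 4 \<and> e \<inter> ?B = {} \<and> inj_on ?c e) \<or>
      (e \<subseteq> {1..t} <+> {1..m} \<and> card e = 4 \<and> e \<inter> ?B \<noteq> {} \<and> e \<inter> Inr ` {1..m} \<noteq> {})"
      unfolding inl[symmetric] inr[symmetric] ..
    also have "\<dots> \<longleftrightarrow> e \<subseteq> verts ?J \<and> card e = 4 \<and> (e \<inter> ?B = {} \<longrightarrow> inj_on ?c e)"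
    proof -
      \<comment> \<open>The edges of the complete part and those meeting both parts are together
        exactly the 4-sets meeting \<open>?B\<close>.\<close>
      have "?B \<subseteq> {1..t} <+> {1..m}" by auto
      moreover have "e \<subseteq> ?B" if "e \<subseteq> {1..t} <+> {1..m}" "e \<inter> Inr ` {1..m} = {}"
        using that unfolding Plus_def by blast
      moreover have "e \<inter> ?B \<noteq> {}" if "e \<subseteq> ?B" "card e = 4"
      proof -
        have "e \<noteq> {}" using that by auto
        then show ?thesis using that(1) by blast
      qed
      ultimately show ?thesis unfolding V by blast
    qed
    finally show "e \<in> edges ?J \<longleftrightarrow> e \<in> {e. e \<subseteq> verts ?J \<and> card e = 4 \<and> (e \<inter> ?B = {} \<longrightarrow> inj_on ?c e)}"
      by simp
  qed
  then show ?thesis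
    using bal unfolding extremal_structure_def by (auto simp: V card_image)
qed

theorem theorem2p4:
  shows "\<exists>(N0 :: nat) (c :: real). c > 0 \<and>
    (\<forall>(n :: nat) (t :: nat). n \<ge> N0 \<longrightarrow> real t \<le> c * real n \<longrightarrow>
      Ex_classes 4 n (t + 1) T4 = {iso_class (join 4 (complete_graph 4 t) (turan_graph 4 (n - t) 4))})"
\<comment> \<open>The factor 2 guarantees that more than \<open>M0 + M0 ^ 4\<close> vertices remain
  after removing the large vertices, and at least that many after also removing a packing.\<close>
proof (intro exI[of _ "2 * (M0 + M0 ^ 4)"] exI[of _ "1 / 10000000000"] conjI allI impI)
  fix n t :: nat
  assume n: "2 * (M0 + M0 ^ 4) \<le> n" and "real t \<le> 1 / 10000000000 * real n"
  then have t: "real t \<le> real n / 10000000000" by simp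
  then have tn: "t \<le> n" by simp
  let ?J = "join 4 (complete_graph 4 t) (turan_graph 4 (n - t) 4)"
  note J = extremal_structure_join[of t "n - t"]
  have "verts ?J = {1..t} <+> {1..n - t}" by (simp add: join_def complete_graph_def turan_graph_def)
  then have cJ: "card (verts ?J) = n" using tn by (simp add: card_Plus)
  obtain H0 :: "nat hypergraph" and B0 c0 where H0: "extremal_structure t H0 B0 c0" "card (verts H0) = n"
    using extremal_structure_exists[OF tn] .
  have r0: "r_graph 4 H0" using H0(1) by (auto simp: extremal_structure_def r_graph_def hypergraph_def)
  have free0: "H0 \<in> free_graphs 4 n (t + 1) T4"
    using r0 H0 extremal_structure_not_packs[OF H0(1)] contains_iff_packs[of H0]
    by (simp add: free_graphs_def r_graph_def)
  have card0: "card (edges H0) + ((n - t) choose 4) = (n choose 4) + turan4 (n - t)"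
    using card_edges_extremal_structure[OF H0(1)] H0(2) by simp
  \<comment> \<open>Any competitor with at least as many edges as \<open>H0\<close> has equally many
    and is isomorphic to the join. Applied to \<open>H0\<close> itself this identifies its class;
    applied to the others it yields both maximality and uniqueness.\<close>
  have dense: "card (edges G) = card (edges H0) \<and> isomorphic G ?J"
    if G: "G \<in> free_graphs 4 n (t + 1) T4" and le: "card (edges H0) \<le> card (edges G)" for G
  proof -
    have hyp: "hypergraph G" and cV: "card (verts G) = n" using G by (auto simp: free_graphs_def r_graph_def)
    have fin: "finite (verts G)" using hyp by (simp add: hypergraph_def)
    have E: "e \<subseteq> verts G \<and> card e = 4" if "e \<in> edges G" for e
      using that G by (auto simp: free_graphs_def r_graph_def hypergraph_def)
    have np: "\<not> packs (Suc t) (edges G)"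
      using G contains_iff_packs[OF hyp] by (simp add: free_graphs_def)
    have d: "(card (verts G) choose 4) + turan4 (card (verts G) - t) \<le>
        card (edges G) + ((card (verts G) - t) choose 4)"
      using card0 le unfolding cV by linarith
    note res = disjoint_tri_extremal[OF fin E np _ _ d, unfolded cV, OF _ n t]
    obtain B c where "extremal_structure t G B c"
      using res(2) fin unfolding extremal_structure_def cV by blast
    then have "isomorphic G ?J" by (rule extremal_structure_isomorphic[OF _ J]) (simp add: cV cJ)
    then show ?thesis using res(1) card0 by simp
  qed
  have iso: "isomorphic H0 ?J" using dense[OF free0] by simp
  have max0: "\<forall>G\<in>free_graphs 4 n (t + 1) T4. card (edges G) \<le> card (edges H0)"
    using dense by (metis linear order_refl)
  show "Ex_classes 4 n (t + 1) T4 = {iso_class ?J}"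
  proof
    show "Ex_classes 4 n (t + 1) T4 \<subseteq> {iso_class ?J}"
      unfolding Ex_classes_def using dense free0 iso_class_eq by fastforce
    have "iso_class ?J = iso_class H0" using iso_class_eq[OF iso] by simp
    then show "{iso_class ?J} \<subseteq> Ex_classes 4 n (t + 1) T4"
      unfolding Ex_classes_def using free0 max0 by blast
  qed
qed simp

end
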